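(* Let the dimension be $d=1$. Let $\{X^i_t\}_{i=1}^N$ evolve according to the finite-$N$ deterministic linear feedback particle filter $$dX^i_t = A m^{(N)}_t\,dt + \mathsf{K}^{(N)}_t\big(dZ_t - C m^{(N)}_t\,dt\big) + G^{(N)}_t\big(X^i_t - m^{(N)}_t\big)dt,\qquad i=1,\dots,N,$$ with $X^i_0$ i.i.d. $\sim\mathcal N(m_0,\Sigma_0)$, and let $\{\bar X^i_t\}_{i=1}^N$ evolve according to its mean-field model $$d\bar X^i_t = A\bar m_t\,dt+\bar{\mathsf{K}}_t\big(dZ_t-C\bar m_t\,dt\big)+\bar G_t\big(\bar X^i_t-\bar m_t\big)dt,\qquad \bar X^i_0=X^i_0 .$$ Assume that $(A,C)$ is detectable, that $(A,\sigma_B)$ is stabilizable, and that the initial empirical covariance $\Sigma^{(N)}_0$ is invertible. Then: (i) The explicit solutions are $$X^i_t=m^{(N)}_t+\Big(\frac{\Sigma^{(N)}_t}{\Sigma^{(N)}_0}\Big)^{1/2}\big(X^i_0-m^{(N)}_0\big),\qquad \bar X^i_t=m_t+\Big(\frac{\Sigma_t}{\Sigma_0}\Big)^{1/2}\big(X^i_0-m_0\big),$$ where $(m_t,\Sigma_t)$ is the Kalman–Bucy filter mean and covariance. (ii) For a fixed $t>0$, in the limit as $N\to\infty$, $$\mathsf{E}\big[|X^i_t-\bar X^i_t|^2\big]\le\frac{\text{(const.)}}{N},$$ where the constant does not depend on $N$.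
   Context: Linear Gaussian filtering model (here with state dimension $d=1$): $dX_t = AX_t\,dt + \sigma_B\,dB_t$, $dZ_t = CX_t\,dt + dW_t$, with constant $A,C,\sigma_B$, $\{B_t\},\{W_t\}$ mutually independent standard Wiener processes, and $X_0\sim\mathcal N(m_0,\Sigma_0)$ with $\Sigma_0>0$, independent of $\{B_t\},\{W_t\}$. $\mathcal Z_t:=\sigma(Z_s;s\in[0,t])$. Kalman–Bucy filter: $dm_t = Am_t\,dt+\Sigma_tC^\top(dZ_t-Cm_t\,dt)$, $\frac{d\Sigma_t}{dt}=A\Sigma_t+\Sigma_tA^\top+\sigma_B\sigma_B^\top-\Sigma_tC^\top C\Sigma_t$, initialized with $(m_0,\Sigma_0)$. Particle filter notation: $m^{(N)}_t:=\frac1N\sum_{i=1}^N X^i_t$, $\Sigma^{(N)}_t:=\frac{1}{N-1}\sum_{i=1}^N (X^i_t-m^{(N)}_t)(X^i_t-m^{(N)}_t)^\top$, $\mathsf{K}^{(N)}_t:=\Sigma^{(N)}_tC^\top$, and $G^{(N)}_t := A - \tfrac12\mathsf{K}^{(N)}_tC + \tfrac12\sigma_B\sigma_B^\top(\Sigma^{(N)}_t)^{-1}+\Omega_t(\Sigma^{(N)}_t)^{-1}$ with $\Omega_t$ skew-symmetric (so $\Omega_t=0$ when $d=1$). Mean-field notation: $\bar m_t=\mathsf{E}[\bar X^i_t|\mathcal Z_t]$, $\bar\Sigma_t=\mathsf{E}[(\bar X^i_t-\bar m_t)(\bar X^i_t-\bar m_t)^\top|\mathcal Z_t]$, $\bar{\mathsf{K}}_t=\bar\Sigma_tC^\top$,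 $\bar G_t:=A-\tfrac12\bar{\mathsf{K}}_tC+\tfrac12\sigma_B\sigma_B^\top\bar\Sigma_t^{-1}+\Omega_t\bar\Sigma_t^{-1}$. It is a known result (exactness of the mean-field filter) that $\bar m_t=m_t$ and $\bar\Sigma_t=\Sigma_t$. All filters are driven by the same observation process $Z_t$. The statement in (ii) is for sufficiently large $N$. *)

theory Defs
  imports "HOL-Probability.Probability"
begin

text \<open>
  The state is scalar. The observation and the signal noise are vector valued: the \<open>m \<times> 1\<close> matrix
  \<open>C\<close> is a vector in \<open>real ^ 'm\<close>, the \<open>1 \<times> q\<close> matrix \<open>\<sigma>\<^sub>B\<close> is a vector \<open>sB\<close> in \<open>real ^ 'q\<close>, and a
  \<open>1 \<times> m\<close> gain is again a vector in \<open>real ^ 'm\<close>, acting by the inner product. Time ranges over \<open>t \<ge> 0\<close>;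
  the values of processes at negative times are irrelevant.
\<close>

definition detectable :: "real \<Rightarrow> real ^ 'm \<Rightarrow> bool" where
  "detectable A C \<longleftrightarrow> (\<exists>L :: real ^ 'm. A - L \<bullet> C < 0)"

definition stabilizable :: "real \<Rightarrow> real ^ 'q \<Rightarrow> bool" where
  "stabilizable A sB \<longleftrightarrow> (\<exists>L :: real ^ 'q. A - sB \<bullet> L < 0)"

definition generated_sigma ::
    "'a measure \<Rightarrow> ('i \<Rightarrow> 'a \<Rightarrow> 'b :: topological_space) \<Rightarrow> 'i set \<Rightarrow> 'a measure" where
  "generated_sigma M Y T =
     sigma (space M) (\<Union>t\<in>T. {Y t -` U \<inter> space M | U. U \<in> sets borel})"

definition continuous_process ::
    "'a measure \<Rightarrow> (real \<Rightarrow> 'a \<Rightarrow> 'b :: topological_space) \<Rightarrow> bool" where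
  "continuous_process M Y \<longleftrightarrow>
     (\<forall>t\<ge>0. Y t \<in> borel_measurable M) \<and>
     (AE \<omega> in M. continuous_on {0..} (\<lambda>t. Y t \<omega>))"

definition standard_wiener :: "'a measure \<Rightarrow> (real \<Rightarrow> 'a \<Rightarrow> real ^ 'm) \<Rightarrow> bool" where
  "standard_wiener M W \<longleftrightarrow>
     continuous_process M W \<and>
     (AE \<omega> in M. W 0 \<omega> = 0) \<and>
     (\<forall>n (\<tau> :: nat \<Rightarrow> real). 0 \<le> \<tau> 0 \<and> (\<forall>k<n. \<tau> k \<le> \<tau> (Suc k)) \<longrightarrow>
        prob_space.indep_vars M (\<lambda>_. borel) (\<lambda>k \<omega>. W (\<tau> (Suc k)) \<omega> - W (\<tau> k) \<omega>) {..<n}) \<and>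
     (\<forall>s t. 0 \<le> s \<and> s < t \<longrightarrow>
        prob_space.indep_vars M (\<lambda>_. borel) (\<lambda>j \<omega>. (W t \<omega> - W s \<omega>) $ j) UNIV \<and>
        (\<forall>j. distributed M lborel (\<lambda>\<omega>. (W t \<omega> - W s \<omega>) $ j)
               (normal_density 0 (sqrt (t - s)))))"

text \<open>
  \<open>J\<close> is a continuous version of the It\^o integral \<open>\<integral> H \<bullet> dZ\<close>. For an adapted integrand with continuous
  paths and a continuous semimartingale \<open>Z\<close>, the It\^o integral over \<open>[0,t]\<close> is the limit in
  probability of the left-endpoint sums along partitions whose mesh tends to 0; this is taken as the
  definition. All the integrands below are continuous.
\<close>

definition ito_integral ::
    "'a measure \<Rightarrow> (real \<Rightarrow> 'a \<Rightarrow> real ^ 'm) \<Rightarrow> (real \<Rightarrow> 'a \<Rightarrow> real ^ 'm) \<Rightarrow> (real \<Rightarrow> 'a \<Rightarrow> real) \<Rightarrow> bool"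
  where
  "ito_integral M H Z J \<longleftrightarrow>
     continuous_process M J \<and>
     (\<forall>t\<ge>0. \<forall>\<epsilon>>0. \<exists>\<delta>>0. \<forall>n (\<tau> :: nat \<Rightarrow> real).
        \<tau> 0 = 0 \<and> \<tau> n = t \<and> (\<forall>k<n. \<tau> k \<le> \<tau> (Suc k) \<and> \<tau> (Suc k) - \<tau> k < \<delta>) \<longrightarrow>
        measure M {\<omega> \<in> space M.
          \<bar>(\<Sum>k<n. H (\<tau> k) \<omega> \<bullet> (Z (\<tau> (Suc k)) \<omega> - Z (\<tau> k) \<omega>)) - J t \<omega>\<bar> > \<epsilon>} < \<epsilon>)"

text \<open>The noise is additive, so the model equations need no stochastic integral. As usual, \<open>Z\<^sub>0 = 0\<close>.\<close>

definition linear_gaussian_model ::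
    "'a measure \<Rightarrow> real \<Rightarrow> real ^ 'm \<Rightarrow> real ^ 'q \<Rightarrow> real \<Rightarrow> real \<Rightarrow>
     (real \<Rightarrow> 'a \<Rightarrow> real) \<Rightarrow> (real \<Rightarrow> 'a \<Rightarrow> real ^ 'q) \<Rightarrow> (real \<Rightarrow> 'a \<Rightarrow> real ^ 'm) \<Rightarrow>
     (real \<Rightarrow> 'a \<Rightarrow> real ^ 'm) \<Rightarrow> bool" where
  "linear_gaussian_model M A C sB m0 S0 X B W Z \<longleftrightarrow>
     standard_wiener M B \<and> standard_wiener M W \<and>
     distributed M lborel (X 0) (normal_density m0 (sqrt S0)) \<and>
     prob_space.indep_sets M
       (\<lambda>k. [sets (generated_sigma M X {0}),
             sets (generated_sigma M B {0..}),
             sets (generated_sigma M W {0..})] ! k) {..<3::nat} \<and>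
     continuous_process M X \<and>
     (AE \<omega> in M. \<forall>t\<ge>0. X t \<omega> = X 0 \<omega> + integral {0..t} (\<lambda>s. A * X s \<omega>) + sB \<bullet> B t \<omega>) \<and>
     continuous_process M Z \<and>
     (AE \<omega> in M. \<forall>t\<ge>0. Z t \<omega> = integral {0..t} (\<lambda>s. X s \<omega> *\<^sub>R C) + W t \<omega>)"

text \<open>
  \<open>Y\<close> solves \<open>dY = A \<mu> dt + K (dZ - C \<mu> dt) + G (Y - \<mu>) dt\<close>. The three filters below are instances.
\<close>

definition filter_sde ::
    "'a measure \<Rightarrow> real \<Rightarrow> real ^ 'm \<Rightarrow> (real \<Rightarrow> 'a \<Rightarrow> real ^ 'm) \<Rightarrow>
     (real \<Rightarrow> 'a \<Rightarrow> real ^ 'm) \<Rightarrow> (real \<Rightarrow> 'a \<Rightarrow> real) \<Rightarrow> (real \<Rightarrow> 'a \<Rightarrow> real) \<Rightarrow>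
     (real \<Rightarrow> 'a \<Rightarrow> real) \<Rightarrow> bool" where
  "filter_sde M A C Z K G \<mu> Y \<longleftrightarrow>
     continuous_process M Y \<and>
     (\<exists>J. ito_integral M K Z J \<and>
        (AE \<omega> in M. \<forall>t\<ge>0. Y t \<omega> = Y 0 \<omega> + J t \<omega> +
           integral {0..t} (\<lambda>s. A * \<mu> s \<omega> - (K s \<omega> \<bullet> C) * \<mu> s \<omega> + G s \<omega> * (Y s \<omega> - \<mu> s \<omega>))))"

definition kalman_bucy ::
    "'a measure \<Rightarrow> real \<Rightarrow> real ^ 'm \<Rightarrow> real ^ 'q \<Rightarrow> real \<Rightarrow> real \<Rightarrow> (real \<Rightarrow> 'a \<Rightarrow> real ^ 'm) \<Rightarrow>
     (real \<Rightarrow> 'a \<Rightarrow> real) \<Rightarrow> (real \<Rightarrow> real) \<Rightarrow> bool" where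
  "kalman_bucy M A C sB m0 S0 Z m S \<longleftrightarrow>
     S 0 = S0 \<and>
     (\<forall>t\<ge>0. (S has_real_derivative (A * S t + S t * A + sB \<bullet> sB - S t * (C \<bullet> C) * S t))
              (at t within {0..})) \<and>
     (AE \<omega> in M. m 0 \<omega> = m0) \<and>
     filter_sde M A C Z (\<lambda>t \<omega>. S t *\<^sub>R C) (\<lambda>t \<omega>. 0) m m"

text \<open>In dimension one the skew-symmetric \<open>\<Omega>\<^sub>t\<close> vanishes.\<close>

definition fpf_gain :: "real \<Rightarrow> real ^ 'm \<Rightarrow> real ^ 'q \<Rightarrow> real \<Rightarrow> real" where
  "fpf_gain A C sB S = A - 1/2 * ((S *\<^sub>R C) \<bullet> C) + 1/2 * (sB \<bullet> sB) * inverse S"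

definition emp_mean :: "nat \<Rightarrow> (nat \<Rightarrow> real \<Rightarrow> 'a \<Rightarrow> real) \<Rightarrow> real \<Rightarrow> 'a \<Rightarrow> real" where
  "emp_mean N X t \<omega> = 1 / real N * (\<Sum>i<N. X i t \<omega>)"

definition emp_cov :: "nat \<Rightarrow> (nat \<Rightarrow> real \<Rightarrow> 'a \<Rightarrow> real) \<Rightarrow> real \<Rightarrow> 'a \<Rightarrow> real" where
  "emp_cov N X t \<omega> = 1 / (real N - 1) * (\<Sum>i<N. (X i t \<omega> - emp_mean N X t \<omega>)\<^sup>2)"

definition finite_fpf ::
    "'a measure \<Rightarrow> real \<Rightarrow> real ^ 'm \<Rightarrow> real ^ 'q \<Rightarrow> (real \<Rightarrow> 'a \<Rightarrow> real ^ 'm) \<Rightarrow>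
     nat \<Rightarrow> (nat \<Rightarrow> real \<Rightarrow> 'a \<Rightarrow> real) \<Rightarrow> bool" where
  "finite_fpf M A C sB Z N X \<longleftrightarrow>
     (\<forall>i<N. filter_sde M A C Z
        (\<lambda>t \<omega>. emp_cov N X t \<omega> *\<^sub>R C)
        (\<lambda>t \<omega>. fpf_gain A C sB (emp_cov N X t \<omega>))
        (emp_mean N X) (X i))"

text \<open>
  Conditional expectations are determined only almost surely, so the conditional mean and covariance
  enter the mean-field equation through versions \<open>mb\<close>, \<open>Sb\<close> with continuous paths. Square
  integrability makes the conditional expectations meaningful, and the equation contains the inverse
  of the conditional covariance.
\<close>

definition mean_field_fpf ::
    "'a measure \<Rightarrow> real \<Rightarrow> real ^ 'm \<Rightarrow> real ^ 'q \<Rightarrow> (real \<Rightarrow> 'a \<Rightarrow> real ^ 'm) \<Rightarrow>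
     (real \<Rightarrow> 'a \<Rightarrow> real) \<Rightarrow> bool" where
  "mean_field_fpf M A C sB Z Y \<longleftrightarrow>
     (\<forall>t\<ge>0. integrable M (\<lambda>\<omega>. (Y t \<omega>)\<^sup>2)) \<and>
     (\<exists>mb Sb. continuous_process M mb \<and> continuous_process M Sb \<and>
        (\<forall>t\<ge>0. AE \<omega> in M.
           mb t \<omega> = real_cond_exp M (generated_sigma M Z {0..t}) (Y t) \<omega>) \<and>
        (\<forall>t\<ge>0. AE \<omega> in M.
           Sb t \<omega> = real_cond_exp M (generated_sigma M Z {0..t}) (\<lambda>\<omega>'. (Y t \<omega>' - mb t \<omega>')\<^sup>2) \<omega>) \<and>
        (AE \<omega> in M. \<forall>t\<ge>0. Sb t \<omega> \<noteq> 0) \<and>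
        filter_sde M A C Z
          (\<lambda>t \<omega>. Sb t \<omega> *\<^sub>R C)
          (\<lambda>t \<omega>. fpf_gain A C sB (Sb t \<omega>))
          mb Y)"

text \<open>
  The particles are initialised with independent samples of the prior, drawn independently of
  \<open>(X\<^sub>0, B, W)\<close>.
\<close>

definition initial_ensemble ::
    "'a measure \<Rightarrow> real \<Rightarrow> real \<Rightarrow> (real \<Rightarrow> 'a \<Rightarrow> real) \<Rightarrow> (real \<Rightarrow> 'a \<Rightarrow> real ^ 'q) \<Rightarrow>
     (real \<Rightarrow> 'a \<Rightarrow> real ^ 'm) \<Rightarrow> nat \<Rightarrow> (nat \<Rightarrow> 'a \<Rightarrow> real) \<Rightarrow> bool" where
  "initial_ensemble M m0 S0 X B W N \<xi> \<longleftrightarrow>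
     prob_space.indep_vars M (\<lambda>_. borel) \<xi> {..<N} \<and>
     (\<forall>i<N. distributed M lborel (\<xi> i) (normal_density m0 (sqrt S0))) \<and>
     prob_space.indep_set M
       (sets (generated_sigma M \<xi> {..<N}))
       (sigma_sets (space M) (sets (generated_sigma M X {0}) \<union>
          sets (generated_sigma M B {0..}) \<union> sets (generated_sigma M W {0..})))"

definition coupled_fpf ::
    "'a measure \<Rightarrow> real \<Rightarrow> real ^ 'm \<Rightarrow> real ^ 'q \<Rightarrow> real \<Rightarrow> real \<Rightarrow>
     (real \<Rightarrow> 'a \<Rightarrow> real) \<Rightarrow> (real \<Rightarrow> 'a \<Rightarrow> real ^ 'q) \<Rightarrow> (real \<Rightarrow> 'a \<Rightarrow> real ^ 'm) \<Rightarrow>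
     (real \<Rightarrow> 'a \<Rightarrow> real ^ 'm) \<Rightarrow> nat \<Rightarrow> (nat \<Rightarrow> real \<Rightarrow> 'a \<Rightarrow> real) \<Rightarrow>
     (nat \<Rightarrow> real \<Rightarrow> 'a \<Rightarrow> real) \<Rightarrow> bool" where
  "coupled_fpf M A C sB m0 S0 X B W Z N Xp Xb \<longleftrightarrow>
     initial_ensemble M m0 S0 X B W N (\<lambda>i. Xp i 0) \<and>
     finite_fpf M A C sB Z N Xp \<and>
     (AE \<omega> in M. emp_cov N Xp 0 \<omega> \<noteq> 0) \<and>
     (\<forall>i<N. mean_field_fpf M A C sB Z (Xb i) \<and> (AE \<omega> in M. Xb i 0 \<omega> = Xp i 0 \<omega>))"

end

theory Submission
  imports Defs
begin

text \<open>
  In dimension one the deviations \<open>e = X\<^sup>i - m\<^sup>(\<^sup>N\<^sup>)\<close> of the particles from their empirical mean do not see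
  the observations: the innovation term is common to all particles, so \<open>e' = G e\<close> with the scalar gain
  \<open>G = A - \<Sigma> |C|\<^sup>2 / 2 + |\<sigma>\<^sub>B|\<^sup>2 / (2 \<Sigma>)\<close>. Hence all deviations are multiplied by the same factor
  \<open>exp (\<integral> G)\<close>, whose square is \<open>\<Sigma>\<^sub>t / \<Sigma>\<^sub>0\<close>, and \<open>\<Sigma>\<close> solves the Riccati equation, which keeps it positive.
  This is the explicit form of the particles (\<open>finite_fpf_path\<close>). For the mean-field particle the same linear
  equation gives \<open>Y = \<Phi> Y\<^sub>0 + U\<close> with \<open>\<Phi>\<close> and \<open>U\<close> determined by the observations and \<open>Y\<^sub>0\<close> independent of
  them, so the conditional mean is \<open>\<Phi> m\<^sub>0 + U\<close> and the conditional variance \<open>\<Phi>\<^sup>2 \<Sigma>\<^sub>0\<close>. The latter solves the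
  Riccati equation as well and therefore is the Kalman--Bucy variance; the former then is the
  Kalman--Bucy mean (\<open>mean_field_fpf_exact\<close>).

  The stochastic integrals are harmless: once a gain is known to be
  continuously differentiable in time, the Ito integral is the pathwise expression obtained by
  integration by parts (\<open>ito_integral_by_parts\<close>), and every equation becomes a linear ordinary
  differential equation along each path.

  For the error bound, write \<open>S\<close> for the Kalman--Bucy variance, \<open>R\<close> for the empirical variance,
  \<open>D\<^sub>0 = R\<^sub>0 - S\<^sub>0\<close> and \<open>E\<^sub>0 = m\<^sup>(\<^sup>N\<^sup>)\<^sub>0 - m\<^sub>0\<close>. The difference of the two means is exactly
  \<open>\<psi>\<^sub>t (E\<^sub>0 + D\<^sub>0 L\<^sub>t)\<close>, where \<open>\<psi>\<^sub>t = exp (\<integral> (A - |C|\<^sup>2 R)) \<le> exp (|A| t)\<close> and \<open>L\<^sub>t\<close> is a linear functional of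
  the observations with coefficients that depend on \<open>S\<close> only (\<open>kalman_mean_difference\<close>).
  The reason is that \<open>R - S = D\<^sub>0 \<phi> \<psi>\<close> with \<open>\<phi> = exp (\<integral> (A - |C|\<^sup>2 S))\<close>, so that in the variation of constants
  formula the kernel \<open>(R\<^sub>s - S\<^sub>s) / \<psi>\<^sub>s = D\<^sub>0 \<phi>\<^sub>s\<close> no longer involves \<open>R\<close>. Since the ensemble is independent of
  the model, \<open>E (D\<^sub>0 L\<^sub>t)\<^sup>2\<close> factors, and \<open>E D\<^sub>0\<^sup>2 = O(1/N)\<close>, \<open>E E\<^sub>0\<^sup>2 = O(1/N)\<close>, \<open>E L\<^sub>t\<^sup>2 < \<infinity>\<close> suffice.

  What remains is \<open>(\<rho> - \<sigma>) e\<^sub>0\<close> with \<open>\<rho> = \<surd>(R\<^sub>t / R\<^sub>0)\<close> and \<open>\<sigma> = \<surd>(S\<^sub>t / S\<^sub>0)\<close>. The factor \<open>\<rho>\<close> may blow up as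
  \<open>R\<^sub>0\<close> tends to 0, but it is a function of \<open>R\<^sub>0\<close> alone (\<open>riccati_closed_form\<close>), so exchangeability
  replaces \<open>e\<^sub>0\<^sup>2\<close> by its average over the ensemble, which is at most \<open>R\<^sub>0\<close>
  (\<open>iid_deviation_le_sample_var\<close>); and \<open>(\<rho> - \<sigma>)\<^sup>2 R\<^sub>0\<close> is bounded by a multiple of \<open>D\<^sub>0\<^sup>2\<close>
  (\<open>sqrt_scaling_error\<close>).
\<close>

section \<open>Linear and Riccati equations on the half-line\<close>

lemma integral_has_real_derivative_Ici:
  fixes g :: "real \<Rightarrow> real"
  assumes "continuous_on {0..} g" and "t \<ge> 0"
  shows "((\<lambda>x. integral {0..x} g) has_real_derivative g t) (at t within {0..})"
proof -
  have "continuous_on {0..t+1} g"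
    using assms(1) by (rule continuous_on_subset) auto
  then have "((\<lambda>x. integral {0..x} g) has_real_derivative g t) (at t within {0..t+1})"
    using assms(2) by (intro integral_has_real_derivative) auto
  moreover have "at t within {0..t+1} = at t within {0..}"
    by (rule at_within_nhd[of _ "{..<t+1}"]) auto
  ultimately show ?thesis by simp
qed

lemma continuous_on_integral_Ici:
  fixes g :: "real \<Rightarrow> real"
  assumes "continuous_on {0..} g"
  shows "continuous_on {0..} (\<lambda>t. integral {0..t} g)"
  by (rule DERIV_continuous_on) (use integral_has_real_derivative_Ici[OF assms] in auto)

lemma eq_if_same_derivative_Ici:
  fixes f g :: "real \<Rightarrow> real"
  assumes "\<And>t. t \<ge> 0 \<Longrightarrow> (f has_real_derivative d t) (at t within {0..})"
    and "\<And>t. t \<ge> 0 \<Longrightarrow> (g has_real_derivative d t) (at t within {0..})"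
    and "f 0 = g 0" and "t \<ge> 0"
  shows "f t = g t"
proof -
  have "\<exists>c. \<forall>x\<in>{0..}. f x - g x = c"
    by (rule has_field_derivative_zero_constant)
       (auto intro!: derivative_eq_intros assms(1,2))
  then obtain c where "\<And>x. x \<ge> 0 \<Longrightarrow> f x - g x = c" by auto
  from this[of 0] this[of t] show ?thesis using assms(3,4) by simp
qed

lemma has_derivative_if_integral_equation:
  fixes y g :: "real \<Rightarrow> real"
  assumes "continuous_on {0..} g" and "\<And>t. t \<ge> 0 \<Longrightarrow> y t = k + integral {0..t} g" and "t \<ge> 0"
  shows "(y has_real_derivative g t) (at t within {0..})"
proof -
  have "((\<lambda>x. k + integral {0..x} g) has_real_derivative g t) (at t within {0..})"
    by (auto intro!: derivative_eq_intros integral_has_real_derivative_Ici assms)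
  then show ?thesis
    using assms(2,3) by (auto intro: has_field_derivative_transform_within[where d=1])
qed

lemma integral_equation_if_has_derivative:
  fixes y g :: "real \<Rightarrow> real"
  assumes "\<And>t. t \<ge> 0 \<Longrightarrow> (y has_real_derivative g t) (at t within {0..})" and "t \<ge> 0"
  shows "y t = y 0 + integral {0..t} g"
proof -
  have "(g has_integral (y t - y 0)) {0..t}"
    using assms(2)
    by (intro fundamental_theorem_of_calculus)
       (auto simp: has_real_derivative_iff_has_vector_derivative[symmetric]
          intro: DERIV_subset[OF assms(1)])
  then show ?thesis by (simp add: integral_unique)
qed

text \<open>
  Variation of constants.
\<close>

lemma linear_ode_solution:
  fixes f a g :: "real \<Rightarrow> real"
  defines "P \<equiv> \<lambda>t. exp (integral {0..t} a)"
  assumes a: "continuous_on {0..} a" and g: "continuous_on {0..} g"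
    and f: "\<And>t. t \<ge> 0 \<Longrightarrow> (f has_real_derivative (a t * f t + g t)) (at t within {0..})"
    and "t \<ge> 0"
  shows "f t = P t * (f 0 + integral {0..t} (\<lambda>s. g s / P s))"
proof -
  have P: "(P has_real_derivative a s * P s) (at s within {0..})" if "s \<ge> 0" for s
    unfolding P_def
    by (auto intro!: derivative_eq_intros integral_has_real_derivative_Ici[OF a that])
  have P0: "P s > 0" "P s \<noteq> 0" for s by (auto simp: P_def)
  have cP: "continuous_on {0..} P"
    by (rule DERIV_continuous_on) (use P in auto)
  have cg: "continuous_on {0..} (\<lambda>s. g s / P s)"
    using P0 by (intro continuous_intros g cP) auto
  have "f t / P t = f 0 / P 0 + integral {0..t} (\<lambda>s. g s / P s)"
  proof (rule integral_equation_if_has_derivative[OF _ \<open>t \<ge> 0\<close>, where y = "\<lambda>s. f s / P s"])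
    fix s :: real assume s: "s \<ge> 0"
    show "((\<lambda>s. f s / P s) has_real_derivative g s / P s) (at s within {0..})"
      using P0 by (auto intro!: derivative_eq_intros f P s simp: field_simps)
  qed
  moreover have "P 0 = 1" by (simp add: P_def)
  ultimately show ?thesis using P0[of t] by (simp add: field_simps)
qed

lemma homogeneous_linear_ode_solution:
  fixes f a :: "real \<Rightarrow> real"
  assumes "continuous_on {0..} a"
    and "\<And>t. t \<ge> 0 \<Longrightarrow> (f has_real_derivative (a t * f t)) (at t within {0..})"
    and "t \<ge> 0"
  shows "f t = f 0 * exp (integral {0..t} a)"
  using linear_ode_solution[of a "\<lambda>_. 0" f t] assms by (simp add: mult.commute)

abbreviation riccati_rhs :: "real \<Rightarrow> real \<Rightarrow> real \<Rightarrow> real \<Rightarrow> real" where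
  "riccati_rhs a b c v \<equiv> 2 * a * v + b - c * v\<^sup>2"

definition riccati :: "real \<Rightarrow> real \<Rightarrow> real \<Rightarrow> (real \<Rightarrow> real) \<Rightarrow> bool" where
  "riccati a b c S \<longleftrightarrow>
     (\<forall>t\<ge>0. (S has_real_derivative riccati_rhs a b c (S t)) (at t within {0..}))"

lemma riccatiD:
  "riccati a b c S \<Longrightarrow> t \<ge> 0 \<Longrightarrow>
     (S has_real_derivative riccati_rhs a b c (S t)) (at t within {0..})"
  by (simp add: riccati_def)

lemma riccati_continuous: "riccati a b c S \<Longrightarrow> continuous_on {0..} S"
  by (rule DERIV_continuous_on) (auto simp: riccati_def)

text \<open>
  A Riccati equation is a linear equation with the solution itself in the coefficient, so the
  variation of constants formula displays positivity.
\<close>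

lemma riccati_pos:
  assumes S: "riccati a b c S" and "S 0 > 0" "b \<ge> 0" "t \<ge> 0"
  shows "S t > 0"
proof -
  note [continuous_intros] = riccati_continuous[OF S]
  define P where "P = (\<lambda>t. exp (integral {0..t} (\<lambda>s. 2 * a - c * S s)))"
  have "S t = P t * (S 0 + integral {0..t} (\<lambda>s. b / P s))"
    unfolding P_def
  proof (rule linear_ode_solution)
    fix t :: real assume "t \<ge> 0"
    from riccatiD[OF S this]
    show "(S has_real_derivative (2 * a - c * S t) * S t + b) (at t within {0..})"
      by (simp add: algebra_simps power2_eq_square)
  qed (intro continuous_intros \<open>t \<ge> 0\<close>)+
  moreover have "integral {0..t} (\<lambda>s. b / P s) \<ge> 0"
    using \<open>b \<ge> 0\<close> by (intro Henstock_Kurzweil_Integration.integral_nonneg integrable_continuous_real)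
       (auto simp: P_def intro!: continuous_intros continuous_on_subset[OF continuous_on_integral_Ici])
  moreover have "P t > 0" by (simp add: P_def)
  ultimately show ?thesis using \<open>S 0 > 0\<close> by (simp add: zero_less_mult_iff)
qed

text \<open>
  The quadratic terms factor, so the difference of two solutions solves a homogeneous linear
  equation. Uniqueness and Lipschitz dependence on the initial value both follow.
\<close>

lemma riccati_difference:
  assumes S: "riccati a b c S" and R: "riccati a b c R" and t: "t \<ge> 0"
  shows "R t - S t = (R 0 - S 0) * exp (integral {0..t} (\<lambda>s. 2 * a - c * (R s + S s)))"
proof (rule homogeneous_linear_ode_solution[OF _ _ t])
  note [continuous_intros] = riccati_continuous[OF S] riccati_continuous[OF R]
  show "continuous_on {0..} (\<lambda>s. 2 * a - c * (R s + S s))"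
    by (intro continuous_intros)
  fix s :: real assume s: "s \<ge> 0"
  show "((\<lambda>t. R t - S t) has_real_derivative (2 * a - c * (R s + S s)) * (R s - S s)) (at s within {0..})"
    using DERIV_diff[OF riccatiD[OF R s] riccatiD[OF S s]]
    by (simp add: algebra_simps power2_eq_square)
qed

lemma riccati_unique:
  assumes "riccati a b c S" "riccati a b c R" "R 0 = S 0" "t \<ge> 0"
  shows "R t = S t"
  using riccati_difference[OF assms(1,2,4)] assms(3) by simp

lemma exp_integral_le:
  fixes g :: "real \<Rightarrow> real"
  assumes "continuous_on {0..} g" "\<And>s. s \<ge> 0 \<Longrightarrow> g s \<le> k" "t \<ge> 0"
  shows "exp (integral {0..t} g) \<le> exp (k * t)"
proof -
  have "integral {0..t} g \<le> integral {0..t} (\<lambda>s. k)"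
    by (rule integral_le) (auto intro!: integrable_continuous_real
        intro: continuous_on_subset[OF assms(1)] assms(2))
  then show ?thesis using \<open>t \<ge> 0\<close> by (simp add: mult.commute)
qed

lemma riccati_difference_bound:
  assumes S: "riccati a b c S" and R: "riccati a b c R" and "t \<ge> 0" "b \<ge> 0" "c \<ge> 0"
    and "S 0 > 0" "R 0 > 0"
  shows "\<bar>R t - S t\<bar> \<le> exp (2 * \<bar>a\<bar> * t) * \<bar>R 0 - S 0\<bar>"
proof -
  have "exp (integral {0..t} (\<lambda>s. 2 * a - c * (R s + S s))) \<le> exp (2 * \<bar>a\<bar> * t)"
  proof (rule exp_integral_le[OF _ _ \<open>t \<ge> 0\<close>])
    note [continuous_intros] = riccati_continuous[OF S] riccati_continuous[OF R]
    show "continuous_on {0..} (\<lambda>s. 2 * a - c * (R s + S s))" by (intro continuous_intros)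
    fix s :: real assume "s \<ge> 0"
    then have "c * (R s + S s) \<ge> 0"
      using riccati_pos[OF S \<open>S 0 > 0\<close> \<open>b \<ge> 0\<close>, of s] riccati_pos[OF R \<open>R 0 > 0\<close> \<open>b \<ge> 0\<close>, of s]
        \<open>c \<ge> 0\<close> by (intro mult_nonneg_nonneg) auto
    then show "2 * a - c * (R s + S s) \<le> 2 * \<bar>a\<bar>" by linarith
  qed
  then show ?thesis
    unfolding riccati_difference[OF S R \<open>t \<ge> 0\<close>] by (simp add: abs_mult mult.commute mult_left_mono)
qed

text \<open>
  Linearising around one solution \<open>S\<close> solves the equation for all initial values at
  once: the reciprocal of \<open>R - S\<close> solves a linear equation. The point of the formula
  is that \<open>R t\<close> is an explicit, hence measurable, function of \<open>R 0\<close>.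
\<close>

lemma riccati_closed_form:
  fixes S R :: "real \<Rightarrow> real" and a c :: real
  defines "\<phi> \<equiv> \<lambda>t. exp (integral {0..t} (\<lambda>s. a - c * S s))"
  assumes S: "riccati a b c S" and R: "riccati a b c R" and t: "t \<ge> 0"
  shows "R t - S t = (\<phi> t)\<^sup>2 * (R 0 - S 0) /
           (1 + c * (R 0 - S 0) * integral {0..t} (\<lambda>s. (\<phi> s)\<^sup>2))"
proof -
  note cS = riccati_continuous[OF S] and cR = riccati_continuous[OF R]
  have \<phi>: "(\<phi> has_real_derivative (a - c * S s) * \<phi> s) (at s within {0..})" if "s \<ge> 0" for s
    unfolding \<phi>_def
    by (auto intro!: derivative_eq_intros integral_has_real_derivative_Ici[OF _ that] continuous_intros cS)
  have c\<phi>: "continuous_on {0..} \<phi>"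
    by (rule DERIV_continuous_on) (use \<phi> in auto)
  \<comment> \<open>\<open>w\<close> turns out to be the denominator of the formula.\<close>
  define w where "w = (\<lambda>t. exp (integral {0..t} (\<lambda>s. c * (R s - S s))))"
  have w: "(w has_real_derivative c * (R s - S s) * w s) (at s within {0..})" if "s \<ge> 0" for s
    unfolding w_def
    by (auto intro!: derivative_eq_intros integral_has_real_derivative_Ici[OF _ that] continuous_intros cS cR)
  have Dw: "(R s - S s) * w s = (R 0 - S 0) * (\<phi> s)\<^sup>2" if "s \<ge> 0" for s
  proof -
    have cc: "continuous_on {0..} (\<lambda>s. 2 * (a - c * S s))" by (intro continuous_intros cS)
    have "(R s - S s) * w s
        = (R 0 - S 0) * w 0 * exp (integral {0..s} (\<lambda>s. 2 * (a - c * S s)))"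
    proof (rule homogeneous_linear_ode_solution[OF cc _ that])
      fix s :: real assume s: "s \<ge> 0"
      show "((\<lambda>s. (R s - S s) * w s) has_real_derivative 2 * (a - c * S s) * ((R s - S s) * w s)) (at s within {0..})"
        by (auto intro!: derivative_eq_intros riccatiD[OF R s] riccatiD[OF S s] w[OF s])
           (simp add: algebra_simps power2_eq_square)
    qed
    also have "exp (integral {0..s} (\<lambda>s. 2 * (a - c * S s))) = (\<phi> s)\<^sup>2"
      by (simp only: \<phi>_def integral_mult_right exp_double)
    finally show ?thesis by (simp add: w_def)
  qed
  have "w t = 1 + c * (R 0 - S 0) * integral {0..t} (\<lambda>s. (\<phi> s)\<^sup>2)"
  proof (rule eq_if_same_derivative_Ici[OF w _ _ t])
    fix s :: real assume s: "s \<ge> 0"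
    have "((\<lambda>t. 1 + c * (R 0 - S 0) * integral {0..t} (\<lambda>s. (\<phi> s)\<^sup>2)) has_real_derivative
        c * (R 0 - S 0) * (\<phi> s)\<^sup>2) (at s within {0..})"
      by (auto intro!: derivative_eq_intros integral_has_real_derivative_Ici[OF _ s] continuous_intros c\<phi>)
    then show "((\<lambda>t. 1 + c * (R 0 - S 0) * integral {0..t} (\<lambda>s. (\<phi> s)\<^sup>2)) has_real_derivative
        c * (R s - S s) * w s) (at s within {0..})"
      by (rule DERIV_cong) (use Dw[OF s] in \<open>simp add: mult.assoc\<close>)
  qed (simp_all add: w_def)
  moreover have "R t - S t = (R 0 - S 0) * (\<phi> t)\<^sup>2 / w t"
    using Dw[OF t] by (simp add: eq_divide_eq w_def)
  ultimately show ?thesis by (simp add: mult.commute)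
qed

section \<open>The filter equations along a single path\<close>

text \<open>
  The mean equation with gain \<open>S\<close> along one path, where \<open>\<zeta>\<close> stands
  for \<open>C \<bullet> Z\<close>: the stochastic integral of \<open>S\<close> against
  \<open>\<zeta>\<close> has been integrated by parts, and the factor of \<open>\<zeta>\<close> in
  the integral is the time derivative of \<open>S\<close> given by the Riccati equation.
\<close>

definition kalman_mean ::
    "real \<Rightarrow> real \<Rightarrow> real \<Rightarrow> (real \<Rightarrow> real) \<Rightarrow> (real \<Rightarrow> real) \<Rightarrow> (real \<Rightarrow> real) \<Rightarrow> bool" where
  "kalman_mean a b c S \<zeta> m \<longleftrightarrow> continuous_on {0..} m \<and>
     (\<forall>t\<ge>0. m t = m 0 + (S t * \<zeta> t - integral {0..t} (\<lambda>s. riccati_rhs a b c (S s) * \<zeta> s))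
        + integral {0..t} (\<lambda>s. (a - c * S s) * m s))"

text \<open>
  The path \<open>\<zeta>\<close> is only continuous; subtracting \<open>S \<zeta>\<close> leaves
  a differentiable function.
\<close>

lemma kalman_mean_derivative:
  assumes m: "kalman_mean a b c S \<zeta> m" and S: "riccati a b c S"
    and \<zeta>: "continuous_on {0..} \<zeta>" and t: "t \<ge> 0"
  shows "((\<lambda>t. m t - S t * \<zeta> t) has_real_derivative
           ((a - c * S t) * m t - riccati_rhs a b c (S t) * \<zeta> t)) (at t within {0..})"
proof -
  note cS = riccati_continuous[OF S]
  have cm: "continuous_on {0..} m" using m by (simp add: kalman_mean_def)
  have c1: "continuous_on {0..} (\<lambda>s. (a - c * S s) * m s)"
    and c2: "continuous_on {0..} (\<lambda>s. riccati_rhs a b c (S s) * \<zeta> s)"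
    by (intro continuous_intros cS cm \<zeta>)+
  show ?thesis
  proof (rule has_derivative_if_integral_equation[OF _ _ t, where k = "m 0"])
    fix t :: real assume t: "t \<ge> 0"
    have "integral {0..t} (\<lambda>s. (a - c * S s) * m s - riccati_rhs a b c (S s) * \<zeta> s)
      = integral {0..t} (\<lambda>s. (a - c * S s) * m s) - integral {0..t} (\<lambda>s. riccati_rhs a b c (S s) * \<zeta> s)"
      by (intro Henstock_Kurzweil_Integration.integral_diff integrable_continuous_real
          continuous_on_subset[OF c1] continuous_on_subset[OF c2]) auto
    then show "m t - S t * \<zeta> t = m 0 + integral {0..t} (\<lambda>s. (a - c * S s) * m s - riccati_rhs a b c (S s) * \<zeta> s)"
      using m t unfolding kalman_mean_def by (auto simp: algebra_simps)
  qed (intro continuous_intros c1 c2)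
qed

lemma kalman_mean_solution:
  fixes a c :: real and S :: "real \<Rightarrow> real"
  defines "\<phi> \<equiv> \<lambda>t. exp (integral {0..t} (\<lambda>s. a - c * S s))"
  assumes m: "kalman_mean a b c S \<zeta> m" and S: "riccati a b c S"
    and \<zeta>: "continuous_on {0..} \<zeta>" and "\<zeta> 0 = 0" and t: "t \<ge> 0"
  shows "m t = S t * \<zeta> t + \<phi> t * (m 0 + integral {0..t}
     (\<lambda>s. ((a - c * S s) * S s - riccati_rhs a b c (S s)) * \<zeta> s / \<phi> s))"
proof -
  note cS = riccati_continuous[OF S]
  have cm: "continuous_on {0..} m" using m by (simp add: kalman_mean_def)
  have "m t - S t * \<zeta> t = \<phi> t * ((m 0 - S 0 * \<zeta> 0) + integral {0..t}
     (\<lambda>s. ((a - c * S s) * S s - riccati_rhs a b c (S s)) * \<zeta> s / \<phi> s))"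
    unfolding \<phi>_def
  proof (rule linear_ode_solution[OF _ _ _ t])
    fix t :: real assume t: "t \<ge> 0"
    show "((\<lambda>t. m t - S t * \<zeta> t) has_real_derivative (a - c * S t) * (m t - S t * \<zeta> t) +
         ((a - c * S t) * S t - riccati_rhs a b c (S t)) * \<zeta> t) (at t within {0..})"
      using kalman_mean_derivative[OF m S \<zeta> t] by (simp add: algebra_simps)
  qed (intro continuous_intros cS cm \<zeta>)+
  then show ?thesis using \<open>\<zeta> 0 = 0\<close> by simp
qed

text \<open>
  Both sides, after subtraction of \<open>(R - S) \<zeta>\<close>, solve the same linear equation
  with coefficient \<open>a - c R\<close>. Because \<open>R - S = (R 0 - S 0) \<phi>
  \<psi>\<close>, dividing the inhomogeneity by \<open>\<psi>\<close> removes \<open>R\<close>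
  from the integral; the functional of \<open>\<zeta>\<close> that is left is the same for every
  \<open>R\<close>.
\<close>

lemma kalman_mean_difference:
  fixes a c :: real and S R :: "real \<Rightarrow> real"
  defines "\<phi> \<equiv> \<lambda>t. exp (integral {0..t} (\<lambda>s. a - c * S s))"
    and "\<psi> \<equiv> \<lambda>t. exp (integral {0..t} (\<lambda>s. a - c * R s))"
  assumes S: "riccati a b c S" and R: "riccati a b c R"
    and m: "kalman_mean a b c S \<zeta> m" and \<mu>: "kalman_mean a b c R \<zeta> \<mu>"
    and \<zeta>: "continuous_on {0..} \<zeta>" and "\<zeta> 0 = 0" and t: "t \<ge> 0"
  shows "\<mu> t - m t = \<psi> t * (\<mu> 0 - m 0 + (R 0 - S 0) *
     (\<phi> t * \<zeta> t - integral {0..t} (\<lambda>s. \<phi> s * ((a - c * S s) * \<zeta> s + c * m s))))"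
proof -
  note cS = riccati_continuous[OF S] and cR = riccati_continuous[OF R]
  have cm: "continuous_on {0..} m" using m by (simp add: kalman_mean_def)
  define D where "D = (\<lambda>t. R t - S t)"
  define q where "q = (\<lambda>s. (a - c * S s) * \<zeta> s + c * m s)"
  have cq: "continuous_on {0..} q"
    unfolding q_def by (intro continuous_intros cS cm \<zeta>)
  have cD: "continuous_on {0..} (\<lambda>s. - (D s * q s))"
    unfolding D_def by (intro continuous_intros cS cR cq)
  have D: "D s = D 0 * \<phi> s * \<psi> s" if "s \<ge> 0" for s
  proof -
    have "integral {0..s} (\<lambda>s. 2 * a - c * (R s + S s))
        = integral {0..s} (\<lambda>s. (a - c * S s) + (a - c * R s))"
      by (rule arg_cong[where f="integral {0..s}"]) (simp add: fun_eq_iff algebra_simps)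
    also have "\<dots> = integral {0..s} (\<lambda>s. a - c * S s) + integral {0..s} (\<lambda>s. a - c * R s)"
      by (intro Henstock_Kurzweil_Integration.integral_add integrable_continuous_real continuous_intros
          continuous_on_subset[OF cS] continuous_on_subset[OF cR]) auto
    finally show ?thesis
      unfolding D_def riccati_difference[OF S R that] by (simp add: \<phi>_def \<psi>_def exp_add)
  qed
  have "(\<mu> t - R t * \<zeta> t) - (m t - S t * \<zeta> t)
      = \<psi> t * (((\<mu> 0 - R 0 * \<zeta> 0) - (m 0 - S 0 * \<zeta> 0)) + integral {0..t} (\<lambda>s. - (D s * q s) / \<psi> s))"
    unfolding \<psi>_def
  proof (rule linear_ode_solution[OF _ _ _ t])
    fix t :: real assume t: "t \<ge> 0"
    show "((\<lambda>t. \<mu> t - R t * \<zeta> t - (m t - S t * \<zeta> t)) has_real_derivative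
          (a - c * R t) * (\<mu> t - R t * \<zeta> t - (m t - S t * \<zeta> t)) + - (D t * q t)) (at t within {0..})"
      using DERIV_diff[OF kalman_mean_derivative[OF \<mu> R \<zeta> t] kalman_mean_derivative[OF m S \<zeta> t]]
      by (rule DERIV_cong) (simp add: D_def q_def algebra_simps power2_eq_square)
  qed (intro continuous_intros cR cD)+
  also have "integral {0..t} (\<lambda>s. - (D s * q s) / \<psi> s) = integral {0..t} (\<lambda>s. - D 0 * (\<phi> s * q s))"
    by (rule Henstock_Kurzweil_Integration.integral_cong) (subst D, auto simp: \<psi>_def)
  also have "\<dots> = - D 0 * integral {0..t} (\<lambda>s. \<phi> s * q s)" by (rule integral_mult_right)
  finally have "\<mu> t - m t = D t * \<zeta> t + \<psi> t * (\<mu> 0 - m 0 - D 0 * integral {0..t} (\<lambda>s. \<phi> s * q s))"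
    using \<open>\<zeta> 0 = 0\<close> by (simp add: D_def algebra_simps)
  also have "D t * \<zeta> t = D 0 * \<phi> t * \<psi> t * \<zeta> t" by (simp only: D[OF t])
  finally show ?thesis by (simp add: D_def q_def algebra_simps)
qed

lemma emp_cov_nonneg: "N \<ge> 2 \<Longrightarrow> emp_cov N X t \<omega> \<ge> 0"
  unfolding emp_cov_def by (intro mult_nonneg_nonneg sum_nonneg) auto

lemma sum_deviation_zero: "N > 0 \<Longrightarrow> (\<Sum>i<N. X i t \<omega> - emp_mean N X t \<omega>) = 0"
  by (simp add: sum_subtractf emp_mean_def)

text \<open>
  The finite system along one path, with \<open>J\<close> the stochastic integral that all
  particles share. The gain contains the inverse of the empirical variance, so the argument has to
  establish positivity before it may treat the integrands as continuous.
\<close>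

lemma finite_fpf_path:
  fixes X :: "nat \<Rightarrow> real \<Rightarrow> 'a \<Rightarrow> real" and C :: "real ^ 'm" and sB :: "real ^ 'q"
    and N :: nat and \<omega> :: 'a
  defines "\<mu> \<equiv> \<lambda>t. emp_mean N X t \<omega>" and "\<Sigma> \<equiv> \<lambda>t. emp_cov N X t \<omega>"
  assumes N: "N \<ge> 2"
    and cX: "\<And>i. i < N \<Longrightarrow> continuous_on {0..} (\<lambda>t. X i t \<omega>)"
    and X: "\<And>i t. i < N \<Longrightarrow> t \<ge> 0 \<Longrightarrow> X i t \<omega> = X i 0 \<omega> + J t +
        integral {0..t} (\<lambda>s. A * \<mu> s - ((\<Sigma> s *\<^sub>R C) \<bullet> C) * \<mu> s
          + fpf_gain A C sB (\<Sigma> s) * (X i s \<omega> - \<mu> s))"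
    and "\<Sigma> 0 \<noteq> 0"
  shows "riccati A (sB \<bullet> sB) (C \<bullet> C) \<Sigma>"
    and "\<And>t. t \<ge> 0 \<Longrightarrow> \<Sigma> t > 0"
    and "\<And>i t. i < N \<Longrightarrow> t \<ge> 0 \<Longrightarrow> X i t \<omega> - \<mu> t = sqrt (\<Sigma> t / \<Sigma> 0) * (X i 0 \<omega> - \<mu> 0)"
    and "\<And>t. t \<ge> 0 \<Longrightarrow> \<mu> t = \<mu> 0 + J t + integral {0..t} (\<lambda>s. (A - (C \<bullet> C) * \<Sigma> s) * \<mu> s)"
proof -
  define b c where "b = sB \<bullet> sB" and "c = C \<bullet> C"
  define e where "e = (\<lambda>i t. X i t \<omega> - \<mu> t)"
  define G where "G = (\<lambda>t. fpf_gain A C sB (\<Sigma> t))"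
  have b: "b \<ge> 0" by (simp add: b_def)
  have c\<mu>: "continuous_on {0..} \<mu>"
    unfolding \<mu>_def emp_mean_def by (intro continuous_intros cX) auto
  have ce: "continuous_on {0..} (e i)" if "i < N" for i
    unfolding e_def using that by (intro continuous_intros cX c\<mu>) auto
  have \<Sigma>e: "\<Sigma> t = 1 / (real N - 1) * (\<Sum>i<N. (e i t)\<^sup>2)" for t
    by (simp add: \<Sigma>_def e_def \<mu>_def emp_cov_def)
  have c\<Sigma>: "continuous_on {0..} \<Sigma>"
    unfolding \<Sigma>e[abs_def] by (intro continuous_intros ce) auto
  have \<Sigma>nn: "\<Sigma> t \<ge> 0" for t unfolding \<Sigma>_def using N by (rule emp_cov_nonneg)
  have sum0: "(\<Sum>i<N. e i t) = 0" for t
    unfolding e_def \<mu>_def using N by (intro sum_deviation_zero) auto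
  have X': "X i t \<omega> = X i 0 \<omega> + J t + integral {0..t} (\<lambda>s. (A - c * \<Sigma> s) * \<mu> s + G s * e i s)"
    if "i < N" "t \<ge> 0" for i t
    using X[OF that] by (simp add: G_def e_def c_def algebra_simps)
  have G: "G t = A - 1/2 * c * \<Sigma> t + 1/2 * b / \<Sigma> t" for t
    by (simp add: G_def fpf_gain_def b_def c_def field_simps)
  \<comment> \<open>As long as the empirical variance stays positive, the integrands are continuous and the common
     noise cancels in the deviations.\<close>
  have step: "e i t = e i 0 + integral {0..t} (\<lambda>s. G s * e i s)"
       "\<mu> t = \<mu> 0 + J t + integral {0..t} (\<lambda>s. (A - c * \<Sigma> s) * \<mu> s)"
    if "i < N" "t \<ge> 0" and pos: "\<And>s. 0 \<le> s \<Longrightarrow> s \<le> t \<Longrightarrow> \<Sigma> s > 0" for i t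
  proof -
    have ct: "continuous_on {0..t} \<Sigma>" "continuous_on {0..t} \<mu>" "\<And>j. j < N \<Longrightarrow> continuous_on {0..t} (e j)"
      by (auto intro: continuous_on_subset[OF c\<Sigma>] continuous_on_subset[OF c\<mu>] continuous_on_subset[OF ce])
    have cG: "continuous_on {0..t} G"
      unfolding G using pos by (intro continuous_intros ct) (auto simp: less_le)
    have i1: "(\<lambda>s. (A - c * \<Sigma> s) * \<mu> s) integrable_on {0..t}"
      and i2: "\<And>j. j < N \<Longrightarrow> (\<lambda>s. G s * e j s) integrable_on {0..t}"
      by (intro integrable_continuous_real continuous_intros ct cG; assumption)+
    have Xj: "X j t \<omega> = X j 0 \<omega> + J t + integral {0..t} (\<lambda>s. (A - c * \<Sigma> s) * \<mu> s)
        + integral {0..t} (\<lambda>s. G s * e j s)" if "j < N" for j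
      using X'[OF that \<open>t \<ge> 0\<close>]
      by (simp add: Henstock_Kurzweil_Integration.integral_add[OF i1 i2[OF that]])
    have "(\<Sum>j<N. integral {0..t} (\<lambda>s. G s * e j s)) = integral {0..t} (\<lambda>s. \<Sum>j<N. G s * e j s)"
      by (rule integral_sum[symmetric]) (use i2 in auto)
    also have "\<dots> = 0" by (simp add: sum_distrib_left[symmetric] sum0)
    finally have z: "(\<Sum>j<N. integral {0..t} (\<lambda>s. G s * e j s)) = 0" .
    have "(\<Sum>j<N. X j t \<omega>) = (\<Sum>j<N. X j 0 \<omega>) + real N * (J t + integral {0..t} (\<lambda>s. (A - c * \<Sigma> s) * \<mu> s))"
      using z by (simp add: Xj sum.distrib algebra_simps)
    then show m: "\<mu> t = \<mu> 0 + J t + integral {0..t} (\<lambda>s. (A - c * \<Sigma> s) * \<mu> s)"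
      using N by (simp add: \<mu>_def emp_mean_def field_simps)
    show "e i t = e i 0 + integral {0..t} (\<lambda>s. G s * e i s)"
      using Xj[OF \<open>i < N\<close>] m by (simp add: e_def)
  qed
  have de: "(e i has_real_derivative G s * e i s) (at s within {0..T})"
    if "i < N" "0 \<le> s" "s \<le> T" and pos: "\<And>s. 0 \<le> s \<Longrightarrow> s \<le> T \<Longrightarrow> \<Sigma> s > 0" for i s T
  proof -
    have ct: "continuous_on {0..T} \<Sigma>" "continuous_on {0..T} (e i)"
      by (auto intro: continuous_on_subset[OF c\<Sigma>] continuous_on_subset[OF ce[OF \<open>i < N\<close>]])
    have cG: "continuous_on {0..T} (\<lambda>s. G s * e i s)"
      unfolding G using pos by (intro continuous_intros ct) (auto simp: less_le)
    have "((\<lambda>u. e i 0 + integral {0..u} (\<lambda>s. G s * e i s)) has_real_derivative G s * e i s) (at s within {0..T})"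
      using that by (auto intro!: derivative_eq_intros integral_has_real_derivative[OF cG])
    then show ?thesis
    proof (rule has_field_derivative_transform_within[where d=1])
      fix u assume "u \<in> {0..T}"
      then show "e i 0 + integral {0..u} (\<lambda>s. G s * e i s) = e i u"
        by (intro step(1)[symmetric] \<open>i < N\<close>) (simp_all add: pos)
    qed (use that in auto)
  qed
  have d\<Sigma>: "(\<Sigma> has_real_derivative riccati_rhs A b c (\<Sigma> s)) (at s within {0..T})"
    if "0 \<le> s" "s \<le> T" and pos: "\<And>s. 0 \<le> s \<Longrightarrow> s \<le> T \<Longrightarrow> \<Sigma> s > 0" for s T
  proof -
    have "((\<lambda>s. \<Sum>i<N. (e i s)\<^sup>2) has_real_derivative (\<Sum>i<N. 2 * e i s * (G s * e i s))) (at s within {0..T})"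
    proof (rule DERIV_sum)
      fix i assume "i \<in> {..<N}"
      then have "(e i has_real_derivative G s * e i s) (at s within {0..T})"
        using that by (intro de) auto
      from DERIV_power[OF this, of 2]
      show "((\<lambda>s. (e i s)\<^sup>2) has_real_derivative 2 * e i s * (G s * e i s)) (at s within {0..T})"
        by (rule DERIV_cong) simp
    qed
    then have "((\<lambda>s. 1 / (real N - 1) * (\<Sum>i<N. (e i s)\<^sup>2)) has_real_derivative
        1 / (real N - 1) * (\<Sum>i<N. 2 * e i s * (G s * e i s))) (at s within {0..T})"
      by (rule DERIV_cmult)
    then have "(\<Sigma> has_real_derivative 1 / (real N - 1) * (\<Sum>i<N. 2 * e i s * (G s * e i s))) (at s within {0..T})"
      by (simp add: \<Sigma>e[abs_def])
    also have "1 / (real N - 1) * (\<Sum>i<N. 2 * e i s * (G s * e i s)) = 2 * G s * \<Sigma> s"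
      by (simp add: \<Sigma>e sum_distrib_left power2_eq_square algebra_simps)
    also have "\<dots> = riccati_rhs A b c (\<Sigma> s)"
      using pos[OF that(1,2)] by (simp add: G field_simps power2_eq_square)
    finally show ?thesis .
  qed
  have \<Sigma>0: "\<Sigma> 0 > 0" using \<Sigma>nn[of 0] \<open>\<Sigma> 0 \<noteq> 0\<close> by simp
  \<comment> \<open>At a first zero \<open>\<tau>\<close>, the nondecreasing function \<open>\<Sigma> exp (- \<integral> (2 A - c \<Sigma>))\<close> would have to vanish.\<close>
  show pos: "\<Sigma> t > 0" if "t \<ge> 0" for t
  proof (rule ccontr)
    assume "\<not> \<Sigma> t > 0"
    then have "\<Sigma> t = 0" using \<Sigma>nn[of t] by simp
    define Z where "Z = {s \<in> {0..t}. \<Sigma> s = 0}"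
    have "continuous_on {0..t} \<Sigma>" by (rule continuous_on_subset[OF c\<Sigma>]) auto
    then have "closed Z"
      unfolding Z_def by (rule continuous_closed_preimage_constant) auto
    then have "compact Z"
      by (auto simp: compact_eq_bounded_closed Z_def intro: bounded_subset[of "{0..t}"])
    moreover have "t \<in> Z" using that \<open>\<Sigma> t = 0\<close> by (simp add: Z_def)
    ultimately obtain \<tau> where \<tau>: "\<tau> \<in> Z" "\<And>s. s \<in> Z \<Longrightarrow> \<tau> \<le> s"
      using compact_attains_inf[of Z] by blast
    have \<tau>0: "\<Sigma> \<tau> = 0" "\<tau> \<ge> 0" "\<tau> \<le> t" using \<tau>(1) by (auto simp: Z_def)
    have before: "\<Sigma> s > 0" if "0 \<le> s" "s < \<tau>" for s
      using \<tau>(2)[of s] that \<Sigma>nn[of s] \<tau>0 by (force simp: Z_def)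
    define P where "P = (\<lambda>s. exp (- integral {0..s} (\<lambda>s. 2 * A - c * \<Sigma> s)))"
    have cI: "continuous_on {0..} (\<lambda>s. 2 * A - c * \<Sigma> s)" by (intro continuous_intros c\<Sigma>)
    have "\<Sigma> 0 * P 0 \<le> \<Sigma> \<tau> * P \<tau>"
    proof (rule DERIV_nonneg_imp_increasing_open[OF \<tau>0(2)])
      show "continuous_on {0..\<tau>} (\<lambda>s. \<Sigma> s * P s)"
        unfolding P_def by (rule continuous_on_subset[of "{0..}"])
           (auto intro!: continuous_intros c\<Sigma> continuous_on_integral_Ici cI)
      fix s assume s: "0 < s" "s < \<tau>"
      have int: "at s within {0..(s+\<tau>)/2} = at s"
        using s by (intro at_within_interior) simp
      have "(\<Sigma> has_real_derivative riccati_rhs A b c (\<Sigma> s)) (at s within {0..(s+\<tau>)/2})"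
        using s before by (intro d\<Sigma>) auto
      then have 1: "(\<Sigma> has_real_derivative riccati_rhs A b c (\<Sigma> s)) (at s)"
        by (simp only: int)
      have int': "at s within {0..} = at s"
        using s by (intro at_within_interior) simp
      have 2: "((\<lambda>s. integral {0..s} (\<lambda>s. 2 * A - c * \<Sigma> s)) has_real_derivative 2 * A - c * \<Sigma> s) (at s)"
        using integral_has_real_derivative_Ici[OF cI, of s] s by (simp add: int')
      have "((\<lambda>s. \<Sigma> s * P s) has_real_derivative b * P s) (at s)"
        unfolding P_def
        by (auto intro!: derivative_eq_intros 1 2) (simp add: algebra_simps power2_eq_square)
      then show "\<exists>y. ((\<lambda>s. \<Sigma> s * P s) has_real_derivative y) (at s) \<and> 0 \<le> y"
        using b by (intro exI[of _ "b * P s"]) (simp add: P_def)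
    qed
    then show False using \<Sigma>0 \<tau>0 by (simp add: P_def)
  qed
  have Ici: "at s within {0..s+1} = at s within {0..}" for s :: real
    by (rule at_within_nhd[of _ "{..<s+1}"]) auto
  have "(\<Sigma> has_real_derivative riccati_rhs A b c (\<Sigma> s)) (at s within {0..})" if "s \<ge> 0" for s
    using d\<Sigma>[of s "s+1"] that pos by (simp add: Ici)
  then show "riccati A (sB \<bullet> sB) (C \<bullet> C) \<Sigma>" by (simp add: riccati_def b_def c_def)
  show "\<mu> t = \<mu> 0 + J t + integral {0..t} (\<lambda>s. (A - (C \<bullet> C) * \<Sigma> s) * \<mu> s)" if "t \<ge> 0" for t
    using step(2)[of 0 t] that N pos by (simp add: c_def)
  show "X i t \<omega> - \<mu> t = sqrt (\<Sigma> t / \<Sigma> 0) * (X i 0 \<omega> - \<mu> 0)" if i: "i < N" and t: "t \<ge> 0" for i t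
  proof -
    have cG: "continuous_on {0..} G"
      unfolding G using pos by (intro continuous_intros c\<Sigma>) (auto simp: less_le)
    define \<Phi> where "\<Phi> = exp (integral {0..t} G)"
    have ei: "e j t = e j 0 * \<Phi>" if "j < N" for j
      unfolding \<Phi>_def
    proof (rule homogeneous_linear_ode_solution[OF cG _ t])
      fix s :: real assume s: "s \<ge> 0"
      have "(e j has_real_derivative G s * e j s) (at s within {0..s+1})"
        using s by (intro de[OF that]) (simp_all add: pos)
      then show "(e j has_real_derivative G s * e j s) (at s within {0..})" by (simp only: Ici)
    qed
    have "\<Sigma> t = \<Phi>\<^sup>2 * \<Sigma> 0"
      by (simp add: \<Sigma>e ei power_mult_distrib sum_distrib_left algebra_simps)
    then have "sqrt (\<Sigma> t / \<Sigma> 0) = \<Phi>" using \<Sigma>0 by (simp add: \<Phi>_def)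
    then show ?thesis using ei[OF i] by (simp add: e_def mult.commute)
  qed
qed

section \<open>Riemann sums, measurability modulo null sets, and the Ito integral\<close>

text \<open>
  With arbitrary tags this covers both uses: left endpoints and \<open>\<Gamma> s = s\<close> for
  Riemann sums, right endpoints for the summation by parts of a stochastic integral. On each cell
  the mean value inequality for \<open>f (tag) \<Gamma> - Q\<close> bounds the error.
\<close>

lemma tagged_sums_tendsto:
  fixes f g \<Gamma> Q :: "real \<Rightarrow> real" and tag :: "nat \<Rightarrow> nat \<Rightarrow> real"
  assumes t: "t \<ge> 0" and f: "continuous_on {0..t} f" and g: "continuous_on {0..t} g"
    and \<Gamma>: "\<And>s. s \<in> {0..t} \<Longrightarrow> (\<Gamma> has_real_derivative g s) (at s within {0..t})"
    and Q: "\<And>s. s \<in> {0..t} \<Longrightarrow> (Q has_real_derivative f s * g s) (at s within {0..t})"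
    and tag: "\<And>n k. k < n \<Longrightarrow> tag n k \<in> {t * real k / real n .. t * real (Suc k) / real n}"
  shows "(\<lambda>n. \<Sum>k<n. f (tag n k) * (\<Gamma> (t * real (Suc k) / real n) - \<Gamma> (t * real k / real n)))
           \<longlonglongrightarrow> Q t - Q 0"
proof -
  obtain B where B: "B > 0" "\<And>s. s \<in> {0..t} \<Longrightarrow> \<bar>g s\<bar> \<le> B"
  proof -
    have "bounded (g ` {0..t})"
      by (intro compact_imp_bounded compact_continuous_image g) simp
    then show ?thesis using that by (auto simp: bounded_pos)
  qed
  have uc: "uniformly_continuous_on {0..t} f"
    by (intro compact_uniformly_continuous f) simp
  show ?thesis
  proof (rule LIMSEQ_I)
    fix r :: real assume r: "r > 0"
    define \<epsilon> where "\<epsilon> = r / (B * (t + 1))"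
    have \<epsilon>: "\<epsilon> > 0" using r B t by (simp add: \<epsilon>_def)
    obtain d where d: "d > 0" "\<And>x y. x \<in> {0..t} \<Longrightarrow> y \<in> {0..t} \<Longrightarrow> \<bar>x - y\<bar> < d \<Longrightarrow> \<bar>f x - f y\<bar> < \<epsilon>"
      using uc \<epsilon> unfolding uniformly_continuous_on_def dist_real_def by metis
    obtain n0 :: nat where n0: "t / d < real n0" using reals_Archimedean2 by blast
    have "norm ((\<Sum>k<n. f (tag n k) * (\<Gamma> (t * real (Suc k) / real n) - \<Gamma> (t * real k / real n)))
        - (Q t - Q 0)) < r" if "n \<ge> Suc n0" for n
    proof -
      have n: "n > 0" using that by simp
      have mesh: "t / real n < d"
      proof -
        have "t < d * real n0" using n0 d by (simp add: field_simps)
        also have "\<dots> \<le> d * real n" using that d by simp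
        finally show ?thesis using n by (simp add: field_simps)
      qed
      define u where "u = (\<lambda>k. t * real k / real n)"
      have uS: "u (Suc k) = u k + t / real n" for k using n by (simp add: u_def field_simps)
      have u0: "u k \<ge> 0" for k using t by (simp add: u_def)
      have ut: "u k \<le> t" if "k \<le> n" for k
        using that n t by (simp add: u_def divide_le_eq mult_left_mono)
      have loc: "\<bar>f (tag n k) * (\<Gamma> (u (Suc k)) - \<Gamma> (u k)) - (Q (u (Suc k)) - Q (u k))\<bar> \<le> \<epsilon> * B * (t / real n)"
        if k: "k < n" for k
      proof -
        have sub: "{u k..u (Suc k)} \<subseteq> {0..t}" using u0[of k] ut[of "Suc k"] k by auto
        have tg: "tag n k \<in> {u k..u (Suc k)}" using tag[OF k] by (simp add: u_def)
        have tn: "t / real n \<ge> 0" using t by simp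
        have "norm ((f (tag n k) * \<Gamma> (u (Suc k)) - Q (u (Suc k))) - (f (tag n k) * \<Gamma> (u k) - Q (u k)))
            \<le> (\<epsilon> * B) * norm (u (Suc k) - u k)"
        proof (rule field_differentiable_bound[where S="{u k..u (Suc k)}"
              and f' = "\<lambda>s. f (tag n k) * g s - f s * g s"])
          fix s assume s: "s \<in> {u k..u (Suc k)}"
          then have s': "s \<in> {0..t}" using sub by blast
          show "((\<lambda>s. f (tag n k) * \<Gamma> s - Q s) has_real_derivative f (tag n k) * g s - f s * g s)
              (at s within {u k..u (Suc k)})"
            by (intro derivative_intros DERIV_cmult DERIV_subset[OF \<Gamma> sub] DERIV_subset[OF Q sub] s')
          have "\<bar>f (tag n k) - f s\<bar> < \<epsilon>"
            using s' tg sub s mesh by (intro d(2)) (auto simp: uS)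
          then have "\<bar>f (tag n k) - f s\<bar> * \<bar>g s\<bar> \<le> \<epsilon> * B"
            using B(2)[OF s'] B(1) \<epsilon> by (intro mult_mono) auto
          then show "norm (f (tag n k) * g s - f s * g s) \<le> \<epsilon> * B"
            by (simp add: abs_mult[symmetric] left_diff_distrib)
        qed (use tn uS in auto)
        then show ?thesis using tn t by (simp add: uS algebra_simps abs_of_nonneg)
      qed
      have "Q t - Q 0 = (\<Sum>k<n. Q (u (Suc k)) - Q (u k))"
        using n by (subst sum_lessThan_telescope) (simp add: u_def)
      then have "norm ((\<Sum>k<n. f (tag n k) * (\<Gamma> (u (Suc k)) - \<Gamma> (u k))) - (Q t - Q 0))
          = norm (\<Sum>k<n. f (tag n k) * (\<Gamma> (u (Suc k)) - \<Gamma> (u k)) - (Q (u (Suc k)) - Q (u k)))"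
        by (simp add: sum_subtractf)
      also have "\<dots> \<le> (\<Sum>k<n. \<epsilon> * B * (t / real n))"
        by (rule sum_norm_le) (use loc in auto)
      also have "\<dots> = \<epsilon> * B * t" using n by simp
      also have "\<dots> = r * (t / (t + 1))" using B by (simp add: \<epsilon>_def)
      also have "\<dots> < r" using t r by (simp add: field_simps)
      finally show ?thesis by (simp only: u_def)
    qed
    then show "\<exists>no. \<forall>n\<ge>no. norm ((\<Sum>k<n. f (tag n k) * (\<Gamma> (t * real (Suc k) / real n) - \<Gamma> (t * real k / real n)))
        - (Q t - Q 0)) < r" by blast
  qed
qed

lemma riemann_sums_tendsto_integral:
  fixes f :: "real \<Rightarrow> real"
  assumes t: "t \<ge> 0" and f: "continuous_on {0..t} f"
  shows "(\<lambda>n. \<Sum>k<n. t / real n * f (t * real k / real n)) \<longlonglongrightarrow> integral {0..t} f"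
proof -
  have "(\<lambda>n. \<Sum>k<n. f (t * real k / real n) * (t * real (Suc k) / real n - t * real k / real n))
      \<longlonglongrightarrow> integral {0..t} f - integral {0..0} f"
    by (rule tagged_sums_tendsto[OF t f, where g="\<lambda>_. 1" and \<Gamma>="\<lambda>s. s"])
       (use t in \<open>auto intro!: derivative_eq_intros integral_has_real_derivative f divide_right_mono mult_left_mono\<close>)
  moreover have "f (t * real k / real n) * (t * real (Suc k) / real n - t * real k / real n)
      = t / real n * f (t * real k / real n)" for k n
    by (simp add: diff_divide_distrib[symmetric] algebra_simps)
  ultimately show ?thesis by simp
qed

text \<open>
  Equality with an \<open>F\<close>-measurable function up to a null set of \<open>M\<close>. Time
  integrals and stochastic integrals of adapted processes are almost sure limits, and since
  neither \<open>M\<close> nor \<open>F\<close> is assumed to be complete, this is the form of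
  measurability that they inherit.
\<close>

definition ae_measurable :: "'a measure \<Rightarrow> 'a measure \<Rightarrow> ('a \<Rightarrow> real) \<Rightarrow> bool" where
  "ae_measurable M F f \<longleftrightarrow> (\<exists>g\<in>borel_measurable F. AE x in M. f x = g x)"

lemma ae_measurableI: "f \<in> borel_measurable F \<Longrightarrow> ae_measurable M F f"
  by (auto simp: ae_measurable_def)

lemma ae_measurable_cong_AE:
  assumes "ae_measurable M F f" "AE x in M. h x = f x"
  shows "ae_measurable M F h"
proof -
  from assms(1) obtain g where "g \<in> borel_measurable F" "AE x in M. f x = g x"
    by (auto simp: ae_measurable_def)
  with assms(2) show ?thesis
    unfolding ae_measurable_def by (intro bexI[of _ g]) (auto elim: AE_mp)
qed

lemma ae_measurable_compose2:
  assumes f: "ae_measurable M F f" and g: "ae_measurable M F g"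
    and h: "(\<lambda>p. h (fst p) (snd p)) \<in> borel_measurable (borel \<Otimes>\<^sub>M borel)"
  shows "ae_measurable M F (\<lambda>x. h (f x) (g x))"
proof -
  from f obtain f' where [measurable]: "f' \<in> borel_measurable F" and f': "AE x in M. f x = f' x"
    by (auto simp: ae_measurable_def)
  from g obtain g' where [measurable]: "g' \<in> borel_measurable F" and g': "AE x in M. g x = g' x"
    by (auto simp: ae_measurable_def)
  have "(\<lambda>x. (f' x, g' x)) \<in> F \<rightarrow>\<^sub>M borel \<Otimes>\<^sub>M borel" by measurable
  from measurable_compose[OF this h] have "(\<lambda>x. h (f' x) (g' x)) \<in> borel_measurable F" by simp
  moreover have "AE x in M. h (f x) (g x) = h (f' x) (g' x)"
    using f' g' by eventually_elim simp
  ultimately show ?thesis by (auto simp: ae_measurable_def)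
qed

lemma ae_measurable_compose:
  assumes "ae_measurable M F f" "h \<in> borel_measurable borel"
  shows "ae_measurable M F (\<lambda>x. h (f x))"
  using ae_measurable_compose2[OF assms(1) assms(1), of "\<lambda>a b. h a"] assms(2) by measurable

lemma ae_measurable_const: "ae_measurable M F (\<lambda>_. c)"
  by (rule ae_measurableI) simp

lemma ae_measurable_add:
  "ae_measurable M F f \<Longrightarrow> ae_measurable M F g \<Longrightarrow> ae_measurable M F (\<lambda>x. f x + g x)"
  by (rule ae_measurable_compose2) measurable

lemma ae_measurable_diff:
  "ae_measurable M F f \<Longrightarrow> ae_measurable M F g \<Longrightarrow> ae_measurable M F (\<lambda>x. f x - g x)"
  by (rule ae_measurable_compose2) measurable

lemma ae_measurable_mult:
  "ae_measurable M F f \<Longrightarrow> ae_measurable M F g \<Longrightarrow> ae_measurable M F (\<lambda>x. f x * g x)"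
  by (rule ae_measurable_compose2) measurable

lemma ae_measurable_divide:
  "ae_measurable M F f \<Longrightarrow> ae_measurable M F g \<Longrightarrow> ae_measurable M F (\<lambda>x. f x / g x)"
  by (rule ae_measurable_compose2) measurable

lemma ae_measurable_sum:
  assumes "finite I" "\<And>i. i \<in> I \<Longrightarrow> ae_measurable M F (f i)"
  shows "ae_measurable M F (\<lambda>x. \<Sum>i\<in>I. f i x)"
  using assms
  by (induction I rule: finite_induct) (auto intro: ae_measurable_const ae_measurable_add)

lemmas ae_measurable_intros =
  ae_measurable_const ae_measurable_add ae_measurable_diff ae_measurable_mult
  ae_measurable_divide ae_measurable_sum

lemma ae_measurable_LIMSEQ:
  assumes "\<And>n :: nat. ae_measurable M F (f n)" and lim: "AE x in M. (\<lambda>n. f n x) \<longlonglongrightarrow> g x"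
  shows "ae_measurable M F g"
proof -
  from assms(1) obtain u where u: "\<And>n. u n \<in> borel_measurable F" "\<And>n. AE x in M. f n x = u n x"
    unfolding ae_measurable_def by metis
  have "(\<lambda>x. lim (\<lambda>n. u n x)) \<in> borel_measurable F"
    by (rule borel_measurable_lim_metric) (rule u)
  moreover have "AE x in M. \<forall>n. f n x = u n x" using u(2) by (simp add: AE_all_countable)
  with lim have "AE x in M. g x = lim (\<lambda>n. u n x)"
    by eventually_elim (simp add: limI)
  ultimately show ?thesis by (auto simp: ae_measurable_def)
qed

lemma ae_measurable_integral:
  fixes h :: "real \<Rightarrow> 'a \<Rightarrow> real"
  assumes t: "t \<ge> 0" and c: "AE x in M. continuous_on {0..t} (\<lambda>s. h s x)"
    and h: "\<And>s. 0 \<le> s \<Longrightarrow> s \<le> t \<Longrightarrow> ae_measurable M F (h s)"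
  shows "ae_measurable M F (\<lambda>x. integral {0..t} (\<lambda>s. h s x))"
proof (rule ae_measurable_LIMSEQ)
  fix n :: nat
  show "ae_measurable M F (\<lambda>x. \<Sum>k<n. t / real n * h (t * real k / real n) x)"
    using t by (auto intro!: ae_measurable_intros h simp: divide_le_eq mult_left_mono)
next
  show "AE x in M. (\<lambda>n. \<Sum>k<n. t / real n * h (t * real k / real n) x) \<longlonglongrightarrow> integral {0..t} (\<lambda>s. h s x)"
    using c by eventually_elim (rule riemann_sums_tendsto_integral[OF t])
qed

text \<open>
  Continuous paths that agree at all rational times agree.
\<close>

lemma AE_all_times_eqI:
  fixes f g :: "real \<Rightarrow> 'a \<Rightarrow> real"
  assumes eq: "\<And>t. t \<ge> 0 \<Longrightarrow> AE x in M. f t x = g t x"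
    and f: "AE x in M. continuous_on {0..} (\<lambda>t. f t x)"
    and g: "AE x in M. continuous_on {0..} (\<lambda>t. g t x)"
  shows "AE x in M. \<forall>t\<ge>0. f t x = g t x"
proof -
  have "AE x in M. \<forall>q::rat. q \<ge> 0 \<longrightarrow> f (of_rat q) x = g (of_rat q) x"
    unfolding AE_all_countable using eq by auto
  with f g show ?thesis
  proof eventually_elim
    fix x assume fx: "continuous_on {0..} (\<lambda>t. f t x)" and gx: "continuous_on {0..} (\<lambda>t. g t x)"
      and q: "\<forall>q::rat. q \<ge> 0 \<longrightarrow> f (of_rat q) x = g (of_rat q) x"
    show "\<forall>t\<ge>0. f t x = g t x"
    proof (intro allI impI)
      fix t :: real assume t: "t \<ge> 0"
      have "\<exists>r::rat. t < of_rat r \<and> of_rat r < t + 1 / real (Suc n)" for n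
        using of_rat_dense[of t "t + 1 / real (Suc n)"] by auto
      then obtain r :: "nat \<Rightarrow> rat" where r: "\<And>n. t < of_rat (r n)" "\<And>n. of_rat (r n) < t + 1 / real (Suc n)"
        by metis
      have r0: "r n \<ge> 0" "(of_rat (r n) :: real) \<in> {0..}" for n
      proof -
        have "(of_rat (r n) :: real) \<ge> 0" using r(1)[of n] t by linarith
        then show "r n \<ge> 0" "(of_rat (r n) :: real) \<in> {0..}" by simp_all
      qed
      have lr: "(\<lambda>n. of_rat (r n)) \<longlonglongrightarrow> t"
      proof (rule tendsto_sandwich[where f="\<lambda>_. t" and h="\<lambda>n. t + 1 / real (Suc n)"])
        have "(\<lambda>n. t + 1 / real (Suc n)) \<longlonglongrightarrow> t + 0"
          by (intro tendsto_intros LIMSEQ_inverse_real_of_nat[unfolded inverse_eq_divide])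
        then show "(\<lambda>n. t + 1 / real (Suc n)) \<longlonglongrightarrow> t" by simp
      qed (use r in \<open>auto intro!: always_eventually less_imp_le\<close>)
      have "(\<lambda>n. f (of_rat (r n)) x) \<longlonglongrightarrow> f t x" "(\<lambda>n. g (of_rat (r n)) x) \<longlonglongrightarrow> g t x"
        using continuous_on_tendsto_compose[OF fx lr] continuous_on_tendsto_compose[OF gx lr] t r0 by auto
      moreover have "(\<lambda>n. f (of_rat (r n)) x) = (\<lambda>n. g (of_rat (r n)) x)" using q r0 by auto
      ultimately show "f t x = g t x" using LIMSEQ_unique by metis
    qed
  qed
qed

abbreviation ito_sum ::
    "(real \<Rightarrow> 'a \<Rightarrow> real ^ 'm) \<Rightarrow> (real \<Rightarrow> 'a \<Rightarrow> real ^ 'm) \<Rightarrow> real \<Rightarrow> nat \<Rightarrow> 'a \<Rightarrow> real" where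
  "ito_sum H Z t n \<omega> \<equiv> \<Sum>k<n. H (t * real k / real n) \<omega> \<bullet>
     (Z (t * real (Suc k) / real n) \<omega> - Z (t * real k / real n) \<omega>)"

text \<open>
  By the lemma of Borel and Cantelli, convergence in probability becomes almost sure convergence
  along all uniform partitions that are refined fast enough. The freedom in the choice of
  \<open>r\<close> allows a common sequence of partitions for several integrals.
\<close>

lemma ito_integral_AE_limit:
  fixes H Z :: "real \<Rightarrow> 'a \<Rightarrow> real ^ 'm"
  assumes "prob_space M" and J: "ito_integral M H Z J"
    and H[measurable]: "\<And>s. s \<ge> 0 \<Longrightarrow> H s \<in> borel_measurable M"
    and Z[measurable]: "\<And>s. s \<ge> 0 \<Longrightarrow> Z s \<in> borel_measurable M"
    and t: "t \<ge> 0"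
  shows "\<exists>\<nu> :: nat \<Rightarrow> nat. \<forall>r. (\<forall>j. r j \<ge> \<nu> j) \<longrightarrow>
     (AE \<omega> in M. (\<lambda>j. ito_sum H Z t (r j) \<omega>) \<longlonglongrightarrow> J t \<omega>)"
proof -
  interpret prob_space M by fact
  define \<Sigma> where "\<Sigma> = (\<lambda>n \<omega>. ito_sum H Z t n \<omega>)"
  have [measurable]: "J t \<in> borel_measurable M"
    using J t by (auto simp: ito_integral_def continuous_process_def)
  have [measurable]: "\<Sigma> n \<in> borel_measurable M" for n
    unfolding \<Sigma>_def using t by (intro borel_measurable_sum borel_measurable_inner borel_measurable_diff H Z) auto
  have "\<exists>n0. \<forall>n\<ge>n0. prob {\<omega> \<in> space M. \<bar>\<Sigma> n \<omega> - J t \<omega>\<bar> > \<epsilon>} < \<epsilon>" if "\<epsilon> > 0" for \<epsilon>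
  proof -
    from J t \<open>\<epsilon> > 0\<close> obtain \<delta> where \<delta>: "\<delta> > 0" and D: "\<And>n (\<tau> :: nat \<Rightarrow> real).
        \<tau> 0 = 0 \<and> \<tau> n = t \<and> (\<forall>k<n. \<tau> k \<le> \<tau> (Suc k) \<and> \<tau> (Suc k) - \<tau> k < \<delta>) \<Longrightarrow>
        prob {\<omega> \<in> space M. \<bar>(\<Sum>k<n. H (\<tau> k) \<omega> \<bullet> (Z (\<tau> (Suc k)) \<omega> - Z (\<tau> k) \<omega>)) - J t \<omega>\<bar> > \<epsilon>} < \<epsilon>"
      unfolding ito_integral_def by meson
    obtain n0 :: nat where n0: "t / \<delta> < real n0" using reals_Archimedean2 by blast
    show ?thesis
    proof (intro exI[of _ "Suc n0"] allI impI)
      fix n assume n: "n \<ge> Suc n0"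
      have "t < \<delta> * real n0" using n0 \<delta> by (simp add: field_simps)
      also have "\<dots> \<le> \<delta> * real n" using n \<delta> by simp
      finally have mesh: "t / real n < \<delta>" using n by (simp add: field_simps)
      have step: "t * real (Suc k) / real n - t * real k / real n = t / real n" for k
        by (simp add: diff_divide_distrib[symmetric] algebra_simps)
      have "t / real n \<ge> 0" using t by simp
      then have "t * real k / real n \<le> t * real (Suc k) / real n" for k using step[of k] by linarith
      then show "prob {\<omega> \<in> space M. \<bar>\<Sigma> n \<omega> - J t \<omega>\<bar> > \<epsilon>} < \<epsilon>"
        unfolding \<Sigma>_def using n mesh step by (intro D) auto
    qed
  qed
  then have "\<forall>j. \<exists>n0. \<forall>n\<ge>n0. prob {\<omega> \<in> space M. \<bar>\<Sigma> n \<omega> - J t \<omega>\<bar> > (1/2)^j} < (1/2)^j" by simp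
  then obtain \<nu> where \<nu>: "\<And>j n. n \<ge> \<nu> j \<Longrightarrow> prob {\<omega> \<in> space M. \<bar>\<Sigma> n \<omega> - J t \<omega>\<bar> > (1/2)^j} < (1/2)^j"
    by metis
  show ?thesis
  proof (intro exI[of _ \<nu>] allI impI)
    fix r :: "nat \<Rightarrow> nat" assume r: "\<forall>j. r j \<ge> \<nu> j"
    have "AE \<omega> in M. eventually (\<lambda>j. \<omega> \<in> space M - {\<omega> \<in> space M. \<bar>\<Sigma> (r j) \<omega> - J t \<omega>\<bar> > (1/2)^j}) sequentially"
    proof (rule borel_cantelli_AE1)
      show "summable (\<lambda>j. prob {\<omega> \<in> space M. \<bar>\<Sigma> (r j) \<omega> - J t \<omega>\<bar> > (1/2)^j})"
        by (rule summable_comparison_test'[of "\<lambda>j. (1/2)^j" 0])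
           (use r \<nu> in \<open>auto intro: less_imp_le summable_geometric\<close>)
    qed (auto simp: less_top[symmetric])
    then have "AE \<omega> in M. (\<lambda>j. \<Sigma> (r j) \<omega>) \<longlonglongrightarrow> J t \<omega>"
    proof eventually_elim
      case (elim \<omega>)
      then have "eventually (\<lambda>j. norm (\<Sigma> (r j) \<omega> - J t \<omega>) \<le> (1/2)^j) sequentially"
        by eventually_elim auto
      moreover have "(\<lambda>j. (1/2::real)^j) \<longlonglongrightarrow> 0" by (rule LIMSEQ_power_zero) simp
      ultimately have "(\<lambda>j. \<Sigma> (r j) \<omega> - J t \<omega>) \<longlonglongrightarrow> 0"
        by (rule Lim_null_comparison)
      then show ?case by (simp add: LIM_zero_iff)
    qed
    then show "AE \<omega> in M. (\<lambda>j. ito_sum H Z t (r j) \<omega>) \<longlonglongrightarrow> J t \<omega>"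
      by (simp only: \<Sigma>_def)
  qed
qed

section \<open>Integration by parts and the finite filter\<close>

lemma continuous_process_measurable:
  "continuous_process M Y \<Longrightarrow> t \<ge> 0 \<Longrightarrow> Y t \<in> borel_measurable M"
  by (simp add: continuous_process_def)

lemma continuous_process_continuous:
  "continuous_process M Y \<Longrightarrow> AE \<omega> in M. continuous_on {0..} (\<lambda>t. Y t \<omega>)"
  by (simp add: continuous_process_def)

lemma ito_integral_continuous: "ito_integral M H Z J \<Longrightarrow> continuous_process M J"
  by (simp add: ito_integral_def)

lemma ito_integral_unique:
  fixes H H' Z :: "real \<Rightarrow> 'a \<Rightarrow> real ^ 'm"
  assumes M: "prob_space M" and Z: "continuous_process M Z"
    and J: "ito_integral M H Z J" and J': "ito_integral M H' Z J'"
    and H: "\<And>s. s \<ge> 0 \<Longrightarrow> H s \<in> borel_measurable M"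
    and H': "\<And>s. s \<ge> 0 \<Longrightarrow> H' s \<in> borel_measurable M"
    and eq: "AE \<omega> in M. \<forall>t\<ge>0. H t \<omega> = H' t \<omega>"
  shows "AE \<omega> in M. \<forall>t\<ge>0. J t \<omega> = J' t \<omega>"
proof (rule AE_all_times_eqI)
  fix t :: real assume t: "t \<ge> 0"
  note Zm = continuous_process_measurable[OF Z]
  obtain \<nu> where \<nu>: "\<forall>r. (\<forall>j. r j \<ge> \<nu> j) \<longrightarrow>
     (AE \<omega> in M. (\<lambda>j. ito_sum H Z t (r j) \<omega>) \<longlonglongrightarrow> J t \<omega>)"
    using ito_integral_AE_limit[OF M J H Zm t] ..
  obtain \<nu>' where \<nu>': "\<forall>r. (\<forall>j. r j \<ge> \<nu>' j) \<longrightarrow>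
     (AE \<omega> in M. (\<lambda>j. ito_sum H' Z t (r j) \<omega>) \<longlonglongrightarrow> J' t \<omega>)"
    using ito_integral_AE_limit[OF M J' H' Zm t] ..
  define r where "r = (\<lambda>j. max (\<nu> j) (\<nu>' j))"
  have r: "\<forall>j. r j \<ge> \<nu> j" "\<forall>j. r j \<ge> \<nu>' j" by (simp_all add: r_def)
  show "AE \<omega> in M. J t \<omega> = J' t \<omega>"
    using \<nu>[THEN spec, THEN mp, OF r(1)] \<nu>'[THEN spec, THEN mp, OF r(2)] eq
  proof eventually_elim
    case (elim \<omega>)
    have "H (t * real k / real n) \<omega> = H' (t * real k / real n) \<omega>" for k n :: nat
      using elim(3) t by simp
    with elim(1,2) show ?case by (simp add: LIMSEQ_unique)
  qed
qed (intro continuous_process_continuous ito_integral_continuous[OF J] ito_integral_continuous[OF J'])+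

lemma ito_integral_ae_measurable:
  fixes Z :: "real \<Rightarrow> 'a \<Rightarrow> real ^ 'm" and \<kappa> :: "real \<Rightarrow> 'a \<Rightarrow> real" and C :: "real ^ 'm"
  assumes M: "prob_space M" and Z: "continuous_process M Z"
    and J: "ito_integral M (\<lambda>s \<omega>. \<kappa> s \<omega> *\<^sub>R C) Z J"
    and \<kappa>: "\<And>s. s \<ge> 0 \<Longrightarrow> \<kappa> s \<in> borel_measurable M" and t: "t \<ge> 0"
    and \<kappa>F: "\<And>s. 0 \<le> s \<Longrightarrow> s \<le> t \<Longrightarrow> ae_measurable M F (\<kappa> s)"
    and ZF: "\<And>s. 0 \<le> s \<Longrightarrow> s \<le> t \<Longrightarrow> ae_measurable M F (\<lambda>\<omega>. C \<bullet> Z s \<omega>)"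
  shows "ae_measurable M F (J t)"
proof -
  have "(\<lambda>\<omega>. \<kappa> s \<omega> *\<^sub>R C) \<in> borel_measurable M" if "s \<ge> 0" for s
    using \<kappa>[OF that] by measurable
  from ito_integral_AE_limit[OF M J this continuous_process_measurable[OF Z] t]
  obtain \<nu> where lim: "AE \<omega> in M. (\<lambda>j. ito_sum (\<lambda>s \<omega>. \<kappa> s \<omega> *\<^sub>R C) Z t (\<nu> j) \<omega>) \<longlonglongrightarrow> J t \<omega>"
    by blast
  show ?thesis
  proof (rule ae_measurable_LIMSEQ[OF _ lim])
    fix j :: nat
    have "t * real k / real n \<le> t" if "k \<le> n" for k n :: nat
      using that t by (cases "n = 0") (auto simp: divide_le_eq mult_left_mono)
    then show "ae_measurable M F (\<lambda>\<omega>. ito_sum (\<lambda>s \<omega>. \<kappa> s \<omega> *\<^sub>R C) Z t (\<nu> j) \<omega>)"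
      using t by (simp only: inner_diff_right inner_scaleR_left)
        (intro ae_measurable_intros \<kappa>F ZF; simp del: of_nat_Suc)
  qed
qed

text \<open>
  For an integrand that is continuously differentiable in time, summation by parts turns the
  defining sums into Stieltjes sums against the integrand, which converge along every path.
\<close>

lemma ito_integral_by_parts:
  fixes Z :: "real \<Rightarrow> 'a \<Rightarrow> real ^ 'm" and \<kappa> \<kappa>' :: "real \<Rightarrow> 'a \<Rightarrow> real" and C :: "real ^ 'm"
  assumes M: "prob_space M" and Z: "continuous_process M Z" and Z0: "AE \<omega> in M. Z 0 \<omega> = 0"
    and J: "ito_integral M (\<lambda>s \<omega>. \<kappa> s \<omega> *\<^sub>R C) Z J"
    and \<kappa>: "\<And>s. s \<ge> 0 \<Longrightarrow> \<kappa> s \<in> borel_measurable M"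
    and \<kappa>': "AE \<omega> in M. continuous_on {0..} (\<lambda>t. \<kappa>' t \<omega>) \<and>
       (\<forall>t\<ge>0. ((\<lambda>t. \<kappa> t \<omega>) has_real_derivative \<kappa>' t \<omega>) (at t within {0..}))"
  shows "AE \<omega> in M. \<forall>t\<ge>0. J t \<omega> = \<kappa> t \<omega> * (C \<bullet> Z t \<omega>) - integral {0..t} (\<lambda>s. \<kappa>' s \<omega> * (C \<bullet> Z s \<omega>))"
proof (rule AE_all_times_eqI)
  have cZ: "AE \<omega> in M. continuous_on {0..} (\<lambda>t. Z t \<omega>)"
    using Z by (simp add: continuous_process_def)
  show "AE \<omega> in M. continuous_on {0..} (\<lambda>t. J t \<omega>)"
    by (intro continuous_process_continuous ito_integral_continuous[OF J])
  show "AE \<omega> in M. continuous_on {0..} (\<lambda>t. \<kappa> t \<omega> * (C \<bullet> Z t \<omega>) - integral {0..t} (\<lambda>s. \<kappa>' s \<omega> * (C \<bullet> Z s \<omega>)))"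
    using \<kappa>' cZ
  proof eventually_elim
    case (elim \<omega>)
    then have "continuous_on {0..} (\<lambda>t. \<kappa> t \<omega>)" by (intro DERIV_continuous_on) auto
    with elim show ?case by (intro continuous_intros continuous_on_integral_Ici) auto
  qed
  fix t :: real assume t: "t \<ge> 0"
  have "(\<lambda>\<omega>. \<kappa> s \<omega> *\<^sub>R C) \<in> borel_measurable M" if "s \<ge> 0" for s
    using \<kappa>[OF that] by measurable
  from ito_integral_AE_limit[OF M J this continuous_process_measurable[OF Z] t]
  obtain \<nu> where \<nu>: "\<forall>r. (\<forall>j. r j \<ge> \<nu> j) \<longrightarrow>
     (AE \<omega> in M. (\<lambda>j. ito_sum (\<lambda>s \<omega>. \<kappa> s \<omega> *\<^sub>R C) Z t (r j) \<omega>) \<longlonglongrightarrow> J t \<omega>)"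
    ..
  define r where "r = (\<lambda>j. max (\<nu> j) j)"
  have r: "filterlim r at_top sequentially"
    by (rule filterlim_at_top_mono[OF filterlim_ident]) (auto simp: r_def)
  have lim: "AE \<omega> in M. (\<lambda>j. ito_sum (\<lambda>s \<omega>. \<kappa> s \<omega> *\<^sub>R C) Z t (r j) \<omega>) \<longlonglongrightarrow> J t \<omega>"
    by (rule \<nu>[THEN spec, THEN mp]) (simp add: r_def)
  show "AE \<omega> in M. J t \<omega> = \<kappa> t \<omega> * (C \<bullet> Z t \<omega>) - integral {0..t} (\<lambda>s. \<kappa>' s \<omega> * (C \<bullet> Z s \<omega>))"
    using lim \<kappa>' cZ Z0
  proof eventually_elim
    case (elim \<omega>)
    define \<zeta> where "\<zeta> = (\<lambda>s. C \<bullet> Z s \<omega>)"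
    have c\<zeta>: "continuous_on {0..} \<zeta>" unfolding \<zeta>_def using elim(3) by (intro continuous_intros)
    have d\<kappa>: "((\<lambda>t. \<kappa> t \<omega>) has_real_derivative \<kappa>' s \<omega>) (at s within {0..t})" if "s \<in> {0..t}" for s
      by (rule DERIV_subset[of _ _ s "{0..}"]) (use elim(2) that in auto)
    have c\<zeta>t: "continuous_on {0..t} \<zeta>" and c\<kappa>t: "continuous_on {0..t} (\<lambda>s. \<kappa>' s \<omega>)"
      by (rule continuous_on_subset[of "{0..}"], use c\<zeta> elim(2) in auto)+
    have c\<zeta>\<kappa>t: "continuous_on {0..t} (\<lambda>s. \<zeta> s * \<kappa>' s \<omega>)"
      by (intro continuous_intros c\<zeta>t c\<kappa>t)
    have "(\<lambda>n. \<Sum>k<n. \<zeta> (t * real (Suc k) / real n) * (\<kappa> (t * real (Suc k) / real n) \<omega> - \<kappa> (t * real k / real n) \<omega>))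
        \<longlonglongrightarrow> integral {0..t} (\<lambda>s. \<zeta> s * \<kappa>' s \<omega>) - integral {0..0} (\<lambda>s. \<zeta> s * \<kappa>' s \<omega>)"
    proof (rule tagged_sums_tendsto[OF t c\<zeta>t c\<kappa>t d\<kappa> integral_has_real_derivative[OF c\<zeta>\<kappa>t]])
      fix n k :: nat
      show "t * real (Suc k) / real n \<in> {t * real k / real n..t * real (Suc k) / real n}"
        using t by (auto intro!: divide_right_mono mult_left_mono)
    qed
    then have *: "(\<lambda>n. \<kappa> t \<omega> * \<zeta> t - (\<Sum>k<n. \<zeta> (t * real (Suc k) / real n) * (\<kappa> (t * real (Suc k) / real n) \<omega> - \<kappa> (t * real k / real n) \<omega>)))
        \<longlonglongrightarrow> \<kappa> t \<omega> * \<zeta> t - integral {0..t} (\<lambda>s. \<kappa>' s \<omega> * \<zeta> s)"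
      by (intro tendsto_intros) (simp add: mult.commute)
    \<comment> \<open>The defining sum is a boundary term minus a Stieltjes sum against \<open>\<kappa>\<close> tagged at right endpoints.\<close>
    have abel: "(ito_sum (\<lambda>s \<omega>. \<kappa> s \<omega> *\<^sub>R C) Z t n \<omega>)
      = \<kappa> t \<omega> * \<zeta> t - (\<Sum>k<n. \<zeta> (t * real (Suc k) / real n) * (\<kappa> (t * real (Suc k) / real n) \<omega> - \<kappa> (t * real k / real n) \<omega>))"
      if "n > 0" for n :: nat
    proof -
      define p where "p = (\<lambda>k. \<kappa> (t * real k / real n) \<omega> * \<zeta> (t * real k / real n))"
      have "\<kappa> t \<omega> * \<zeta> t = (\<Sum>k<n. p (Suc k) - p k)"
        using that elim(4) by (subst sum_lessThan_telescope) (simp add: p_def \<zeta>_def)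
      then show ?thesis
        by (simp add: p_def \<zeta>_def sum_subtractf[symmetric] algebra_simps inner_diff_right del: of_nat_Suc)
    qed
    have "(\<lambda>n. ito_sum (\<lambda>s \<omega>. \<kappa> s \<omega> *\<^sub>R C) Z t n \<omega>)
        \<longlonglongrightarrow> \<kappa> t \<omega> * \<zeta> t - integral {0..t} (\<lambda>s. \<kappa>' s \<omega> * \<zeta> s)"
      by (rule Lim_transform_eventually[OF *])
         (use abel in \<open>auto intro!: eventually_mono[OF eventually_gt_at_top[of 0]]\<close>)
    from filterlim_compose[OF this r] elim(1)
    have "J t \<omega> = \<kappa> t \<omega> * \<zeta> t - integral {0..t} (\<lambda>s. \<kappa>' s \<omega> * \<zeta> s)"
      by (intro LIMSEQ_unique)
    then show ?case by (simp only: \<zeta>_def)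
  qed
qed

text \<open>
  Here the integrand is deterministic and solves the Riccati equation, so integration by parts
  applies.
\<close>

lemma kalman_bucy_path:
  fixes Z :: "real \<Rightarrow> 'a \<Rightarrow> real ^ 'm" and sB :: "real ^ 'q"
  assumes M: "prob_space M" and Z: "continuous_process M Z" and Z0: "AE \<omega> in M. Z 0 \<omega> = 0"
    and kb: "kalman_bucy M A C sB m0 S0 Z m S"
  shows "riccati A (sB \<bullet> sB) (C \<bullet> C) S"
    and "AE \<omega> in M. kalman_mean A (sB \<bullet> sB) (C \<bullet> C) S (\<lambda>t. C \<bullet> Z t \<omega>) (\<lambda>t. m t \<omega>)"
proof -
  show S: "riccati A (sB \<bullet> sB) (C \<bullet> C) S"
    using kb by (auto simp: kalman_bucy_def riccati_def power2_eq_square algebra_simps)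
  note cS = riccati_continuous[OF S]
  from kb obtain J where cm: "continuous_process M m"
    and J: "ito_integral M (\<lambda>t \<omega>. S t *\<^sub>R C) Z J"
    and m: "AE \<omega> in M. \<forall>t\<ge>0. m t \<omega> = m 0 \<omega> + J t \<omega> +
           integral {0..t} (\<lambda>s. A * m s \<omega> - ((S s *\<^sub>R C) \<bullet> C) * m s \<omega> + 0 * (m s \<omega> - m s \<omega>))"
    unfolding kalman_bucy_def filter_sde_def by blast
  have "AE \<omega> in M. \<forall>t\<ge>0. J t \<omega> = S t * (C \<bullet> Z t \<omega>)
      - integral {0..t} (\<lambda>s. riccati_rhs A (sB \<bullet> sB) (C \<bullet> C) (S s) * (C \<bullet> Z s \<omega>))"
  proof (rule ito_integral_by_parts[OF M Z Z0 J])
    show "AE \<omega> in M. continuous_on {0..} (\<lambda>s. riccati_rhs A (sB \<bullet> sB) (C \<bullet> C) (S s)) \<and>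
       (\<forall>t\<ge>0. (S has_real_derivative riccati_rhs A (sB \<bullet> sB) (C \<bullet> C) (S t)) (at t within {0..}))"
      by (intro AE_I2 conjI continuous_intros cS allI impI riccatiD[OF S])
  qed simp
  moreover have "AE \<omega> in M. continuous_on {0..} (\<lambda>t. m t \<omega>)"
    using cm by (simp add: continuous_process_def)
  ultimately show "AE \<omega> in M. kalman_mean A (sB \<bullet> sB) (C \<bullet> C) S (\<lambda>t. C \<bullet> Z t \<omega>) (\<lambda>t. m t \<omega>)"
    using m
  proof eventually_elim
    case (elim \<omega>)
    have *: "A * m s \<omega> - ((S s *\<^sub>R C) \<bullet> C) * m s \<omega> + 0 * (m s \<omega> - m s \<omega>) = (A - (C \<bullet> C) * S s) * m s \<omega>" for s
      by (simp add: algebra_simps)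
    show ?case
      unfolding kalman_mean_def
    proof (intro conjI allI impI elim(2))
      fix t :: real assume t: "t \<ge> 0"
      show "m t \<omega> = m 0 \<omega> + (S t * (C \<bullet> Z t \<omega>)
          - integral {0..t} (\<lambda>s. riccati_rhs A (sB \<bullet> sB) (C \<bullet> C) (S s) * (C \<bullet> Z s \<omega>)))
          + integral {0..t} (\<lambda>s. (A - (C \<bullet> C) * S s) * m s \<omega>)"
        using elim(1)[rule_format, OF t] elim(3)[rule_format, OF t] unfolding * by linarith
    qed
  qed
qed

abbreviation fpf_drift :: "real \<Rightarrow> real ^ 'm \<Rightarrow> real ^ 'q \<Rightarrow> real \<Rightarrow> real \<Rightarrow> real \<Rightarrow> real" where
  "fpf_drift A C sB \<mu> \<Sigma> y \<equiv>
     A * \<mu> - ((\<Sigma> *\<^sub>R C) \<bullet> C) * \<mu> + fpf_gain A C sB \<Sigma> * (y - \<mu>)"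

text \<open>
  Uniqueness of the stochastic integral makes the driving terms of all particles equal, which is
  what the pathwise analysis needs; it shows that the gain is differentiable, and only then can
  the driving term be integrated by parts.
\<close>

lemma finite_fpf_AE:
  fixes Z :: "real \<Rightarrow> 'a \<Rightarrow> real ^ 'm" and sB :: "real ^ 'q"
  assumes M: "prob_space M" and Z: "continuous_process M Z" and Z0: "AE \<omega> in M. Z 0 \<omega> = 0"
    and N: "N \<ge> 2" and X: "finite_fpf M A C sB Z N X" and ne: "AE \<omega> in M. emp_cov N X 0 \<omega> \<noteq> 0"
  shows "AE \<omega> in M. riccati A (sB \<bullet> sB) (C \<bullet> C) (\<lambda>t. emp_cov N X t \<omega>) \<and>
     (\<forall>t\<ge>0. emp_cov N X t \<omega> > 0) \<and>
     kalman_mean A (sB \<bullet> sB) (C \<bullet> C) (\<lambda>t. emp_cov N X t \<omega>) (\<lambda>t. C \<bullet> Z t \<omega>) (\<lambda>t. emp_mean N X t \<omega>) \<and>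
     (\<forall>t\<ge>0. \<forall>i<N. X i t \<omega> - emp_mean N X t \<omega> =
        sqrt (emp_cov N X t \<omega> / emp_cov N X 0 \<omega>) * (X i 0 \<omega> - emp_mean N X 0 \<omega>))"
proof -
  have cp: "continuous_process M (X i)" if "i < N" for i
    using X that by (simp add: finite_fpf_def filter_sde_def)
  have Xm: "X i t \<in> borel_measurable M" if "i < N" "t \<ge> 0" for i t
    using cp[OF that(1)] that(2) by (rule continuous_process_measurable)
  have mm: "emp_mean N X t \<in> borel_measurable M" if "t \<ge> 0" for t
    unfolding emp_mean_def[abs_def] using Xm that by measurable
  have cm: "emp_cov N X t \<in> borel_measurable M" if "t \<ge> 0" for t
    unfolding emp_cov_def[abs_def] using mm[OF that] Xm that by measurable
  then have Km: "(\<lambda>\<omega>. emp_cov N X t \<omega> *\<^sub>R C) \<in> borel_measurable M" if "t \<ge> 0" for t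
    using that by measurable
  define Q where "Q = (\<lambda>i J. ito_integral M (\<lambda>t \<omega>. emp_cov N X t \<omega> *\<^sub>R C) Z J \<and>
        (AE \<omega> in M. \<forall>t\<ge>0. X i t \<omega> = X i 0 \<omega> + J t \<omega> +
           integral {0..t} (\<lambda>s. fpf_drift A C sB (emp_mean N X s \<omega>) (emp_cov N X s \<omega>) (X i s \<omega>))))"
  have "\<forall>i. i < N \<longrightarrow> (\<exists>J. Q i J)"
    using X unfolding finite_fpf_def filter_sde_def Q_def by blast
  then have "\<exists>J. \<forall>i. i < N \<longrightarrow> Q i (J i)" by (rule choice_iff'[THEN iffD1])
  then obtain J where Q: "\<forall>i. i < N \<longrightarrow> Q i (J i)" ..
  have J: "ito_integral M (\<lambda>t \<omega>. emp_cov N X t \<omega> *\<^sub>R C) Z (J i)"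
    and eq: "AE \<omega> in M. \<forall>t\<ge>0. X i t \<omega> = X i 0 \<omega> + J i t \<omega> +
           integral {0..t} (\<lambda>s. fpf_drift A C sB (emp_mean N X s \<omega>) (emp_cov N X s \<omega>) (X i s \<omega>))"
    if "i < N" for i
    using Q that unfolding Q_def by blast+
  have J0: "ito_integral M (\<lambda>t \<omega>. emp_cov N X t \<omega> *\<^sub>R C) Z (J 0)" using J N by simp
  have "AE \<omega> in M. \<forall>i\<in>{..<N}. \<forall>t\<ge>0. J i t \<omega> = J 0 t \<omega>"
    unfolding AE_finite_all[OF finite_lessThan]
    by (intro ballI ito_integral_unique[OF M Z J J0 Km Km]) simp_all
  moreover have "AE \<omega> in M. \<forall>i\<in>{..<N}. \<forall>t\<ge>0. X i t \<omega> = X i 0 \<omega> + J i t \<omega> +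
           integral {0..t} (\<lambda>s. fpf_drift A C sB (emp_mean N X s \<omega>) (emp_cov N X s \<omega>) (X i s \<omega>))"
    unfolding AE_finite_all[OF finite_lessThan] by (intro ballI eq) simp
  moreover have cont: "AE \<omega> in M. \<forall>i\<in>{..<N}. continuous_on {0..} (\<lambda>t. X i t \<omega>)"
    unfolding AE_finite_all[OF finite_lessThan]
    by (intro ballI continuous_process_continuous cp) simp
  ultimately have path: "AE \<omega> in M. riccati A (sB \<bullet> sB) (C \<bullet> C) (\<lambda>t. emp_cov N X t \<omega>) \<and>
     (\<forall>t\<ge>0. emp_cov N X t \<omega> > 0) \<and>
     (\<forall>t\<ge>0. emp_mean N X t \<omega> = emp_mean N X 0 \<omega> + J 0 t \<omega>
        + integral {0..t} (\<lambda>s. (A - (C \<bullet> C) * emp_cov N X s \<omega>) * emp_mean N X s \<omega>)) \<and>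
     (\<forall>t\<ge>0. \<forall>i<N. X i t \<omega> - emp_mean N X t \<omega> =
        sqrt (emp_cov N X t \<omega> / emp_cov N X 0 \<omega>) * (X i 0 \<omega> - emp_mean N X 0 \<omega>))"
    using ne
  proof eventually_elim
    case (elim \<omega>)
    have c: "continuous_on {0..} (\<lambda>t. X i t \<omega>)" if "i < N" for i using elim(3) that by blast
    have e: "X i t \<omega> = X i 0 \<omega> + J 0 t \<omega> +
           integral {0..t} (\<lambda>s. fpf_drift A C sB (emp_mean N X s \<omega>) (emp_cov N X s \<omega>) (X i s \<omega>))" if "i < N" "t \<ge> 0" for i t
      proof -
      have i: "i \<in> {..<N}" using that by simp
      show ?thesis
        using elim(1)[THEN bspec, OF i, rule_format, OF that(2)] elim(2)[THEN bspec, OF i, rule_format, OF that(2)]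
        by (simp only:)
    qed
    note p = finite_fpf_path[where X=X and \<omega>=\<omega> and J="\<lambda>t. J 0 t \<omega>" and A=A and C=C and sB=sB, OF N c e elim(4)]
    show ?case using p by blast
  qed
  have "AE \<omega> in M. \<forall>t\<ge>0. J 0 t \<omega> = emp_cov N X t \<omega> * (C \<bullet> Z t \<omega>)
      - integral {0..t} (\<lambda>s. riccati_rhs A (sB \<bullet> sB) (C \<bullet> C) (emp_cov N X s \<omega>) * (C \<bullet> Z s \<omega>))"
  proof (rule ito_integral_by_parts[OF M Z Z0 J0 cm])
    show "AE \<omega> in M. continuous_on {0..} (\<lambda>s. riccati_rhs A (sB \<bullet> sB) (C \<bullet> C) (emp_cov N X s \<omega>)) \<and>
       (\<forall>t\<ge>0. ((\<lambda>t. emp_cov N X t \<omega>) has_real_derivative riccati_rhs A (sB \<bullet> sB) (C \<bullet> C) (emp_cov N X t \<omega>)) (at t within {0..}))"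
      using path
    proof eventually_elim
      case (elim \<omega>)
      then have R: "riccati A (sB \<bullet> sB) (C \<bullet> C) (\<lambda>t. emp_cov N X t \<omega>)" by simp
      show ?case by (intro conjI continuous_intros riccati_continuous[OF R] allI impI riccatiD[OF R])
    qed
  qed
  with path cont show ?thesis
  proof eventually_elim
    case (elim \<omega>)
    have c: "continuous_on {0..} (\<lambda>t. emp_mean N X t \<omega>)"
      unfolding emp_mean_def using elim(2) by (intro continuous_intros) auto
    have eq: "\<forall>t\<ge>0. emp_mean N X t \<omega> = emp_mean N X 0 \<omega> + J 0 t \<omega>
        + integral {0..t} (\<lambda>s. (A - (C \<bullet> C) * emp_cov N X s \<omega>) * emp_mean N X s \<omega>)"
      using elim(1) by blast
    have "kalman_mean A (sB \<bullet> sB) (C \<bullet> C) (\<lambda>t. emp_cov N X t \<omega>) (\<lambda>t. C \<bullet> Z t \<omega>) (\<lambda>t. emp_mean N X t \<omega>)"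
      unfolding kalman_mean_def
    proof (intro conjI allI impI c)
      fix t :: real assume t: "t \<ge> 0"
      show "emp_mean N X t \<omega> = emp_mean N X 0 \<omega> + (emp_cov N X t \<omega> * (C \<bullet> Z t \<omega>)
          - integral {0..t} (\<lambda>s. riccati_rhs A (sB \<bullet> sB) (C \<bullet> C) (emp_cov N X s \<omega>) * (C \<bullet> Z s \<omega>)))
          + integral {0..t} (\<lambda>s. (A - (C \<bullet> C) * emp_cov N X s \<omega>) * emp_mean N X s \<omega>)"
        using eq[rule_format, OF t] elim(3)[rule_format, OF t] by linarith
    qed
    with elim(1) show ?case by blast
  qed
qed

section \<open>Square-integrable processes driven by the model\<close>

lemma space_generated_sigma [simp]: "space (generated_sigma M Y T) = space M"
  by (auto simp: generated_sigma_def space_measure_of_conv)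

lemma sets_generated_sigma:
  "sets (generated_sigma M Y T) = sigma_sets (space M) (\<Union>t\<in>T. {Y t -` U \<inter> space M | U. U \<in> sets borel})"
  unfolding generated_sigma_def by (rule sets_measure_of) auto

lemma generated_sigma_measurable:
  assumes "t \<in> T"
  shows "Y t \<in> borel_measurable (generated_sigma M Y T)"
  by (rule measurableI) (use assms in \<open>auto simp: sets_generated_sigma intro!: sigma_sets.Basic\<close>)

lemma subalgebra_generated_sigma:
  assumes "\<And>t. t \<in> T \<Longrightarrow> Y t \<in> borel_measurable M"
  shows "subalgebra M (generated_sigma M Y T)"
proof -
  have "sets (generated_sigma M Y T) \<subseteq> sets M"
    unfolding sets_generated_sigma by (rule sets.sigma_sets_subset) (auto intro: measurable_sets assms)
  then show ?thesis by (simp add: subalgebra_def)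
qed

abbreviation second_moment :: "'a measure \<Rightarrow> ('a \<Rightarrow> real) \<Rightarrow> ennreal" where
  "second_moment M f \<equiv> \<integral>\<^sup>+\<omega>. ennreal ((f \<omega>)\<^sup>2) \<partial>M"

text \<open>
  Continuous processes that are adapted to the fixed \<open>\<sigma>\<close>-algebra
  \<open>F\<close> up to null sets and bounded in \<open>L\<^sup>2\<close> on bounded time
  intervals. The class is closed under linear operations and time integration, so membership of
  the observations and of the functional \<open>L\<close> can be read off from formulas.
\<close>

definition l2_process :: "'a measure \<Rightarrow> 'a measure \<Rightarrow> (real \<Rightarrow> 'a \<Rightarrow> real) \<Rightarrow> bool" where
  "l2_process M F h \<longleftrightarrow>
     (AE \<omega> in M. continuous_on {0..} (\<lambda>t. h t \<omega>)) \<and>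
     (\<forall>t\<ge>0. ae_measurable M F (h t)) \<and>
     (\<forall>T. \<exists>K. \<forall>t\<in>{0..T}. second_moment M (h t) \<le> ennreal K)"

lemma l2_process_bound:
  assumes "l2_process M F h"
  obtains K where "K \<ge> 0" "\<And>t. 0 \<le> t \<Longrightarrow> t \<le> T \<Longrightarrow> second_moment M (h t) \<le> ennreal K"
proof -
  from assms obtain K where K: "\<forall>t\<in>{0..T}. second_moment M (h t) \<le> ennreal K"
    unfolding l2_process_def by blast
  show ?thesis
  proof (rule that[of "max K 0"])
    fix t assume "0 \<le> t" "t \<le> T"
    then have "second_moment M (h t) \<le> ennreal K" using K by simp
    also have "\<dots> \<le> ennreal (max K 0)" by (intro ennreal_leI) simp
    finally show "second_moment M (h t) \<le> ennreal (max K 0)" .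
  qed simp
qed

lemma l2_process_continuous: "l2_process M F h \<Longrightarrow> AE \<omega> in M. continuous_on {0..} (\<lambda>t. h t \<omega>)"
  by (simp add: l2_process_def)

lemma l2_process_ae_measurable: "l2_process M F h \<Longrightarrow> t \<ge> 0 \<Longrightarrow> ae_measurable M F (h t)"
  by (simp add: l2_process_def)

lemma ae_measurable_obtain:
  assumes "subalgebra M F" "ae_measurable M F f"
  obtains g where "g \<in> borel_measurable F" "g \<in> borel_measurable M" "AE x in M. f x = g x"
  using assms by (auto simp: ae_measurable_def dest: measurable_from_subalg)

lemma nn_integral_square_add_le:
  assumes F: "subalgebra M F" and f: "ae_measurable M F f" and g: "ae_measurable M F g"
  shows "second_moment M (\<lambda>\<omega>. f \<omega> + g \<omega>)
    \<le> 2 * second_moment M f + 2 * second_moment M g"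
proof -
  obtain f' where [measurable]: "f' \<in> borel_measurable M" and f': "AE x in M. f x = f' x"
    using F f by (rule ae_measurable_obtain)
  obtain g' where [measurable]: "g' \<in> borel_measurable M" and g': "AE x in M. g x = g' x"
    using F g by (rule ae_measurable_obtain)
  have "second_moment M (\<lambda>\<omega>. f \<omega> + g \<omega>) = second_moment M (\<lambda>\<omega>. f' \<omega> + g' \<omega>)"
    by (rule nn_integral_cong_AE) (use f' g' in eventually_elim, simp)
  also have "\<dots> \<le> (\<integral>\<^sup>+\<omega>. 2 * ennreal ((f' \<omega>)\<^sup>2) + 2 * ennreal ((g' \<omega>)\<^sup>2) \<partial>M)"
  proof (rule nn_integral_mono)
    fix \<omega>
    have "(f' \<omega> + g' \<omega>)\<^sup>2 \<le> 2 * (f' \<omega>)\<^sup>2 + 2 * (g' \<omega>)\<^sup>2"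
      using sum_squares_bound[of "f' \<omega>" "g' \<omega>"] by (simp add: power2_sum)
    then show "ennreal ((f' \<omega> + g' \<omega>)\<^sup>2) \<le> 2 * ennreal ((f' \<omega>)\<^sup>2) + 2 * ennreal ((g' \<omega>)\<^sup>2)"
      by (simp add: ennreal_plus[symmetric] ennreal_mult[symmetric] ennreal_numeral[symmetric]
          del: ennreal_plus ennreal_numeral)
  qed
  also have "\<dots> = 2 * second_moment M f' + 2 * second_moment M g'"
    by (simp add: nn_integral_add nn_integral_cmult)
  also have "second_moment M f' = second_moment M f"
    by (rule nn_integral_cong_AE) (use f' in eventually_elim, simp)
  also have "second_moment M g' = second_moment M g"
    by (rule nn_integral_cong_AE) (use g' in eventually_elim, simp)
  finally show ?thesis .
qed

lemma l2_process_add: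
  assumes F: "subalgebra M F" and f: "l2_process M F f" and g: "l2_process M F g"
  shows "l2_process M F (\<lambda>t \<omega>. f t \<omega> + g t \<omega>)"
  unfolding l2_process_def
proof (intro conjI allI impI)
  show "AE \<omega> in M. continuous_on {0..} (\<lambda>t. f t \<omega> + g t \<omega>)"
    using l2_process_continuous[OF f] l2_process_continuous[OF g]
    by eventually_elim (intro continuous_intros)
  show "ae_measurable M F (\<lambda>\<omega>. f t \<omega> + g t \<omega>)" if "t \<ge> 0" for t
    using that by (intro ae_measurable_intros l2_process_ae_measurable[OF f] l2_process_ae_measurable[OF g])
  fix T :: real
  obtain K where K: "K \<ge> 0" "\<And>t. 0 \<le> t \<Longrightarrow> t \<le> T \<Longrightarrow> second_moment M (f t) \<le> ennreal K"
    using l2_process_bound[OF f] by blast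
  obtain L where L: "L \<ge> 0" "\<And>t. 0 \<le> t \<Longrightarrow> t \<le> T \<Longrightarrow> second_moment M (g t) \<le> ennreal L"
    using l2_process_bound[OF g] by blast
  show "\<exists>K. \<forall>t\<in>{0..T}. second_moment M (\<lambda>\<omega>. f t \<omega> + g t \<omega>) \<le> ennreal K"
  proof (intro exI[of _ "2 * K + 2 * L"] ballI)
    fix t assume t: "t \<in> {0..T}"
    have "second_moment M (\<lambda>\<omega>. f t \<omega> + g t \<omega>)
      \<le> 2 * second_moment M (f t) + 2 * second_moment M (g t)"
      using t by (intro nn_integral_square_add_le[OF F] l2_process_ae_measurable[OF f] l2_process_ae_measurable[OF g]) auto
    also have "\<dots> \<le> 2 * ennreal K + 2 * ennreal L"
      using t by (intro add_mono mult_left_mono K L) auto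
    also have "\<dots> = ennreal (2 * K + 2 * L)"
      using K(1) L(1) by (simp add: ennreal_mult)
    finally show "second_moment M (\<lambda>\<omega>. f t \<omega> + g t \<omega>) \<le> ennreal (2 * K + 2 * L)" .
  qed
qed

lemma l2_process_mult:
  fixes a :: "real \<Rightarrow> real"
  assumes a: "continuous_on {0..} a" and f: "l2_process M F f" and F: "subalgebra M F"
  shows "l2_process M F (\<lambda>t \<omega>. a t * f t \<omega>)"
  unfolding l2_process_def
proof (intro conjI allI impI)
  show "AE \<omega> in M. continuous_on {0..} (\<lambda>t. a t * f t \<omega>)"
    using l2_process_continuous[OF f] by eventually_elim (intro continuous_intros a)
  show "ae_measurable M F (\<lambda>\<omega>. a t * f t \<omega>)" if "t \<ge> 0" for t
    using that by (intro ae_measurable_intros l2_process_ae_measurable[OF f])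
  fix T :: real
  obtain K where K: "K \<ge> 0" "\<And>t. 0 \<le> t \<Longrightarrow> t \<le> T \<Longrightarrow> second_moment M (f t) \<le> ennreal K"
    using l2_process_bound[OF f] by blast
  have "bounded (a ` {0..T})"
    by (intro compact_imp_bounded compact_continuous_image continuous_on_subset[OF a]) auto
  then obtain b where "\<forall>x\<in>a ` {0..T}. norm x \<le> b" unfolding bounded_iff ..
  then have b: "\<bar>a t\<bar> \<le> b" if "t \<in> {0..T}" for t using that by simp
  show "\<exists>K. \<forall>t\<in>{0..T}. second_moment M (\<lambda>\<omega>. a t * f t \<omega>) \<le> ennreal K"
  proof (intro exI[of _ "b\<^sup>2 * K"] ballI)
    fix t assume t: "t \<in> {0..T}"
    have "ae_measurable M F (f t)" using t by (intro l2_process_ae_measurable[OF f]) simp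
    with F obtain f' where [measurable]: "f' \<in> borel_measurable M" and f': "AE x in M. f t x = f' x"
      by (rule ae_measurable_obtain)
    have "second_moment M (\<lambda>\<omega>. a t * f t \<omega>) = (\<integral>\<^sup>+\<omega>. ennreal ((a t)\<^sup>2) * ennreal ((f' \<omega>)\<^sup>2) \<partial>M)"
      by (rule nn_integral_cong_AE) (use f' in eventually_elim, simp add: power_mult_distrib ennreal_mult)
    also have "\<dots> = ennreal ((a t)\<^sup>2) * second_moment M f'" by (simp add: nn_integral_cmult)
    also have "second_moment M f' = second_moment M (f t)"
      by (rule nn_integral_cong_AE) (use f' in eventually_elim, simp)
    also have "ennreal ((a t)\<^sup>2) * \<dots> \<le> ennreal (b\<^sup>2) * ennreal K"
    proof (rule mult_mono)
      have "\<bar>a t\<bar>\<^sup>2 \<le> b\<^sup>2" using b[OF t] by (intro power_mono) auto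
      then show "ennreal ((a t)\<^sup>2) \<le> ennreal (b\<^sup>2)" by (intro ennreal_leI) simp
    qed (use K t in auto)
    also have "\<dots> = ennreal (b\<^sup>2 * K)" using K(1) by (simp add: ennreal_mult)
    finally show "second_moment M (\<lambda>\<omega>. a t * f t \<omega>) \<le> ennreal (b\<^sup>2 * K)" .
  qed
qed

lemma l2_process_cong:
  assumes f: "l2_process M F f" and eq: "AE \<omega> in M. \<forall>t\<ge>0. g t \<omega> = f t \<omega>"
  shows "l2_process M F g"
  unfolding l2_process_def
proof (intro conjI allI impI)
  show "AE \<omega> in M. continuous_on {0..} (\<lambda>t. g t \<omega>)"
    using l2_process_continuous[OF f] eq
  proof eventually_elim
    case (elim \<omega>)
    then show ?case using continuous_on_cong[of "{0..}" "{0..}" "\<lambda>t. g t \<omega>" "\<lambda>t. f t \<omega>"] by simp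
  qed
  have eqt: "AE \<omega> in M. g t \<omega> = f t \<omega>" if "t \<ge> 0" for t
    using eq by eventually_elim (use that in blast)
  show "ae_measurable M F (g t)" if "t \<ge> 0" for t
    by (rule ae_measurable_cong_AE[OF l2_process_ae_measurable[OF f that] eqt[OF that]])
  fix T :: real
  obtain K where K: "\<And>t. 0 \<le> t \<Longrightarrow> t \<le> T \<Longrightarrow> second_moment M (f t) \<le> ennreal K"
    using l2_process_bound[OF f] by blast
  have "second_moment M (g t) = second_moment M (f t)" if "t \<ge> 0" for t
    by (rule nn_integral_cong_AE) (use eqt[OF that] in eventually_elim, simp)
  then show "\<exists>K. \<forall>t\<in>{0..T}. second_moment M (g t) \<le> ennreal K"
    using K by (intro exI[of _ K]) auto
qed

lemma l2_process_const:
  assumes "ae_measurable M F f" "second_moment M f < \<infinity>"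
  shows "l2_process M F (\<lambda>_. f)"
  using assms unfolding l2_process_def
  by (auto intro!: exI[of _ "enn2real (second_moment M f)"])

lemma sum_square_le:
  fixes x :: "nat \<Rightarrow> real"
  shows "(\<Sum>k<n. x k)\<^sup>2 \<le> real n * (\<Sum>k<n. (x k)\<^sup>2)"
  using Cauchy_Schwarz_ineq_sum[of "\<lambda>_. 1" x "{..<n}"] by simp

text \<open>
  Cauchy--Schwarz bounds the second moments of the Riemann sums uniformly, and Fatou's lemma
  passes to the limit. Fubini's theorem would instead ask for joint measurability in time and
  outcome.
\<close>

lemma l2_process_integral:
  assumes F: "subalgebra M F" and f: "l2_process M F f"
  shows "l2_process M F (\<lambda>t \<omega>. integral {0..t} (\<lambda>s. f s \<omega>))"
  unfolding l2_process_def
proof (intro conjI allI impI)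
  note cf = l2_process_continuous[OF f]
  show "AE \<omega> in M. continuous_on {0..} (\<lambda>t. integral {0..t} (\<lambda>s. f s \<omega>))"
    using cf by eventually_elim (rule continuous_on_integral_Ici)
  have cft: "AE \<omega> in M. continuous_on {0..t} (\<lambda>s. f s \<omega>)" for t
    using cf by eventually_elim (auto intro: continuous_on_subset)
  show "ae_measurable M F (\<lambda>\<omega>. integral {0..t} (\<lambda>s. f s \<omega>))" if "t \<ge> 0" for t
    using that cft by (intro ae_measurable_integral l2_process_ae_measurable[OF f])
  fix T :: real
  obtain K where K: "K \<ge> 0" "\<And>t. 0 \<le> t \<Longrightarrow> t \<le> T \<Longrightarrow> second_moment M (f t) \<le> ennreal K"
    using l2_process_bound[OF f] by blast
  show "\<exists>K. \<forall>t\<in>{0..T}. second_moment M (\<lambda>\<omega>. integral {0..t} (\<lambda>s. f s \<omega>)) \<le> ennreal K"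
  proof (intro exI[of _ "T\<^sup>2 * K"] ballI)
    fix t assume "t \<in> {0..T}"
    then have t: "t \<ge> 0" "t \<le> T" by auto
    have grid: "t * real k / real n \<ge> 0" "t * real k / real n \<le> t" if "k < n" for k n :: nat
      using that t by (auto simp: divide_le_eq mult_left_mono)
    have "\<forall>s. s \<ge> 0 \<longrightarrow> (\<exists>g. g \<in> borel_measurable M \<and> (AE x in M. f s x = g x))"
    proof (intro allI impI)
      fix s :: real assume "s \<ge> 0"
      from F l2_process_ae_measurable[OF f this]
      obtain g where "g \<in> borel_measurable M" "AE x in M. f s x = g x"
        by (rule ae_measurable_obtain)
      then show "\<exists>g. g \<in> borel_measurable M \<and> (AE x in M. f s x = g x)" by blast
    qed
    then have "\<exists>g. \<forall>s. s \<ge> 0 \<longrightarrow> g s \<in> borel_measurable M \<and> (AE x in M. f s x = g s x)"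
      by (rule choice_iff'[THEN iffD1])
    then obtain g where g: "\<And>s. s \<ge> 0 \<Longrightarrow> g s \<in> borel_measurable M" "\<And>s. s \<ge> 0 \<Longrightarrow> AE x in M. f s x = g s x"
      by blast
    define R where "R = (\<lambda>n \<omega>. \<Sum>k<n. t / real n * g (t * real k / real n) \<omega>)"
    have [measurable]: "R n \<in> borel_measurable M" for n
      unfolding R_def using grid by (intro borel_measurable_sum borel_measurable_times g) auto
    have RE: "second_moment M (R n) \<le> ennreal (T\<^sup>2 * K)" for n
    proof -
      have "second_moment M (R n)
          \<le> (\<integral>\<^sup>+\<omega>. (\<Sum>k<n. ennreal (real n * (t / real n)\<^sup>2) * ennreal ((g (t * real k / real n) \<omega>)\<^sup>2)) \<partial>M)"
      proof (rule nn_integral_mono)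
        fix \<omega>
        have "(R n \<omega>)\<^sup>2 \<le> real n * (\<Sum>k<n. (t / real n * g (t * real k / real n) \<omega>)\<^sup>2)"
          unfolding R_def by (rule sum_square_le)
        also have "\<dots> = (\<Sum>k<n. real n * (t / real n)\<^sup>2 * (g (t * real k / real n) \<omega>)\<^sup>2)"
          by (simp only: sum_distrib_left power_mult_distrib mult.assoc)
        finally show "ennreal ((R n \<omega>)\<^sup>2)
            \<le> (\<Sum>k<n. ennreal (real n * (t / real n)\<^sup>2) * ennreal ((g (t * real k / real n) \<omega>)\<^sup>2))"
          by (simp add: ennreal_mult[symmetric] sum_ennreal ennreal_leI)
      qed
      also have "\<dots> = (\<Sum>k<n. ennreal (real n * (t / real n)\<^sup>2) * (\<integral>\<^sup>+\<omega>. ennreal ((g (t * real k / real n) \<omega>)\<^sup>2) \<partial>M))"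
        using grid g(1) by (subst nn_integral_sum) (auto intro!: sum.cong nn_integral_cmult)
      also have "\<dots> \<le> (\<Sum>k<n. ennreal (real n * (t / real n)\<^sup>2) * ennreal K)"
      proof (intro sum_mono mult_left_mono)
        fix k assume "k \<in> {..<n}"
        then have k: "t * real k / real n \<ge> 0" "t * real k / real n \<le> T" using grid[of k n] t by auto
        have "(\<integral>\<^sup>+\<omega>. ennreal ((g (t * real k / real n) \<omega>)\<^sup>2) \<partial>M) = (\<integral>\<^sup>+\<omega>. ennreal ((f (t * real k / real n) \<omega>)\<^sup>2) \<partial>M)"
          by (rule nn_integral_cong_AE) (use g(2)[OF k(1)] in eventually_elim, simp)
        also have "\<dots> \<le> ennreal K" using k by (rule K)
        finally show "(\<integral>\<^sup>+\<omega>. ennreal ((g (t * real k / real n) \<omega>)\<^sup>2) \<partial>M) \<le> ennreal K" .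
      qed simp
      also have "\<dots> = (\<Sum>k<n. ennreal (real n * (t / real n)\<^sup>2 * K))"
        using K(1) by (simp add: ennreal_mult)
      also have "\<dots> = ennreal (\<Sum>k<n. real n * (t / real n)\<^sup>2 * K)"
        by (rule sum_ennreal) (use K(1) in auto)
      also have "\<dots> \<le> ennreal (T\<^sup>2 * K)"
      proof (rule ennreal_leI)
        have "(\<Sum>k<n. real n * (t / real n)\<^sup>2 * K) \<le> t\<^sup>2 * K"
          using K(1) by (cases "n = 0") (auto simp: power2_eq_square)
        also have "\<dots> \<le> T\<^sup>2 * K" using t K(1) by (intro mult_right_mono power_mono) auto
        finally show "(\<Sum>k<n. real n * (t / real n)\<^sup>2 * K) \<le> T\<^sup>2 * K" .
      qed
      finally show ?thesis .
    qed
    have all: "AE \<omega> in M. \<forall>n. \<forall>k\<in>{..<n}. f (t * real k / real n) \<omega> = g (t * real k / real n) \<omega>"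
      unfolding AE_all_countable AE_finite_all[OF finite_lessThan]
      using grid by (intro allI ballI g(2)) auto
    have "second_moment M (\<lambda>\<omega>. integral {0..t} (\<lambda>s. f s \<omega>)) = (\<integral>\<^sup>+\<omega>. liminf (\<lambda>n. ennreal ((R n \<omega>)\<^sup>2)) \<partial>M)"
    proof (rule nn_integral_cong_AE)
      show "AE \<omega> in M. ennreal ((integral {0..t} (\<lambda>s. f s \<omega>))\<^sup>2) = liminf (\<lambda>n. ennreal ((R n \<omega>)\<^sup>2))"
        using all cft[of t]
      proof eventually_elim
        case (elim \<omega>)
        have "R n \<omega> = (\<Sum>k<n. t / real n * f (t * real k / real n) \<omega>)" for n
          unfolding R_def using elim(1) by (intro sum.cong) auto
        with riemann_sums_tendsto_integral[OF t(1) elim(2)]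
        have "(\<lambda>n. R n \<omega>) \<longlonglongrightarrow> integral {0..t} (\<lambda>s. f s \<omega>)" by simp
        then have "(\<lambda>n. ennreal ((R n \<omega>)\<^sup>2)) \<longlonglongrightarrow> ennreal ((integral {0..t} (\<lambda>s. f s \<omega>))\<^sup>2)"
          by (intro tendsto_intros)
        from lim_imp_Liminf[OF _ this] show ?case by simp
      qed
    qed
    also have "\<dots> \<le> liminf (\<lambda>n. \<integral>\<^sup>+\<omega>. ennreal ((R n \<omega>)\<^sup>2) \<partial>M)"
      by (rule nn_integral_liminf) measurable
    also have "\<dots> \<le> ennreal (T\<^sup>2 * K)"
      using Liminf_mono[of "\<lambda>n. \<integral>\<^sup>+\<omega>. ennreal ((R n \<omega>)\<^sup>2) \<partial>M" "\<lambda>_. ennreal (T\<^sup>2 * K)" sequentially] RE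
      by (simp add: Liminf_const)
    finally show "second_moment M (\<lambda>\<omega>. integral {0..t} (\<lambda>s. f s \<omega>)) \<le> ennreal (T\<^sup>2 * K)" .
  qed
qed

lemma l2_process_sum:
  assumes F: "subalgebra M F" and "finite I" and "\<And>i. i \<in> I \<Longrightarrow> l2_process M F (f i)"
  shows "l2_process M F (\<lambda>t \<omega>. \<Sum>i\<in>I. f i t \<omega>)"
  using assms(2,3)
proof (induction I rule: finite_induct)
  case empty
  show ?case by (simp add: l2_process_const ae_measurable_const)
next
  case (insert i I)
  then show ?case by (simp add: l2_process_add[OF F])
qed

lemma standard_wiener_second_moment:
  assumes M: "prob_space M" and W: "standard_wiener M W" and t: "t \<ge> 0"
  shows "second_moment M (\<lambda>\<omega>. W t \<omega> $ j) \<le> ennreal t"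
proof -
  interpret prob_space M by fact
  have W0: "AE \<omega> in M. W 0 \<omega> = 0" using W by (simp add: standard_wiener_def)
  show ?thesis
  proof (cases "t = 0")
    case True
    have "second_moment M (\<lambda>\<omega>. W t \<omega> $ j) = (\<integral>\<^sup>+\<omega>. 0 \<partial>M)"
      by (rule nn_integral_cong_AE) (use W0 True in \<open>auto elim: eventually_mono\<close>)
    then show ?thesis by simp
  next
    case False
    with t have t: "t > 0" by simp
    define w where "w = (\<lambda>\<omega>. (W t \<omega> - W 0 \<omega>) $ j)"
    have D: "distributed M lborel w (normal_density 0 (sqrt t))"
      using W t unfolding standard_wiener_def w_def by force
    have i: "integrable M (\<lambda>\<omega>. (w \<omega>)\<^sup>2)"
      using integrable_normal_moment[of "sqrt t" 0 2] t
      by (subst distributed_integrable[OF D, symmetric]) auto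
    have "expectation (\<lambda>\<omega>. (w \<omega>)\<^sup>2) = t"
      using normal_distributed_variance[OF _ D] normal_distributed_expectation[OF _ D] t by simp
    then have "second_moment M w = ennreal t"
      by (subst nn_integral_eq_integral[OF i]) auto
    moreover have "second_moment M (\<lambda>\<omega>. W t \<omega> $ j) = second_moment M w"
      by (rule nn_integral_cong_AE) (use W0 in \<open>auto simp: w_def elim: eventually_mono\<close>)
    ultimately show ?thesis by simp
  qed
qed

lemma l2_process_wiener:
  fixes W :: "real \<Rightarrow> 'a \<Rightarrow> real ^ 'm"
  assumes M: "prob_space M" and W: "standard_wiener M W" and F: "subalgebra M F"
    and WF: "\<And>t. t \<ge> 0 \<Longrightarrow> W t \<in> borel_measurable F"
  shows "l2_process M F (\<lambda>t \<omega>. v \<bullet> W t \<omega>)"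
proof -
  have c: "AE \<omega> in M. continuous_on {0..} (\<lambda>t. W t \<omega>)"
    using W unfolding standard_wiener_def by (intro continuous_process_continuous) blast
  have "l2_process M F (\<lambda>t \<omega>. W t \<omega> $ j)" for j
    unfolding l2_process_def
  proof (intro conjI allI impI)
    show "AE \<omega> in M. continuous_on {0..} (\<lambda>t. W t \<omega> $ j)"
      using c by eventually_elim (intro continuous_intros)
    show "ae_measurable M F (\<lambda>\<omega>. W t \<omega> $ j)" if "t \<ge> 0" for t
    proof (rule ae_measurableI)
      note [measurable] = WF[OF that]
      have "(\<lambda>\<omega>. W t \<omega> \<bullet> axis j 1) \<in> borel_measurable F" by measurable
      then show "(\<lambda>\<omega>. W t \<omega> $ j) \<in> borel_measurable F" by (simp add: inner_axis)
    qed
    fix T :: real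
    have "second_moment M (\<lambda>\<omega>. W t \<omega> $ j) \<le> ennreal T" if "t \<in> {0..T}" for t
      using standard_wiener_second_moment[OF M W, of t j] that
      by (auto intro: order_trans ennreal_leI)
    then show "\<exists>K. \<forall>t\<in>{0..T}. second_moment M (\<lambda>\<omega>. W t \<omega> $ j) \<le> ennreal K" by blast
  qed
  then have "l2_process M F (\<lambda>t \<omega>. \<Sum>j\<in>UNIV. v $ j * W t \<omega> $ j)"
    by (intro l2_process_sum[OF F] l2_process_mult[OF _ _ F]) auto
  then show ?thesis by (simp add: inner_vec_def)
qed

text \<open>
  The \<open>\<sigma>\<close>-algebra of the initial state and both noises, from which the initial
  ensemble is independent.
\<close>

definition model_sigma ::
    "'a measure \<Rightarrow> (real \<Rightarrow> 'a \<Rightarrow> real) \<Rightarrow> (real \<Rightarrow> 'a \<Rightarrow> real ^ 'q) \<Rightarrow> (real \<Rightarrow> 'a \<Rightarrow> real ^ 'm) \<Rightarrow> 'a measure"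
  where
  "model_sigma M X B W = sigma (space M) (sets (generated_sigma M X {0}) \<union>
          sets (generated_sigma M B {0..}) \<union> sets (generated_sigma M W {0..}))"

lemma generated_sigma_Pow: "sets (generated_sigma M Y T) \<subseteq> Pow (space M)"
  using sets.sets_into_space[of _ "generated_sigma M Y T"] by auto

lemma sets_model_sigma:
  "sets (model_sigma M X B W) = sigma_sets (space M) (sets (generated_sigma M X {0}) \<union>
          sets (generated_sigma M B {0..}) \<union> sets (generated_sigma M W {0..}))"
  unfolding model_sigma_def by (rule sets_measure_of) (intro Un_least generated_sigma_Pow)

lemma space_model_sigma [simp]: "space (model_sigma M X B W) = space M"
  by (simp add: model_sigma_def space_measure_of_conv)

lemma model_sigma_measurable:
  shows "X 0 \<in> borel_measurable (model_sigma M X B W)"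
    and "t \<ge> 0 \<Longrightarrow> B t \<in> borel_measurable (model_sigma M X B W)"
    and "t \<ge> 0 \<Longrightarrow> W t \<in> borel_measurable (model_sigma M X B W)"
proof -
  have "subalgebra (model_sigma M X B W) (generated_sigma M X {0})"
    and "subalgebra (model_sigma M X B W) (generated_sigma M B {0..})"
    and "subalgebra (model_sigma M X B W) (generated_sigma M W {0..})"
    unfolding subalgebra_def by (auto simp: sets_model_sigma intro: sigma_sets.Basic)
  then show "X 0 \<in> borel_measurable (model_sigma M X B W)"
    and "t \<ge> 0 \<Longrightarrow> B t \<in> borel_measurable (model_sigma M X B W)"
    and "t \<ge> 0 \<Longrightarrow> W t \<in> borel_measurable (model_sigma M X B W)"
    by (auto intro!: measurable_from_subalg[OF _ generated_sigma_measurable])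
qed

lemma subalgebra_model_sigma:
  assumes model: "linear_gaussian_model M A C sB m0 S0 X B W Z"
  shows "subalgebra M (model_sigma M X B W)"
proof -
  have cX: "continuous_process M X" and cB: "continuous_process M B" and cW: "continuous_process M W"
    using model by (simp_all add: linear_gaussian_model_def standard_wiener_def)
  have "sets (generated_sigma M X {0}) \<subseteq> sets M" "sets (generated_sigma M B {0..}) \<subseteq> sets M"
    "sets (generated_sigma M W {0..}) \<subseteq> sets M"
    using subalgebra_generated_sigma[of "{0}" X M] subalgebra_generated_sigma[of "{0..}" B M]
      subalgebra_generated_sigma[of "{0..}" W M]
      continuous_process_measurable[OF cX] continuous_process_measurable[OF cB] continuous_process_measurable[OF cW]
    by (auto simp: subalgebra_def)
  then have "sets (model_sigma M X B W) \<subseteq> sets M"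
    unfolding sets_model_sigma by (intro sets.sigma_sets_subset) auto
  then show ?thesis by (simp add: subalgebra_def)
qed

text \<open>
  The signal is an explicit functional of its initial value and its noise, by variation of
  constants, and the observation is an integral of the signal plus noise.
\<close>

lemma observation_l2_process:
  assumes M: "prob_space M" and S0: "S0 > 0" and model: "linear_gaussian_model M A C sB m0 S0 X B W Z"
  shows "AE \<omega> in M. Z 0 \<omega> = 0" and "continuous_process M Z"
    and "l2_process M (model_sigma M X B W) (\<lambda>t \<omega>. integral {0..t} (\<lambda>s. X s \<omega>))"
    and "AE \<omega> in M. \<forall>t\<ge>0. Z t \<omega> = integral {0..t} (\<lambda>s. X s \<omega>) *\<^sub>R C + W t \<omega>"
    and "l2_process M (model_sigma M X B W) (\<lambda>t \<omega>. C \<bullet> Z t \<omega>)"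
proof -
  interpret prob_space M by fact
  let ?H = "model_sigma M X B W"
  have B: "standard_wiener M B" and W: "standard_wiener M W"
    and X0: "distributed M lborel (X 0) (normal_density m0 (sqrt S0))"
    and cX: "continuous_process M X"
    and X: "AE \<omega> in M. \<forall>t\<ge>0. X t \<omega> = X 0 \<omega> + integral {0..t} (\<lambda>s. A * X s \<omega>) + sB \<bullet> B t \<omega>"
    and cZ: "continuous_process M Z"
    and Z: "AE \<omega> in M. \<forall>t\<ge>0. Z t \<omega> = integral {0..t} (\<lambda>s. X s \<omega> *\<^sub>R C) + W t \<omega>"
    using model by (simp_all add: linear_gaussian_model_def)
  show "continuous_process M Z" by fact
  have W0: "AE \<omega> in M. W 0 \<omega> = 0" using W by (simp add: standard_wiener_def)
  show "AE \<omega> in M. Z 0 \<omega> = 0"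
    using Z W0 by eventually_elim simp
  note F = subalgebra_model_sigma[OF model]
  have lB: "l2_process M ?H (\<lambda>t \<omega>. sB \<bullet> B t \<omega>)"
    by (rule l2_process_wiener[OF M B F]) (rule model_sigma_measurable(2))
  have lW: "l2_process M ?H (\<lambda>t \<omega>. C \<bullet> W t \<omega>)"
    by (rule l2_process_wiener[OF M W F]) (rule model_sigma_measurable(3))
  have lX0: "l2_process M ?H (\<lambda>_. X 0)"
  proof (rule l2_process_const)
    show "ae_measurable M ?H (X 0)" by (rule ae_measurableI[OF model_sigma_measurable(1)])
    have [measurable]: "X 0 \<in> borel_measurable M" using X0 by (auto simp: distributed_def)
    have i: "integrable M (\<lambda>\<omega>. (X 0 \<omega> - m0)\<^sup>2)"
      using integrable_normal_moment[of "sqrt S0" m0 2] S0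
      by (subst distributed_integrable[OF X0, symmetric]) auto
    have i': "integrable M (\<lambda>\<omega>. 2 * (X 0 \<omega> - m0)\<^sup>2 + 2 * m0\<^sup>2)" using i by auto
    have "norm ((X 0 \<omega>)\<^sup>2) \<le> norm (2 * (X 0 \<omega> - m0)\<^sup>2 + 2 * m0\<^sup>2)" for \<omega>
      using sum_squares_bound[of "X 0 \<omega> - m0" m0] zero_le_power2[of "X 0 \<omega> - 2 * m0"]
      by (simp add: power2_eq_square algebra_simps)
    then have "integrable M (\<lambda>\<omega>. (X 0 \<omega>)\<^sup>2)"
      by (intro Bochner_Integration.integrable_bound[OF i'] AE_I2) auto
    then show "(\<integral>\<^sup>+\<omega>. ennreal ((X 0 \<omega>)\<^sup>2) \<partial>M) < \<infinity>"
      by (auto simp: integrable_iff_bounded)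
  qed
  \<comment> \<open>Variation of constants for \<open>X - sB \<bullet> B\<close>, whose paths are differentiable.\<close>
  have eA: "continuous_on {0..} (\<lambda>t. exp (A * t))" "continuous_on {0..} (\<lambda>t. A / exp (A * t))"
    by (intro continuous_intros; simp)+
  define V where "V = (\<lambda>t \<omega>. exp (A * t) * (X 0 \<omega> + integral {0..t} (\<lambda>s. A / exp (A * s) * (sB \<bullet> B s \<omega>))) + sB \<bullet> B t \<omega>)"
  have lV: "l2_process M ?H V"
    unfolding V_def
    by (intro l2_process_add[OF F] l2_process_mult[OF _ _ F] l2_process_integral[OF F] lX0 lB eA)
  have "AE \<omega> in M. \<forall>t\<ge>0. X t \<omega> = V t \<omega>"
    using X continuous_process_continuous[OF cX] l2_process_continuous[OF lB]
  proof eventually_elim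
    case (elim \<omega>)
    have cXw: "continuous_on {0..} (\<lambda>t. X t \<omega>)" and cBw: "continuous_on {0..} (\<lambda>t. sB \<bullet> B t \<omega>)"
      using elim(2,3) by auto
    have B0: "sB \<bullet> B 0 \<omega> = 0" using elim(1)[rule_format, of 0] by simp
    show ?case
    proof (intro allI impI)
      fix t :: real assume t: "t \<ge> 0"
      have ca: "continuous_on {0..} (\<lambda>_. A)" and cg: "continuous_on {0..} (\<lambda>s. A * (sB \<bullet> B s \<omega>))"
        by (intro continuous_intros cBw)+
      have d: "((\<lambda>t. X t \<omega> - sB \<bullet> B t \<omega>) has_real_derivative A * X s \<omega>) (at s within {0..})" if "s \<ge> 0" for s
      proof (rule has_derivative_if_integral_equation[OF _ _ that, where k="X 0 \<omega>"])
        show "continuous_on {0..} (\<lambda>s. A * X s \<omega>)" by (intro continuous_intros cXw)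
        show "X t \<omega> - sB \<bullet> B t \<omega> = X 0 \<omega> + integral {0..t} (\<lambda>s. A * X s \<omega>)" if "t \<ge> 0" for t
          using elim(1)[rule_format, OF that] by linarith
      qed
      have "X t \<omega> - sB \<bullet> B t \<omega> = exp (integral {0..t} (\<lambda>_. A)) * ((X 0 \<omega> - sB \<bullet> B 0 \<omega>)
          + integral {0..t} (\<lambda>s. A * (sB \<bullet> B s \<omega>) / exp (integral {0..s} (\<lambda>_. A))))"
        by (rule linear_ode_solution[OF ca cg _ t]) (rule DERIV_cong[OF d], simp_all add: algebra_simps)
      moreover have "integral {0..t} (\<lambda>s. A * (sB \<bullet> B s \<omega>) / exp (integral {0..s} (\<lambda>_. A)))
          = integral {0..t} (\<lambda>s. A / exp (A * s) * (sB \<bullet> B s \<omega>))"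
        by (rule Henstock_Kurzweil_Integration.integral_cong) (simp add: mult.commute)
      ultimately show "X t \<omega> = V t \<omega>" using t B0 by (simp add: V_def mult.commute)
    qed
  qed
  then have lX: "l2_process M ?H X" by (rule l2_process_cong[OF lV])
  show lI: "l2_process M ?H (\<lambda>t \<omega>. integral {0..t} (\<lambda>s. X s \<omega>))"
    by (rule l2_process_integral[OF F lX])
  show Z': "AE \<omega> in M. \<forall>t\<ge>0. Z t \<omega> = integral {0..t} (\<lambda>s. X s \<omega>) *\<^sub>R C + W t \<omega>"
    using Z continuous_process_continuous[OF cX]
  proof eventually_elim
    case (elim \<omega>)
    show ?case
    proof (intro allI impI)
      fix t :: real assume t: "t \<ge> 0"
      have "(\<lambda>s. X s \<omega>) integrable_on {0..t}"
        by (intro integrable_continuous_real continuous_on_subset[OF elim(2)]) auto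
      then have "((\<lambda>s. X s \<omega> *\<^sub>R C) has_integral integral {0..t} (\<lambda>s. X s \<omega>) *\<^sub>R C) {0..t}"
        by (intro has_integral_scaleR_left integrable_integral)
      then show "Z t \<omega> = integral {0..t} (\<lambda>s. X s \<omega>) *\<^sub>R C + W t \<omega>"
        using elim(1)[rule_format, OF t] by (simp add: integral_unique)
    qed
  qed
  have "l2_process M ?H (\<lambda>t \<omega>. (C \<bullet> C) * integral {0..t} (\<lambda>s. X s \<omega>) + C \<bullet> W t \<omega>)"
    by (intro l2_process_add[OF F] l2_process_mult[OF _ _ F] lI lW continuous_intros)
  then show "l2_process M ?H (\<lambda>t \<omega>. C \<bullet> Z t \<omega>)"
    by (rule l2_process_cong) (use Z' in \<open>eventually_elim, simp add: inner_add_right\<close>)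
qed

text \<open>
  The observations are functions of the model data only almost surely, so the
  \<open>\<sigma>\<close>-algebra that they generate is contained in that of the model up to null
  sets.
\<close>

lemma observation_sets_mod_null:
  assumes M: "prob_space M" and S0: "S0 > 0" and model: "linear_gaussian_model M A C sB m0 S0 X B W Z"
    and A: "E \<in> sets (generated_sigma M Z {0..T})"
  shows "\<exists>E'\<in>sets (model_sigma M X B W). AE \<omega> in M. \<omega> \<in> E \<longleftrightarrow> \<omega> \<in> E'"
  using A unfolding sets_generated_sigma
proof (induction rule: sigma_sets.induct)
  case (Basic E)
  then obtain s U where s: "s \<in> {0..T}" and U: "U \<in> sets borel" and E: "E = Z s -` U \<inter> space M" by auto
  note obs = observation_l2_process[OF M S0 model]
  have "ae_measurable M (model_sigma M X B W) (\<lambda>\<omega>. integral {0..s} (\<lambda>s. X s \<omega>))"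
    using obs(3) s by (intro l2_process_ae_measurable[of M _ "\<lambda>s \<omega>. integral {0..s} (\<lambda>s. X s \<omega>)"]) auto
  then obtain g where [measurable]: "g \<in> borel_measurable (model_sigma M X B W)"
    and g: "AE \<omega> in M. integral {0..s} (\<lambda>s. X s \<omega>) = g \<omega>"
    unfolding ae_measurable_def by blast
  have [measurable]: "W s \<in> borel_measurable (model_sigma M X B W)"
    using s by (intro model_sigma_measurable(3)) auto
  have "(\<lambda>\<omega>. g \<omega> *\<^sub>R C + W s \<omega>) -` U \<inter> space (model_sigma M X B W) \<in> sets (model_sigma M X B W)"
    using U by measurable
  moreover have "AE \<omega> in M. \<omega> \<in> E \<longleftrightarrow> \<omega> \<in> (\<lambda>\<omega>. g \<omega> *\<^sub>R C + W s \<omega>) -` U \<inter> space (model_sigma M X B W)"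
    using obs(4) g
  proof eventually_elim
    case (elim \<omega>)
    have "Z s \<omega> = g \<omega> *\<^sub>R C + W s \<omega>" using elim s by auto
    then show ?case by (simp add: E)
  qed
  ultimately show ?case by blast
next
  case Empty
  show ?case by (rule bexI[of _ "{}"]) auto
next
  case (Compl E)
  then obtain E' where E': "E' \<in> sets (model_sigma M X B W)" "AE \<omega> in M. \<omega> \<in> E \<longleftrightarrow> \<omega> \<in> E'" by blast
  have "space (model_sigma M X B W) - E' \<in> sets (model_sigma M X B W)" using E'(1) by (rule sets.compl_sets)
  moreover have "AE \<omega> in M. \<omega> \<in> space M - E \<longleftrightarrow> \<omega> \<in> space (model_sigma M X B W) - E'"
    using E'(2) by eventually_elim auto
  ultimately show ?case by blast
next
  case (Union E)
  then obtain E' where E': "\<And>i. E' i \<in> sets (model_sigma M X B W)" "\<And>i. AE \<omega> in M. \<omega> \<in> E i \<longleftrightarrow> \<omega> \<in> E' i"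
    by metis
  have "(\<Union>i. E' i) \<in> sets (model_sigma M X B W)" using E'(1) by auto
  moreover have "AE \<omega> in M. \<forall>i. \<omega> \<in> E i \<longleftrightarrow> \<omega> \<in> E' i" using E'(2) by (simp add: AE_all_countable)
  then have "AE \<omega> in M. \<omega> \<in> (\<Union>i. E i) \<longleftrightarrow> \<omega> \<in> (\<Union>i. E' i)" by eventually_elim auto
  ultimately show ?case by blast
qed

section \<open>Exactness of the mean-field filter\<close>

lemma generated_sigma_mono:
  assumes "T \<subseteq> T'"
  shows "subalgebra (generated_sigma M Y T') (generated_sigma M Y T)"
  unfolding subalgebra_def sets_generated_sigma
  by (intro conjI sigma_sets_mono') (use assms in auto)

lemma (in prob_space) indep_var_if_sigma_indep:
  assumes ind: "indep_set (sets G) (sets H)" and G: "subalgebra M G" and H: "subalgebra M H"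
    and f: "f \<in> borel_measurable G" and g: "g \<in> borel_measurable H"
  shows "indep_var borel f borel g"
proof -
  have sp: "space G = space M" "space H = space M" using G H by (simp_all add: subalgebra_def)
  have *: "sigma_sets (space M) {f -` A \<inter> space M |A. A \<in> sets borel} \<subseteq> sets G"
    using f sp by (intro sets.sigma_sets_subset[of _ G, unfolded sp]) (auto intro: measurable_sets[of f G, unfolded sp])
  have **: "sigma_sets (space M) {g -` A \<inter> space M |A. A \<in> sets borel} \<subseteq> sets H"
    using g sp by (intro sets.sigma_sets_subset[of _ H, unfolded sp]) (auto intro: measurable_sets[of g H, unfolded sp])
  have "indep_set (sigma_sets (space M) {f -` A \<inter> space M |A. A \<in> sets borel})
      (sigma_sets (space M) {g -` A \<inter> space M |A. A \<in> sets borel})"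
    using ind * ** unfolding indep_sets2_eq by blast
  then show ?thesis
    unfolding indep_var_eq using measurable_from_subalg[OF G f] measurable_from_subalg[OF H g] by blast
qed

text \<open>
  Every event of \<open>F\<close> agrees up to a null set with one of \<open>H\<close> and
  therefore is independent of \<open>u\<close>, so its contribution to the integral of
  \<open>u\<close> is the mean of \<open>u\<close> times its probability.
\<close>

lemma (in prob_space) real_cond_exp_indep:
  assumes ind: "indep_set (sets G) (sets H)" and G: "subalgebra M G" and H: "subalgebra M H"
    and F: "subalgebra M F"
    and FH: "\<And>E. E \<in> sets F \<Longrightarrow> \<exists>E'\<in>sets H. AE \<omega> in M. \<omega> \<in> E \<longleftrightarrow> \<omega> \<in> E'"
    and u: "u \<in> borel_measurable G" and ui: "integrable M u"
  shows "AE \<omega> in M. real_cond_exp M F u \<omega> = expectation u"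
proof -
  interpret finite_measure_subalgebra M F
    by unfold_locales (rule F)
  show ?thesis
  proof (rule real_cond_exp_charact)
    fix E assume E: "E \<in> sets F"
    then have EM[measurable]: "E \<in> sets M" using F by (auto simp: subalgebra_def)
    obtain E' where E': "E' \<in> sets H" and EE: "AE \<omega> in M. \<omega> \<in> E \<longleftrightarrow> \<omega> \<in> E'"
      using FH[OF E] by blast
    have E'M[measurable]: "E' \<in> sets M" using H E' by (auto simp: subalgebra_def)
    have [measurable]: "u \<in> borel_measurable M" using ui by simp
    have "indep_var borel u borel (indicator E' :: 'a \<Rightarrow> real)"
      using E' by (intro indep_var_if_sigma_indep[OF ind G H u]) simp
    from indep_var_lebesgue_integral[OF this ui integrable_real_indicator[OF E'M]]
    have "expectation (\<lambda>\<omega>. u \<omega> * indicator E' \<omega>) = expectation u * prob E'" by (simp add: less_top[symmetric])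
    moreover have "prob E' = prob E"
      using EE by (intro measure_eq_AE) auto
    moreover have "(\<integral>\<omega>\<in>E. u \<omega> \<partial>M) = expectation (\<lambda>\<omega>. u \<omega> * indicator E' \<omega>)"
      unfolding set_lebesgue_integral_def
      by (rule integral_cong_AE) (measurable, use EE in \<open>eventually_elim, auto simp: indicator_def\<close>)
    ultimately show "(\<integral>\<omega>\<in>E. u \<omega> \<partial>M) = (\<integral>\<omega>\<in>E. expectation u \<partial>M)"
      by (simp add: set_lebesgue_integral_def)
  qed (use ui in auto)
qed

text \<open>
  Truncation to the event on which \<open>p\<close> and \<open>q\<close> are bounded by
  \<open>n\<close> makes every term integrable; these events belong to \<open>F\<close> and
  exhaust the space.
\<close>

lemma (in finite_measure_subalgebra) real_cond_exp_affine:
  fixes p q :: "'a \<Rightarrow> real"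
  assumes p[measurable]: "p \<in> borel_measurable F" and q[measurable]: "q \<in> borel_measurable F"
    and V: "integrable M V" and VF: "AE \<omega> in M. real_cond_exp M F V \<omega> = v"
    and f[measurable]: "f \<in> borel_measurable M" and fe: "AE \<omega> in M. f \<omega> = p \<omega> * V \<omega> + q \<omega>"
  shows "AE \<omega> in M. real_cond_exp M F f \<omega> = p \<omega> * v + q \<omega>"
proof -
  have [measurable]: "p \<in> borel_measurable M" "q \<in> borel_measurable M"
    by (rule measurable_from_subalg[OF subalg]; fact)+
  have [measurable]: "V \<in> borel_measurable M" using V by simp
  have "AE \<omega> in M. \<bar>p \<omega>\<bar> \<le> real n \<and> \<bar>q \<omega>\<bar> \<le> real n \<longrightarrow> real_cond_exp M F f \<omega> = p \<omega> * v + q \<omega>" for n :: nat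
  proof -
    define a where "a = (\<lambda>\<omega>. if \<bar>p \<omega>\<bar> \<le> real n \<and> \<bar>q \<omega>\<bar> \<le> real n then 1 else 0 :: real)"
    have aF[measurable]: "a \<in> borel_measurable F" unfolding a_def by measurable
    have aM[measurable]: "a \<in> borel_measurable M" by (rule measurable_from_subalg[OF subalg aF])
    have i1: "integrable M (\<lambda>\<omega>. (a \<omega> * p \<omega>) * V \<omega>)"
    proof (rule Bochner_Integration.integrable_bound)
      show "integrable M (\<lambda>\<omega>. real n * V \<omega>)" using V by simp
      show "AE \<omega> in M. norm (a \<omega> * p \<omega> * V \<omega>) \<le> norm (real n * V \<omega>)"
        by (auto simp: a_def abs_mult mult_right_mono)
    qed measurable
    have i2: "integrable M (\<lambda>\<omega>. a \<omega> * q \<omega>)"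
      by (rule integrable_const_bound[of _ "real n"]) (auto simp: a_def)
    have ae: "AE \<omega> in M. a \<omega> * f \<omega> = (a \<omega> * p \<omega>) * V \<omega> + a \<omega> * q \<omega>"
      using fe by eventually_elim (simp add: algebra_simps)
    have i3: "integrable M (\<lambda>\<omega>. a \<omega> * f \<omega>)"
      using Bochner_Integration.integrable_add[OF i1 i2] ae
      by (subst integrable_cong_AE[of _ _ "\<lambda>\<omega>. (a \<omega> * p \<omega>) * V \<omega> + a \<omega> * q \<omega>"]) auto
    have "AE \<omega> in M. real_cond_exp M F (\<lambda>\<omega>. a \<omega> * f \<omega>) \<omega> = a \<omega> * real_cond_exp M F f \<omega>"
      by (rule real_cond_exp_mult[OF aF f i3])
    moreover have "AE \<omega> in M. real_cond_exp M F (\<lambda>\<omega>. a \<omega> * f \<omega>) \<omega>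
        = real_cond_exp M F (\<lambda>\<omega>. (a \<omega> * p \<omega>) * V \<omega> + a \<omega> * q \<omega>) \<omega>"
      by (rule real_cond_exp_cong[OF ae]) measurable
    moreover have "AE \<omega> in M. real_cond_exp M F (\<lambda>\<omega>. (a \<omega> * p \<omega>) * V \<omega> + a \<omega> * q \<omega>) \<omega>
        = real_cond_exp M F (\<lambda>\<omega>. (a \<omega> * p \<omega>) * V \<omega>) \<omega> + real_cond_exp M F (\<lambda>\<omega>. a \<omega> * q \<omega>) \<omega>"
      by (rule real_cond_exp_add[OF i1 i2])
    moreover have "AE \<omega> in M. real_cond_exp M F (\<lambda>\<omega>. (a \<omega> * p \<omega>) * V \<omega>) \<omega>
        = (a \<omega> * p \<omega>) * real_cond_exp M F V \<omega>"
      by (rule real_cond_exp_mult[OF _ _ i1]) measurable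
    moreover have "AE \<omega> in M. real_cond_exp M F (\<lambda>\<omega>. a \<omega> * q \<omega>) \<omega> = a \<omega> * q \<omega>"
      by (rule real_cond_exp_F_meas[OF i2]) measurable
    ultimately show ?thesis
      using VF by eventually_elim (auto simp: a_def)
  qed
  then have "AE \<omega> in M. \<forall>n. \<bar>p \<omega>\<bar> \<le> real n \<and> \<bar>q \<omega>\<bar> \<le> real n \<longrightarrow> real_cond_exp M F f \<omega> = p \<omega> * v + q \<omega>"
    unfolding AE_all_countable by blast
  then show ?thesis
  proof eventually_elim
    case (elim \<omega>)
    obtain n :: nat where "max \<bar>p \<omega>\<bar> \<bar>q \<omega>\<bar> \<le> real n" using real_arch_simple by blast
    with elim show ?case by auto
  qed
qed

lemma normal_central_moments:
  assumes M: "prob_space M" and S0: "S0 > 0" and D: "distributed M lborel \<xi> (normal_density m0 (sqrt S0))"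
  shows "integrable M (\<lambda>\<omega>. (\<xi> \<omega> - m0) ^ k)"
    and "integrable M \<xi>" and "integral\<^sup>L M \<xi> = m0"
    and "integral\<^sup>L M (\<lambda>\<omega>. \<xi> \<omega> - m0) = 0"
    and "integral\<^sup>L M (\<lambda>\<omega>. (\<xi> \<omega> - m0)\<^sup>2) = S0"
    and "integral\<^sup>L M (\<lambda>\<omega>. (\<xi> \<omega> - m0) ^ 4) = 3 * S0\<^sup>2"
proof -
  interpret prob_space M by fact
  show i: "integrable M (\<lambda>\<omega>. (\<xi> \<omega> - m0) ^ k)" for k
    using integrable_normal_moment[of "sqrt S0" m0 k] S0
    by (subst distributed_integrable[OF D, symmetric]) auto
  have "integrable M (\<lambda>\<omega>. (\<xi> \<omega> - m0) ^ 1 + m0)" using i[of 1] by (intro Bochner_Integration.integrable_add) auto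
  then show i\<xi>: "integrable M \<xi>" by simp
  show E: "expectation \<xi> = m0" using S0 by (intro normal_distributed_expectation[OF _ D]) simp
  show "expectation (\<lambda>\<omega>. \<xi> \<omega> - m0) = 0" using i\<xi> E by (simp add: prob_space)
  show "expectation (\<lambda>\<omega>. (\<xi> \<omega> - m0)\<^sup>2) = S0" using normal_distributed_variance[OF _ D] S0 by (simp add: E)
  have "expectation (\<lambda>\<omega>. (\<xi> \<omega> - m0) ^ 4) = (\<integral>x. normal_density m0 (sqrt S0) x * (x - m0) ^ 4 \<partial>lborel)"
    using S0 by (intro distributed_integral[OF D, symmetric]) auto
  also have "\<dots> = 3 * S0\<^sup>2"
    using integral_normal_moment_even[of "sqrt S0" m0 2] S0
    by (simp add: fact_numeral power_mult[of "sqrt S0" 2 2, simplified] numeral_eq_Suc[symmetric] eval_nat_numeral)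
  finally show "expectation (\<lambda>\<omega>. (\<xi> \<omega> - m0) ^ 4) = 3 * S0\<^sup>2" .
qed

lemma fpf_gain_alt: "fpf_gain A C sB S = A - 1/2 * (C \<bullet> C) * S + 1/2 * (sB \<bullet> sB) / S"
  by (simp add: fpf_gain_def field_simps)

text \<open>
  With \<open>J\<close> subtracted, the filter equation is linear with coefficient
  \<open>G\<close>, so its solution is affine in the initial value, with the same coefficient for
  all initial values.
\<close>

lemma affine_filter_path:
  fixes Y :: "real \<Rightarrow> real" and \<alpha> :: "real \<Rightarrow> real"
  assumes cY: "continuous_on {0..} Y" and cJ: "continuous_on {0..} J"
    and cG: "continuous_on {0..} G" and c\<mu>: "continuous_on {0..} \<mu>" and c\<alpha>: "continuous_on {0..} \<alpha>"
    and Y: "\<And>t. t \<ge> 0 \<Longrightarrow> Y t = Y 0 + J t + integral {0..t} (\<lambda>s. \<alpha> s * \<mu> s + G s * (Y s - \<mu> s))"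
    and t: "t \<ge> 0"
  shows "Y t = exp (integral {0..t} G) * Y 0 + (J t + exp (integral {0..t} G) *
     integral {0..t} (\<lambda>s. (\<alpha> s * \<mu> s + G s * (J s - \<mu> s)) / exp (integral {0..s} G)))"
proof -
  have J0: "J 0 = 0" using Y[of 0] by simp
  have c1: "continuous_on {0..} (\<lambda>s. \<alpha> s * \<mu> s + G s * (Y s - \<mu> s))"
    and c2: "continuous_on {0..} (\<lambda>s. \<alpha> s * \<mu> s + G s * (J s - \<mu> s))"
    by (intro continuous_intros cY cJ cG c\<mu> c\<alpha>)+
  have d: "((\<lambda>t. Y t - J t) has_real_derivative G s * (Y s - J s) + (\<alpha> s * \<mu> s + G s * (J s - \<mu> s))) (at s within {0..})"
    if "s \<ge> 0" for s
  proof -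
    have "((\<lambda>t. Y t - J t) has_real_derivative \<alpha> s * \<mu> s + G s * (Y s - \<mu> s)) (at s within {0..})"
    proof (rule has_derivative_if_integral_equation[OF c1 _ that, where k = "Y 0"])
      show "Y t - J t = Y 0 + integral {0..t} (\<lambda>s. \<alpha> s * \<mu> s + G s * (Y s - \<mu> s))" if "t \<ge> 0" for t
        using Y[OF that] by linarith
    qed
    then show ?thesis by (rule DERIV_cong) (simp add: algebra_simps)
  qed
  show ?thesis
    using linear_ode_solution[OF cG c2 d t] J0 by (simp add: algebra_simps)
qed

text \<open>
  The conditional mean and variance of \<open>Y = \<Phi> \<xi> + U\<close> given the observations
  are \<open>\<Phi> m0 + U\<close> and \<open>\<Phi>\<^sup>2 S0\<close>. The definition of
  \<open>\<Phi>\<close> through \<open>\<Sigma>\<close> turns the second identity into the Riccati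
  equation.
\<close>

lemma mean_field_fpf_exact:
  fixes Z :: "real \<Rightarrow> 'a \<Rightarrow> real ^ 'm" and sB :: "real ^ 'q"
  assumes M: "prob_space M" and S0: "S0 > 0"
    and Z: "continuous_process M Z" and Z0: "AE \<omega> in M. Z 0 \<omega> = 0"
    and S: "riccati A (sB \<bullet> sB) (C \<bullet> C) S" "S 0 = S0"
    and m: "AE \<omega> in M. kalman_mean A (sB \<bullet> sB) (C \<bullet> C) S (\<lambda>t. C \<bullet> Z t \<omega>) (\<lambda>t. m t \<omega>)"
    and m0: "AE \<omega> in M. m 0 \<omega> = m0"
    and Y: "mean_field_fpf M A C sB Z Y" and Y0: "AE \<omega> in M. Y 0 \<omega> = \<xi> \<omega>"
    and \<xi>: "distributed M lborel \<xi> (normal_density m0 (sqrt S0))" "\<xi> \<in> borel_measurable G"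
    and ind: "prob_space.indep_set M (sets G) (sets H)" and G: "subalgebra M G" and H: "subalgebra M H"
    and ZH: "\<And>T E. E \<in> sets (generated_sigma M Z {0..T}) \<Longrightarrow> \<exists>E'\<in>sets H. AE \<omega> in M. \<omega> \<in> E \<longleftrightarrow> \<omega> \<in> E'"
  shows "AE \<omega> in M. \<forall>t\<ge>0. Y t \<omega> = m t \<omega> + sqrt (S t / S0) * (\<xi> \<omega> - m0)"
proof -
  interpret prob_space M by fact
  define b c where "b = sB \<bullet> sB" and "c = C \<bullet> C"
  have b: "b \<ge> 0" by (simp add: b_def)
  define F where "F = (\<lambda>t. generated_sigma M Z {0..t::real})"
  have F: "subalgebra M (F t)" for t
    unfolding F_def by (rule subalgebra_generated_sigma) (auto intro: continuous_process_measurable[OF Z])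
  from Y obtain \<mu> \<Sigma> where c\<mu>: "continuous_process M \<mu>" and c\<Sigma>: "continuous_process M \<Sigma>"
    and \<mu>E: "\<forall>t\<ge>0. AE \<omega> in M. \<mu> t \<omega> = real_cond_exp M (generated_sigma M Z {0..t}) (Y t) \<omega>"
    and \<Sigma>E: "\<forall>t\<ge>0. AE \<omega> in M. \<Sigma> t \<omega> = real_cond_exp M (generated_sigma M Z {0..t}) (\<lambda>\<omega>'. (Y t \<omega>' - \<mu> t \<omega>')\<^sup>2) \<omega>"
    and ne: "AE \<omega> in M. \<forall>t\<ge>0. \<Sigma> t \<omega> \<noteq> 0"
    and sde: "filter_sde M A C Z (\<lambda>t \<omega>. \<Sigma> t \<omega> *\<^sub>R C) (\<lambda>t \<omega>. fpf_gain A C sB (\<Sigma> t \<omega>)) \<mu> Y"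
    unfolding mean_field_fpf_def by blast
  from sde obtain J where cY: "continuous_process M Y"
    and J: "ito_integral M (\<lambda>t \<omega>. \<Sigma> t \<omega> *\<^sub>R C) Z J"
    and Yeq: "AE \<omega> in M. \<forall>t\<ge>0. Y t \<omega> = Y 0 \<omega> + J t \<omega> +
           integral {0..t} (\<lambda>s. A * \<mu> s \<omega> - ((\<Sigma> s \<omega> *\<^sub>R C) \<bullet> C) * \<mu> s \<omega> + fpf_gain A C sB (\<Sigma> s \<omega>) * (Y s \<omega> - \<mu> s \<omega>))"
    unfolding filter_sde_def by blast
  define g where "g = (\<lambda>s \<omega>. fpf_gain A C sB (\<Sigma> s \<omega>))"
  define \<alpha> where "\<alpha> = (\<lambda>s \<omega>. A - c * \<Sigma> s \<omega>)"
  define \<Phi> where "\<Phi> = (\<lambda>t \<omega>. exp (integral {0..t} (\<lambda>s. g s \<omega>)))"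
  define f where "f = (\<lambda>s \<omega>. \<alpha> s \<omega> * \<mu> s \<omega> + g s \<omega> * (J s \<omega> - \<mu> s \<omega>))"
  define U where "U = (\<lambda>t \<omega>. J t \<omega> + \<Phi> t \<omega> * integral {0..t} (\<lambda>s. f s \<omega> / \<Phi> s \<omega>))"
  have cont: "AE \<omega> in M. continuous_on {0..} (\<lambda>t. \<mu> t \<omega>) \<and> continuous_on {0..} (\<lambda>t. \<Sigma> t \<omega>)
      \<and> continuous_on {0..} (\<lambda>t. Y t \<omega>) \<and> continuous_on {0..} (\<lambda>t. J t \<omega>)"
    using continuous_process_continuous[OF c\<mu>] continuous_process_continuous[OF c\<Sigma>]
      continuous_process_continuous[OF cY] continuous_process_continuous[OF ito_integral_continuous[OF J]]
    by eventually_elim blast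
  have cont': "AE \<omega> in M. continuous_on {0..} (\<lambda>t. g t \<omega>) \<and> continuous_on {0..} (\<lambda>t. \<Phi> t \<omega>)
      \<and> continuous_on {0..} (\<lambda>t. f t \<omega>) \<and> continuous_on {0..} (\<lambda>t. U t \<omega>)"
    using cont ne
  proof eventually_elim
    case (elim \<omega>)
    then have c1: "continuous_on {0..} (\<lambda>t. \<mu> t \<omega>)" and c2: "continuous_on {0..} (\<lambda>t. \<Sigma> t \<omega>)"
      and c3: "continuous_on {0..} (\<lambda>t. J t \<omega>)" by auto
    have g: "continuous_on {0..} (\<lambda>t. g t \<omega>)"
      unfolding g_def fpf_gain_alt using elim(2) by (intro continuous_intros c2) auto
    have \<Phi>: "continuous_on {0..} (\<lambda>t. \<Phi> t \<omega>)"
      unfolding \<Phi>_def by (intro continuous_intros continuous_on_integral_Ici g)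
    have f: "continuous_on {0..} (\<lambda>t. f t \<omega>)"
      unfolding f_def \<alpha>_def by (intro continuous_intros c1 c2 c3 g)
    have "continuous_on {0..} (\<lambda>s. f s \<omega> / \<Phi> s \<omega>)"
      by (intro continuous_intros f \<Phi>) (simp add: \<Phi>_def)
    then have "continuous_on {0..} (\<lambda>t. integral {0..t} (\<lambda>s. f s \<omega> / \<Phi> s \<omega>))"
      by (rule continuous_on_integral_Ici)
    then have "continuous_on {0..} (\<lambda>t. U t \<omega>)"
      unfolding U_def by (intro continuous_on_add continuous_on_mult c3 \<Phi>)
    with g \<Phi> f show ?case by blast
  qed
  have YU: "AE \<omega> in M. \<forall>t\<ge>0. Y t \<omega> = \<Phi> t \<omega> * \<xi> \<omega> + U t \<omega>"
    using cont cont' Yeq Y0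
  proof eventually_elim
    case (elim \<omega>)
    have \<alpha>: "continuous_on {0..} (\<lambda>t. \<alpha> t \<omega>)"
      unfolding \<alpha>_def using elim(1) by (intro continuous_intros) auto
    have eq: "A * \<mu> s \<omega> - ((\<Sigma> s \<omega> *\<^sub>R C) \<bullet> C) * \<mu> s \<omega> + fpf_gain A C sB (\<Sigma> s \<omega>) * (Y s \<omega> - \<mu> s \<omega>)
        = \<alpha> s \<omega> * \<mu> s \<omega> + g s \<omega> * (Y s \<omega> - \<mu> s \<omega>)" for s
      by (simp add: \<alpha>_def g_def c_def algebra_simps)
    have paths: "continuous_on {0..} (\<lambda>t. Y t \<omega>)" "continuous_on {0..} (\<lambda>t. J t \<omega>)"
      "continuous_on {0..} (\<lambda>t. g t \<omega>)" "continuous_on {0..} (\<lambda>t. \<mu> t \<omega>)"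
      using elim(1,2) by blast+
    have Yeq: "Y t \<omega> = Y 0 \<omega> + J t \<omega> + integral {0..t} (\<lambda>s. \<alpha> s \<omega> * \<mu> s \<omega> + g s \<omega> * (Y s \<omega> - \<mu> s \<omega>))"
      if "t \<ge> 0" for t
      using elim(3) that unfolding eq by blast
    show ?case
    proof (intro allI impI)
      fix t :: real assume t: "t \<ge> 0"
      have "Y t \<omega> = exp (integral {0..t} (\<lambda>s. g s \<omega>)) * Y 0 \<omega> + (J t \<omega> + exp (integral {0..t} (\<lambda>s. g s \<omega>)) *
         integral {0..t} (\<lambda>s. (\<alpha> s \<omega> * \<mu> s \<omega> + g s \<omega> * (J s \<omega> - \<mu> s \<omega>)) / exp (integral {0..s} (\<lambda>s. g s \<omega>))))"
        by (rule affine_filter_path[OF paths \<alpha> Yeq t])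
      then show "Y t \<omega> = \<Phi> t \<omega> * \<xi> \<omega> + U t \<omega>"
        by (simp only: U_def \<Phi>_def f_def elim(4))
    qed
  qed
  \<comment> \<open>\<open>\<Phi>\<close> and \<open>U\<close> are functionals of the observations.\<close>
  have F_eq: "generated_sigma M Z {0..s} = F s" for s by (simp add: F_def)
  note \<mu>E = \<mu>E[unfolded F_eq] and \<Sigma>E = \<Sigma>E[unfolded F_eq]
  have subF: "subalgebra (F t) (F s)" if "s \<le> t" for s t
    unfolding F_def by (rule generated_sigma_mono) (use that in auto)
  have ceF: "ae_measurable M (F t) (real_cond_exp M (F s) h)" if "s \<le> t" for s t h
    by (rule ae_measurableI[OF measurable_from_subalg[OF subF[OF that] borel_measurable_cond_exp]])
  have \<mu>F: "ae_measurable M (F t) (\<mu> s)" if "0 \<le> s" "s \<le> t" for s t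
    by (rule ae_measurable_cong_AE[OF ceF[OF that(2)] \<mu>E[rule_format, OF that(1)]])
  have \<Sigma>F: "ae_measurable M (F t) (\<Sigma> s)" if "0 \<le> s" "s \<le> t" for s t
    by (rule ae_measurable_cong_AE[OF ceF[OF that(2)] \<Sigma>E[rule_format, OF that(1)]])
  have ZF: "ae_measurable M (F t) (\<lambda>\<omega>. C \<bullet> Z s \<omega>)" if "0 \<le> s" "s \<le> t" for s t
  proof (rule ae_measurableI)
    have [measurable]: "Z s \<in> borel_measurable (F t)"
      unfolding F_def by (rule generated_sigma_measurable) (use that in auto)
    show "(\<lambda>\<omega>. C \<bullet> Z s \<omega>) \<in> borel_measurable (F t)" by measurable
  qed
  have JF: "ae_measurable M (F t) (J s)" if "0 \<le> s" "s \<le> t" for s t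
    using that by (intro ito_integral_ae_measurable[OF M Z J] continuous_process_measurable[OF c\<Sigma>] \<Sigma>F ZF) auto
  have gF: "ae_measurable M (F t) (g s)" if "0 \<le> s" "s \<le> t" for s t
    unfolding g_def fpf_gain_alt using that by (intro ae_measurable_intros \<Sigma>F)
  have fF: "ae_measurable M (F t) (f s)" if "0 \<le> s" "s \<le> t" for s t
    unfolding f_def \<alpha>_def using that by (intro ae_measurable_intros \<Sigma>F \<mu>F gF JF)
  have \<Phi>F: "ae_measurable M (F t) (\<Phi> s)" if "0 \<le> s" "s \<le> t" for s t
  proof -
    have "ae_measurable M (F t) (\<lambda>\<omega>. integral {0..s} (\<lambda>u. g u \<omega>))"
    proof (rule ae_measurable_integral)
      show "AE \<omega> in M. continuous_on {0..s} (\<lambda>u. g u \<omega>)"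
        using cont' by eventually_elim (auto intro: continuous_on_subset)
    qed (use that gF in auto)
    then show ?thesis unfolding \<Phi>_def by (rule ae_measurable_compose) measurable
  qed
  have UF: "ae_measurable M (F t) (U t)" if "0 \<le> t" for t
  proof -
    have "ae_measurable M (F t) (\<lambda>\<omega>. integral {0..t} (\<lambda>s. f s \<omega> / \<Phi> s \<omega>))"
    proof (rule ae_measurable_integral)
      show "AE \<omega> in M. continuous_on {0..t} (\<lambda>s. f s \<omega> / \<Phi> s \<omega>)"
        using cont'
      proof eventually_elim
        case (elim \<omega>)
        then have "continuous_on {0..t} (\<lambda>s. f s \<omega>)" "continuous_on {0..t} (\<lambda>s. \<Phi> s \<omega>)"
          by (auto intro: continuous_on_subset)
        then show ?case by (intro continuous_intros) (auto simp: \<Phi>_def)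
      qed
    qed (use that fF \<Phi>F in \<open>auto intro: ae_measurable_divide\<close>)
    then show ?thesis unfolding U_def using that by (intro ae_measurable_intros JF \<Phi>F) auto
  qed
  note mom = normal_central_moments[OF M S0 \<xi>(1)]
  have \<mu>eq: "AE \<omega> in M. \<mu> t \<omega> = \<Phi> t \<omega> * m0 + U t \<omega>" if t: "t \<ge> 0" for t
  proof -
    interpret Ft: finite_measure_subalgebra M "F t" by unfold_locales (rule F)
    obtain p where p: "p \<in> borel_measurable (F t)" "AE \<omega> in M. \<Phi> t \<omega> = p \<omega>"
      using \<Phi>F[OF t order.refl] unfolding ae_measurable_def by blast
    obtain q where q: "q \<in> borel_measurable (F t)" "AE \<omega> in M. U t \<omega> = q \<omega>"
      using UF[OF t] unfolding ae_measurable_def by blast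
    have "AE \<omega> in M. real_cond_exp M (F t) (Y t) \<omega> = p \<omega> * m0 + q \<omega>"
    proof (rule Ft.real_cond_exp_affine[OF p(1) q(1) mom(2)])
      show "AE \<omega> in M. real_cond_exp M (F t) \<xi> \<omega> = m0"
        using real_cond_exp_indep[OF ind G H F _ \<xi>(2) mom(2)] ZH mom(3) unfolding F_def by simp
      show "Y t \<in> borel_measurable M" by (rule continuous_process_measurable[OF cY t])
      show "AE \<omega> in M. Y t \<omega> = p \<omega> * \<xi> \<omega> + q \<omega>"
        using YU p(2) q(2) by eventually_elim (use t in auto)
    qed
    with \<mu>E[rule_format, OF t] p(2) q(2) show ?thesis by eventually_elim simp
  qed
  have \<mu>all: "AE \<omega> in M. \<forall>t\<ge>0. \<mu> t \<omega> = \<Phi> t \<omega> * m0 + U t \<omega>"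
  proof (rule AE_all_times_eqI[OF \<mu>eq])
    show "AE \<omega> in M. continuous_on {0..} (\<lambda>t. \<Phi> t \<omega> * m0 + U t \<omega>)"
      using cont' by eventually_elim (auto intro!: continuous_intros)
  qed (use cont in \<open>auto elim: eventually_mono\<close>)
  have \<Sigma>eq: "AE \<omega> in M. \<Sigma> t \<omega> = (\<Phi> t \<omega>)\<^sup>2 * S0" if t: "t \<ge> 0" for t
  proof -
    interpret Ft: finite_measure_subalgebra M "F t" by unfold_locales (rule F)
    obtain p where p[measurable]: "p \<in> borel_measurable (F t)" and pe: "AE \<omega> in M. \<Phi> t \<omega> = p \<omega>"
      using \<Phi>F[OF t order.refl] unfolding ae_measurable_def by blast
    have "AE \<omega> in M. real_cond_exp M (F t) (\<lambda>\<omega>'. (Y t \<omega>' - \<mu> t \<omega>')\<^sup>2) \<omega> = (p \<omega>)\<^sup>2 * S0 + 0"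
    proof (rule Ft.real_cond_exp_affine[OF _ _ mom(1)[of 2]])
      have "(\<lambda>\<omega>. (\<xi> \<omega> - m0)\<^sup>2) \<in> borel_measurable G" using \<xi>(2) by measurable
      from real_cond_exp_indep[OF ind G H F _ this mom(1)[of 2]]
      show "AE \<omega> in M. real_cond_exp M (F t) (\<lambda>\<omega>. (\<xi> \<omega> - m0)\<^sup>2) \<omega> = S0"
        using ZH mom(5) unfolding F_def by simp
      have [measurable]: "Y t \<in> borel_measurable M" "\<mu> t \<in> borel_measurable M"
        by (rule continuous_process_measurable[OF _ t]; fact)+
      show "(\<lambda>\<omega>'. (Y t \<omega>' - \<mu> t \<omega>')\<^sup>2) \<in> borel_measurable M" by measurable
      show "AE \<omega> in M. (Y t \<omega> - \<mu> t \<omega>)\<^sup>2 = (p \<omega>)\<^sup>2 * (\<xi> \<omega> - m0)\<^sup>2 + 0"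
        using YU \<mu>all pe
      proof eventually_elim
        case (elim \<omega>)
        have "Y t \<omega> - \<mu> t \<omega> = p \<omega> * (\<xi> \<omega> - m0)" using elim t by (simp add: algebra_simps)
        then show ?case by (simp add: power_mult_distrib)
      qed
    qed measurable
    with \<Sigma>E[rule_format, OF t] pe show ?thesis by eventually_elim simp
  qed
  have \<Sigma>all: "AE \<omega> in M. \<forall>t\<ge>0. \<Sigma> t \<omega> = (\<Phi> t \<omega>)\<^sup>2 * S0"
  proof (rule AE_all_times_eqI[OF \<Sigma>eq])
    show "AE \<omega> in M. continuous_on {0..} (\<lambda>t. (\<Phi> t \<omega>)\<^sup>2 * S0)"
      using cont' by eventually_elim (auto intro!: continuous_intros)
  qed (use cont in \<open>auto elim: eventually_mono\<close>)
  have \<Sigma>S: "AE \<omega> in M. riccati A b c (\<lambda>t. \<Sigma> t \<omega>) \<and> (\<forall>t\<ge>0. \<Sigma> t \<omega> = S t) \<and> (\<forall>t\<ge>0. \<Phi> t \<omega> = sqrt (S t / S0))"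
    using \<Sigma>all cont'
  proof eventually_elim
    case (elim \<omega>)
    have \<Phi>pos: "\<Phi> t \<omega> > 0" for t by (simp add: \<Phi>_def)
    have R: "riccati A b c (\<lambda>t. \<Sigma> t \<omega>)"
      unfolding riccati_def
    proof (intro allI impI)
      fix t :: real assume t: "t \<ge> 0"
      have "((\<lambda>t. \<Phi> t \<omega>) has_real_derivative g t \<omega> * \<Phi> t \<omega>) (at t within {0..})"
        unfolding \<Phi>_def using elim(2) t
        by (auto intro!: derivative_eq_intros integral_has_real_derivative_Ici)
      then have "((\<lambda>t. (\<Phi> t \<omega>)\<^sup>2 * S0) has_real_derivative 2 * g t \<omega> * ((\<Phi> t \<omega>)\<^sup>2 * S0)) (at t within {0..})"
        by (auto intro!: derivative_eq_intros simp: power2_eq_square)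
      then have "((\<lambda>t. \<Sigma> t \<omega>) has_real_derivative 2 * g t \<omega> * ((\<Phi> t \<omega>)\<^sup>2 * S0)) (at t within {0..})"
        by (rule has_field_derivative_transform_within[where d=1]) (use elim(1) t in auto)
      moreover have "(\<Phi> t \<omega>)\<^sup>2 * S0 = \<Sigma> t \<omega>" using elim(1) t by simp
      moreover have "\<Sigma> t \<omega> \<noteq> 0" using elim(1) t \<Phi>pos[of t] S0 by simp
      then have "2 * g t \<omega> * \<Sigma> t \<omega> = riccati_rhs A b c (\<Sigma> t \<omega>)"
        by (simp add: g_def fpf_gain_alt b_def c_def field_simps power2_eq_square)
      ultimately show "((\<lambda>t. \<Sigma> t \<omega>) has_real_derivative riccati_rhs A b c (\<Sigma> t \<omega>)) (at t within {0..})"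
        by simp
    qed
    have "\<Sigma> 0 \<omega> = S 0" using elim(1) S(2) by (simp add: \<Phi>_def)
    then have eq: "\<Sigma> t \<omega> = S t" if "t \<ge> 0" for t
      using riccati_unique[OF _ R _ that, of S] S(1) by (simp add: b_def c_def)
    moreover have "\<Phi> t \<omega> = sqrt (S t / S0)" if t: "t \<ge> 0" for t
    proof -
      have "S t / S0 = (\<Phi> t \<omega>)\<^sup>2" using eq[OF t] elim(1)[rule_format, OF t] S0
        by (simp add: divide_eq_eq)
      then show ?thesis using \<Phi>pos[of t] by simp
    qed
    ultimately show ?case using R by blast
  qed
  have "AE \<omega> in M. \<forall>t\<ge>0. J t \<omega> = \<Sigma> t \<omega> * (C \<bullet> Z t \<omega>)
      - integral {0..t} (\<lambda>s. riccati_rhs A b c (\<Sigma> s \<omega>) * (C \<bullet> Z s \<omega>))"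
  proof (rule ito_integral_by_parts[OF M Z Z0 J continuous_process_measurable[OF c\<Sigma>]])
    show "AE \<omega> in M. continuous_on {0..} (\<lambda>s. riccati_rhs A b c (\<Sigma> s \<omega>)) \<and>
       (\<forall>t\<ge>0. ((\<lambda>t. \<Sigma> t \<omega>) has_real_derivative riccati_rhs A b c (\<Sigma> t \<omega>)) (at t within {0..}))"
      using \<Sigma>S
    proof eventually_elim
      case (elim \<omega>)
      then have R: "riccati A b c (\<lambda>t. \<Sigma> t \<omega>)" by simp
      show ?case by (intro conjI continuous_intros riccati_continuous[OF R] allI impI riccatiD[OF R])
    qed
  qed
  then show ?thesis
    using \<Sigma>S \<mu>all YU cont cont' m m0 continuous_process_continuous[OF Z] Z0
  proof eventually_elim
    case (elim \<omega>)
    note Jeq = elim(1) and R = elim(2)[THEN conjunct1]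
    have \<Sigma>S: "\<And>t. t \<ge> 0 \<Longrightarrow> \<Sigma> t \<omega> = S t" and \<Phi>S: "\<And>t. t \<ge> 0 \<Longrightarrow> \<Phi> t \<omega> = sqrt (S t / S0)"
      using elim(2) by blast+
    have c\<mu>: "continuous_on {0..} (\<lambda>t. \<mu> t \<omega>)" and cg: "continuous_on {0..} (\<lambda>t. g t \<omega>)"
      and cf: "continuous_on {0..} (\<lambda>t. f t \<omega>)" and c\<Phi>: "continuous_on {0..} (\<lambda>t. \<Phi> t \<omega>)"
      and c\<Sigma>: "continuous_on {0..} (\<lambda>t. \<Sigma> t \<omega>)"
      using elim(5,6) by blast+
    have J0: "J 0 \<omega> = 0" using Jeq[rule_format, of 0] elim(10) by simp
    have \<mu>0: "\<mu> 0 \<omega> = m0" using elim(3)[rule_format, of 0] J0 by (simp add: \<Phi>_def U_def)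
    have c\<alpha>\<mu>: "continuous_on {0..} (\<lambda>s. (A - c * \<Sigma> s \<omega>) * \<mu> s \<omega>)"
      by (intro continuous_intros c\<mu> c\<Sigma>)
    have \<mu>J: "\<mu> t \<omega> - J t \<omega> = \<Phi> t \<omega> * (m0 + integral {0..t} (\<lambda>s. f s \<omega> / \<Phi> s \<omega>))" if "t \<ge> 0" for t
      using elim(3)[rule_format, OF that] by (simp add: U_def algebra_simps)
    \<comment> \<open>The conditional mean inherits the mean equation: in \<open>\<mu> - J\<close> the gain \<open>g\<close> cancels.\<close>
    have d: "((\<lambda>t. \<mu> t \<omega> - J t \<omega>) has_real_derivative (A - c * \<Sigma> t \<omega>) * \<mu> t \<omega>) (at t within {0..})"
      if t: "t \<ge> 0" for t
    proof -
      have \<Phi>0: "\<Phi> t \<omega> \<noteq> 0" for t by (simp add: \<Phi>_def)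
      have cq: "continuous_on {0..} (\<lambda>s. f s \<omega> / \<Phi> s \<omega>)"
        by (intro continuous_intros cf c\<Phi>) (simp add: \<Phi>0)
      have d1: "((\<lambda>t. \<Phi> t \<omega>) has_real_derivative g t \<omega> * \<Phi> t \<omega>) (at t within {0..})"
        unfolding \<Phi>_def by (auto intro!: derivative_eq_intros integral_has_real_derivative_Ici cg t)
      have "((\<lambda>t. \<Phi> t \<omega> * (m0 + integral {0..t} (\<lambda>s. f s \<omega> / \<Phi> s \<omega>))) has_real_derivative
          g t \<omega> * \<Phi> t \<omega> * (m0 + integral {0..t} (\<lambda>s. f s \<omega> / \<Phi> s \<omega>)) + (0 + f t \<omega> / \<Phi> t \<omega>) * \<Phi> t \<omega>) (at t within {0..})"
        by (intro DERIV_mult d1 DERIV_add DERIV_const integral_has_real_derivative_Ici cq t)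
      then have "((\<lambda>t. \<mu> t \<omega> - J t \<omega>) has_real_derivative
          g t \<omega> * \<Phi> t \<omega> * (m0 + integral {0..t} (\<lambda>s. f s \<omega> / \<Phi> s \<omega>)) + (0 + f t \<omega> / \<Phi> t \<omega>) * \<Phi> t \<omega>) (at t within {0..})"
        by (rule has_field_derivative_transform_within[where d=1]) (use \<mu>J t in auto)
      moreover have "g t \<omega> * \<Phi> t \<omega> * (m0 + integral {0..t} (\<lambda>s. f s \<omega> / \<Phi> s \<omega>)) + (0 + f t \<omega> / \<Phi> t \<omega>) * \<Phi> t \<omega>
          = g t \<omega> * (\<mu> t \<omega> - J t \<omega>) + f t \<omega>"
        unfolding \<mu>J[OF t] using \<Phi>0[of t] by simp
      moreover have "\<dots> = (A - c * \<Sigma> t \<omega>) * \<mu> t \<omega>" by (simp add: f_def \<alpha>_def algebra_simps)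
      ultimately show ?thesis by simp
    qed
    have km: "kalman_mean A b c (\<lambda>t. \<Sigma> t \<omega>) (\<lambda>t. C \<bullet> Z t \<omega>) (\<lambda>t. \<mu> t \<omega>)"
      unfolding kalman_mean_def
    proof (intro conjI allI impI c\<mu>)
      fix t :: real assume t: "t \<ge> 0"
      from integral_equation_if_has_derivative[OF d t] J0 Jeq[rule_format, OF t]
      show "\<mu> t \<omega> = \<mu> 0 \<omega> + (\<Sigma> t \<omega> * (C \<bullet> Z t \<omega>)
          - integral {0..t} (\<lambda>s. riccati_rhs A b c (\<Sigma> s \<omega>) * (C \<bullet> Z s \<omega>)))
          + integral {0..t} (\<lambda>s. (A - c * \<Sigma> s \<omega>) * \<mu> s \<omega>)" by linarith
    qed
    have c\<zeta>: "continuous_on {0..} (\<lambda>t. C \<bullet> Z t \<omega>)" using elim(9) by (intro continuous_intros)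
    have \<zeta>0: "C \<bullet> Z 0 \<omega> = 0" using elim(10) by simp
    have "\<mu> t \<omega> - m t \<omega> = 0" if t: "t \<ge> 0" for t
      using kalman_mean_difference[OF S(1) R[unfolded b_def c_def] elim(7) km[unfolded b_def c_def] c\<zeta> \<zeta>0 t]
        \<mu>0 elim(8) \<Sigma>S[of 0] by simp
    moreover have "Y t \<omega> = \<mu> t \<omega> + \<Phi> t \<omega> * (\<xi> \<omega> - m0)" if "t \<ge> 0" for t
      using elim(3)[rule_format, OF that] elim(4)[rule_format, OF that] by (simp add: algebra_simps)
    ultimately show ?case using \<Phi>S by auto
  qed
qed

section \<open>Moments of Gaussian samples\<close>

definition sample_mean :: "nat \<Rightarrow> (nat \<Rightarrow> real) \<Rightarrow> real" where
  "sample_mean N x = 1 / real N * (\<Sum>i<N. x i)"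

definition sample_var :: "nat \<Rightarrow> (nat \<Rightarrow> real) \<Rightarrow> real" where
  "sample_var N x = 1 / (real N - 1) * (\<Sum>i<N. (x i - sample_mean N x)\<^sup>2)"

lemma emp_mean_eq: "emp_mean N X t \<omega> = sample_mean N (\<lambda>i. X i t \<omega>)"
  by (simp add: emp_mean_def sample_mean_def)

lemma emp_cov_eq: "emp_cov N X t \<omega> = sample_var N (\<lambda>i. X i t \<omega>)"
  by (simp add: emp_cov_def sample_var_def emp_mean_eq)

lemma sample_mean_cong: "(\<And>i. i < N \<Longrightarrow> x i = y i) \<Longrightarrow> sample_mean N x = sample_mean N y"
  by (simp add: sample_mean_def)

lemma sample_var_cong: "(\<And>i. i < N \<Longrightarrow> x i = y i) \<Longrightarrow> sample_var N x = sample_var N y"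
  using sample_mean_cong[of N x y] by (simp add: sample_var_def)

lemma sample_mean_permute:
  assumes "\<pi> permutes {..<N}" shows "sample_mean N (\<lambda>i. x (\<pi> i)) = sample_mean N x"
  using sum.permute[OF assms, of x] by (simp add: sample_mean_def o_def)

lemma sample_var_permute:
  assumes "\<pi> permutes {..<N}" shows "sample_var N (\<lambda>i. x (\<pi> i)) = sample_var N x"
  using sum.permute[OF assms, of "\<lambda>i. (x i - sample_mean N x)\<^sup>2"]
  by (simp add: sample_var_def sample_mean_permute[OF assms] o_def)

lemma sample_mean_measurable:
  "(\<And>i. i < N \<Longrightarrow> \<xi> i \<in> borel_measurable F) \<Longrightarrow> (\<lambda>\<omega>. sample_mean N (\<lambda>i. \<xi> i \<omega>)) \<in> borel_measurable F"
  unfolding sample_mean_def by (intro borel_measurable_times borel_measurable_const borel_measurable_sum) auto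

lemma sample_var_measurable:
  "(\<And>i. i < N \<Longrightarrow> \<xi> i \<in> borel_measurable F) \<Longrightarrow> (\<lambda>\<omega>. sample_var N (\<lambda>i. \<xi> i \<omega>)) \<in> borel_measurable F"
  unfolding sample_var_def
  by (intro borel_measurable_times borel_measurable_const borel_measurable_sum borel_measurable_power
      borel_measurable_diff sample_mean_measurable) auto

text \<open>
  The joint law of the sample is a product of equal factors, hence invariant under the
  transposition of \<open>i\<close> and \<open>j\<close>, and so are the sample mean and variance.
\<close>

lemma (in prob_space) iid_deviation_exchangeable:
  fixes \<xi> :: "nat \<Rightarrow> 'a \<Rightarrow> real" and h :: "real \<Rightarrow> ennreal"
  assumes ind: "indep_vars (\<lambda>_. borel) \<xi> {..<N}"
    and D: "\<And>i. i < N \<Longrightarrow> distr M borel (\<xi> i) = D"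
    and h[measurable]: "h \<in> borel_measurable borel" and i: "i < N" and j: "j < N"
  shows "(\<integral>\<^sup>+\<omega>. h (sample_var N (\<lambda>k. \<xi> k \<omega>)) * ennreal ((\<xi> i \<omega> - sample_mean N (\<lambda>k. \<xi> k \<omega>))\<^sup>2) \<partial>M)
       = (\<integral>\<^sup>+\<omega>. h (sample_var N (\<lambda>k. \<xi> k \<omega>)) * ennreal ((\<xi> j \<omega> - sample_mean N (\<lambda>k. \<xi> k \<omega>))\<^sup>2) \<partial>M)"
proof -
  let ?I = "{..<N}"
  define P where "P = (\<Pi>\<^sub>M k\<in>?I. D)"
  define f where "f = (\<lambda>i x. h (sample_var N x) * ennreal ((x i - sample_mean N x)\<^sup>2))"
  have \<xi>[measurable]: "\<xi> k \<in> borel_measurable M" if "k < N" for k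
    using ind that by (simp add: indep_vars_def)
  have DP: "prob_space D" and sD: "sets D = sets borel"
    using D[OF i, symmetric] prob_space_distr[OF \<xi>[OF i]] by simp_all
  have fm: "f k \<in> borel_measurable (\<Pi>\<^sub>M k\<in>?I. (borel :: real measure))" if "k < N" for k
  proof -
    have 1: "(\<lambda>x. sample_var N (\<lambda>k. x k)) \<in> borel_measurable (\<Pi>\<^sub>M k\<in>?I. (borel :: real measure))"
      by (rule sample_var_measurable) simp
    have 2: "(\<lambda>x. sample_mean N (\<lambda>k. x k)) \<in> borel_measurable (\<Pi>\<^sub>M k\<in>?I. (borel :: real measure))"
      by (rule sample_mean_measurable) simp
    have 3: "(\<lambda>x. x k) \<in> borel_measurable (\<Pi>\<^sub>M k\<in>?I. (borel :: real measure))" using that by simp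
    show ?thesis unfolding f_def using 1 2 3 by measurable
  qed
  have sP: "sets P = sets (\<Pi>\<^sub>M k\<in>?I. (borel :: real measure))"
    unfolding P_def by (rule sets_PiM_cong) (simp_all add: sD)
  have fP[measurable]: "f k \<in> borel_measurable P" if "k < N" for k
    using fm[OF that] by (simp cong: measurable_cong_sets add: sP)
  have law: "distr M (\<Pi>\<^sub>M k\<in>?I. borel) (\<lambda>\<omega>. \<lambda>k\<in>?I. \<xi> k \<omega>) = P"
  proof -
    have "distr M (\<Pi>\<^sub>M k\<in>?I. borel) (\<lambda>\<omega>. \<lambda>k\<in>?I. \<xi> k \<omega>) = (\<Pi>\<^sub>M k\<in>?I. distr M borel (\<xi> k))"
      using ind i \<xi> by (subst indep_vars_iff_distr_eq_PiM'[symmetric]) auto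
    also have "\<dots> = P" unfolding P_def by (rule PiM_cong) (simp_all add: D)
    finally show ?thesis .
  qed
  have toP: "(\<integral>\<^sup>+\<omega>. f k (\<lambda>k. \<xi> k \<omega>) \<partial>M) = (\<integral>\<^sup>+x. f k x \<partial>P)" if k: "k < N" for k
  proof -
    have fr: "f k (\<lambda>k. \<xi> k \<omega>) = f k (\<lambda>k\<in>?I. \<xi> k \<omega>)" for \<omega>
    proof -
      have "sample_var N (\<lambda>k. \<xi> k \<omega>) = sample_var N (\<lambda>k\<in>?I. \<xi> k \<omega>)" by (rule sample_var_cong) simp
      moreover have "sample_mean N (\<lambda>k. \<xi> k \<omega>) = sample_mean N (\<lambda>k\<in>?I. \<xi> k \<omega>)" by (rule sample_mean_cong) simp
      ultimately show ?thesis using k by (simp add: f_def)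
    qed
    have m: "(\<lambda>\<omega>. \<lambda>k\<in>?I. \<xi> k \<omega>) \<in> M \<rightarrow>\<^sub>M (\<Pi>\<^sub>M k\<in>?I. borel)"
      by (rule measurable_restrict) simp
    show ?thesis
      unfolding law[symmetric] by (subst nn_integral_distr[OF m]) (simp_all add: fr fm[OF k])
  qed
  define \<pi> where "\<pi> = Transposition.transpose i j"
  have \<pi>: "\<pi> permutes ?I" unfolding \<pi>_def using i j by (intro permutes_swap_id) auto
  have \<pi>I: "\<pi> k < N" if "k < N" for k using permutes_in_image[OF \<pi>, of k] that by simp
  have \<pi>i: "\<pi> i = j" by (simp add: \<pi>_def)
  have inv: "distr P P (\<lambda>x. \<lambda>k\<in>?I. x (\<pi> k)) = P"
    unfolding P_def
    using distr_PiM_reindex[of ?I "\<lambda>_. D" \<pi> ?I] DP permutes_inj_on[OF \<pi>] \<pi>I by auto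
  have m\<pi>: "(\<lambda>x. \<lambda>k\<in>?I. x (\<pi> k)) \<in> P \<rightarrow>\<^sub>M P"
    unfolding P_def by (rule measurable_restrict) (rule measurable_component_singleton, use \<pi>I in simp)
  have "(\<integral>\<^sup>+x. f i x \<partial>P) = (\<integral>\<^sup>+x. f i x \<partial>(distr P P (\<lambda>x. \<lambda>k\<in>?I. x (\<pi> k))))" by (simp only: inv)
  also have "\<dots> = (\<integral>\<^sup>+x. f i (\<lambda>k\<in>?I. x (\<pi> k)) \<partial>P)" by (rule nn_integral_distr[OF m\<pi>]) (simp add: fP[OF i])
  also have "\<dots> = (\<integral>\<^sup>+x. f j x \<partial>P)"
  proof (rule nn_integral_cong)
    fix x
    have "sample_var N (\<lambda>k\<in>?I. x (\<pi> k)) = sample_var N (\<lambda>k. x (\<pi> k))" by (rule sample_var_cong) simp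
    moreover have "sample_mean N (\<lambda>k\<in>?I. x (\<pi> k)) = sample_mean N (\<lambda>k. x (\<pi> k))" by (rule sample_mean_cong) simp
    ultimately show "f i (\<lambda>k\<in>?I. x (\<pi> k)) = f j x"
      using i by (simp add: f_def sample_var_permute[OF \<pi>] sample_mean_permute[OF \<pi>] \<pi>i)
  qed
  finally show ?thesis using toP[OF i] toP[OF j] by (simp add: f_def)
qed

text \<open>
  Averaging over the sample replaces the squared deviation by \<open>(N - 1) / N\<close> times the
  sample variance. This avoids moments of the inverse sample variance when \<open>h\<close> is
  unbounded near 0.
\<close>

lemma (in prob_space) iid_deviation_le_sample_var:
  fixes \<xi> :: "nat \<Rightarrow> 'a \<Rightarrow> real" and h :: "real \<Rightarrow> ennreal"
  assumes N: "N \<ge> 2" and ind: "indep_vars (\<lambda>_. borel) \<xi> {..<N}"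
    and D: "\<And>i. i < N \<Longrightarrow> distr M borel (\<xi> i) = D"
    and h[measurable]: "h \<in> borel_measurable borel" and i: "i < N"
  shows "(\<integral>\<^sup>+\<omega>. h (sample_var N (\<lambda>k. \<xi> k \<omega>)) * ennreal ((\<xi> i \<omega> - sample_mean N (\<lambda>k. \<xi> k \<omega>))\<^sup>2) \<partial>M)
      \<le> (\<integral>\<^sup>+\<omega>. h (sample_var N (\<lambda>k. \<xi> k \<omega>)) * ennreal (sample_var N (\<lambda>k. \<xi> k \<omega>)) \<partial>M)"
    (is "?E i \<le> ?V")
proof -
  have \<xi>[measurable]: "\<xi> k \<in> borel_measurable M" if "k < N" for k
    using ind that by (simp add: indep_vars_def)
  have [measurable]: "(\<lambda>\<omega>. sample_var N (\<lambda>k. \<xi> k \<omega>)) \<in> borel_measurable M"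
    "(\<lambda>\<omega>. sample_mean N (\<lambda>k. \<xi> k \<omega>)) \<in> borel_measurable M"
    by (auto intro: sample_var_measurable sample_mean_measurable)
  have "of_nat N * ?E i = (\<Sum>k<N. ?E i)" by simp
  also have "\<dots> = (\<Sum>k<N. ?E k)"
    by (intro sum.cong refl iid_deviation_exchangeable[OF ind D h i]) simp_all
  also have "\<dots> = (\<integral>\<^sup>+\<omega>. (\<Sum>k<N. h (sample_var N (\<lambda>k. \<xi> k \<omega>)) * ennreal ((\<xi> k \<omega> - sample_mean N (\<lambda>k. \<xi> k \<omega>))\<^sup>2)) \<partial>M)"
    by (rule nn_integral_sum[symmetric]) (use \<xi> in measurable)
  also have "\<dots> = (\<integral>\<^sup>+\<omega>. ennreal (real N - 1) * (h (sample_var N (\<lambda>k. \<xi> k \<omega>)) * ennreal (sample_var N (\<lambda>k. \<xi> k \<omega>))) \<partial>M)"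
  proof (rule nn_integral_cong)
    fix \<omega>
    let ?v = "sample_var N (\<lambda>k. \<xi> k \<omega>)" and ?m = "sample_mean N (\<lambda>k. \<xi> k \<omega>)"
    have "(\<Sum>k<N. (\<xi> k \<omega> - ?m)\<^sup>2) = (real N - 1) * ?v"
      using N by (simp add: sample_var_def)
    moreover have "?v \<ge> 0" unfolding sample_var_def using N by (intro mult_nonneg_nonneg sum_nonneg) auto
    ultimately have "ennreal (\<Sum>k<N. (\<xi> k \<omega> - ?m)\<^sup>2) = ennreal (real N - 1) * ennreal ?v"
      using N by (simp add: ennreal_mult)
    then show "(\<Sum>k<N. h ?v * ennreal ((\<xi> k \<omega> - ?m)\<^sup>2)) = ennreal (real N - 1) * (h ?v * ennreal ?v)"
      by (simp add: sum_distrib_left[symmetric] sum_ennreal mult_ac)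
  qed
  also have "\<dots> = ennreal (real N - 1) * ?V" by (rule nn_integral_cmult) measurable
  also have "\<dots> \<le> of_nat N * ?V"
    unfolding ennreal_of_nat_eq_real_of_nat by (intro mult_right_mono ennreal_leI) auto
  finally show ?thesis
    using N by (subst (asm) ennreal_mult_le_mult_iff) (auto simp: ennreal_of_nat_eq_real_of_nat)
qed

lemma (in prob_space) second_moment_indep_sum:
  fixes u :: "'i \<Rightarrow> 'a \<Rightarrow> real"
  assumes "finite I" and "indep_vars (\<lambda>_. borel) u I"
    and "\<And>i. i \<in> I \<Longrightarrow> integrable M (\<lambda>\<omega>. (u i \<omega>)\<^sup>2)"
    and "\<And>i. i \<in> I \<Longrightarrow> expectation (u i) = 0"
  shows "integrable M (\<lambda>\<omega>. (\<Sum>i\<in>I. u i \<omega>)\<^sup>2) \<and>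
    expectation (\<lambda>\<omega>. (\<Sum>i\<in>I. u i \<omega>)\<^sup>2) = (\<Sum>i\<in>I. expectation (\<lambda>\<omega>. (u i \<omega>)\<^sup>2))"
  using assms
proof (induction I rule: finite_induct)
  case (insert i I)
  let ?s = "\<lambda>\<omega>. \<Sum>i\<in>I. u i \<omega>"
  have IH: "integrable M (\<lambda>\<omega>. (?s \<omega>)\<^sup>2)" "expectation (\<lambda>\<omega>. (?s \<omega>)\<^sup>2) = (\<Sum>i\<in>I. expectation (\<lambda>\<omega>. (u i \<omega>)\<^sup>2))"
    using insert.IH[OF indep_vars_subset[OF insert.prems(1)]] insert.prems by auto
  have um: "u k \<in> borel_measurable M" if "k \<in> insert i I" for k
    using insert.prems(1) that unfolding indep_vars_def by blast
  have ui: "integrable M (u k)" if "k \<in> insert i I" for k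
    using um[OF that] insert.prems(2)[OF that] by (rule square_integrable_imp_integrable)
  have si: "integrable M ?s" by (intro Bochner_Integration.integrable_sum ui) simp
  have iv: "indep_var borel (u i) borel ?s"
    using insert.hyps insert.prems(1) by (intro indep_vars_sum)
  have ci: "integrable M (\<lambda>\<omega>. u i \<omega> * ?s \<omega>)"
    by (rule indep_var_integrable[OF iv ui si]) simp
  have c0: "expectation (\<lambda>\<omega>. u i \<omega> * ?s \<omega>) = 0"
    using indep_var_lebesgue_integral[OF iv ui si] insert.prems(3)[of i] by simp
  have eq: "(\<Sum>k\<in>insert i I. u k \<omega>)\<^sup>2 = (u i \<omega>)\<^sup>2 + 2 * (u i \<omega> * ?s \<omega>) + (?s \<omega>)\<^sup>2" for \<omega>
    using insert.hyps by (simp add: power2_sum)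
  show ?case
    unfolding eq using IH ci c0 insert.prems(2)[of i] insert.hyps by simp
qed simp

text \<open>
  With \<open>y\<close> the centred sample and \<open>T\<close> its sum, \<open>(N - 1)
  (sample_var - S0)\<close> is \<open>\<Sum>(y\<^sup>2 - S0) - (T\<^sup>2 / N - S0)\<close>. The
  first sum has independent centred terms and second moment \<open>2 N S0\<^sup>2\<close>; the
  second term has second moment \<open>2 S0\<^sup>2\<close>, since \<open>T\<close> is Gaussian
  with variance \<open>N S0\<close>. The constant 24 is what these give for all \<open>N \<ge>
  2\<close>.
\<close>

lemma (in prob_space) gaussian_sample_moments:
  fixes \<xi> :: "nat \<Rightarrow> 'a \<Rightarrow> real"
  assumes S0: "S0 > 0" and N: "N \<ge> 2" and ind: "indep_vars (\<lambda>_. borel) \<xi> {..<N}"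
    and D: "\<And>i. i < N \<Longrightarrow> distributed M lborel (\<xi> i) (normal_density m0 (sqrt S0))"
  shows "integrable M (\<lambda>\<omega>. (sample_mean N (\<lambda>k. \<xi> k \<omega>) - m0)\<^sup>2)"
    and "expectation (\<lambda>\<omega>. (sample_mean N (\<lambda>k. \<xi> k \<omega>) - m0)\<^sup>2) = S0 / real N"
    and "integrable M (\<lambda>\<omega>. (sample_var N (\<lambda>k. \<xi> k \<omega>) - S0)\<^sup>2)"
    and "expectation (\<lambda>\<omega>. (sample_var N (\<lambda>k. \<xi> k \<omega>) - S0)\<^sup>2) \<le> 24 * S0\<^sup>2 / real N"
proof -
  have \<xi>m: "\<xi> k \<in> borel_measurable M" if "k < N" for k
    using ind that by (simp add: indep_vars_def)
  define T where "T = (\<lambda>\<omega>. \<Sum>k<N. \<xi> k \<omega>)"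
  have "distributed M lborel T (normal_density (\<Sum>k<N. m0) (sqrt (\<Sum>k<N. (sqrt S0)\<^sup>2)))"
    unfolding T_def using N S0 D ind by (intro sum_indep_normal) (auto simp: lessThan_empty_iff)
  then have DT: "distributed M lborel T (normal_density (real N * m0) (sqrt (real N * S0)))"
    using S0 by simp
  have NS: "real N * S0 > 0" using N S0 by simp
  note mT = normal_central_moments[OF prob_space_axioms NS DT]
  note m\<xi> = normal_central_moments[OF prob_space_axioms S0 D]
  have mean: "sample_mean N (\<lambda>k. \<xi> k \<omega>) - m0 = 1 / real N * (T \<omega> - real N * m0)" for \<omega>
    using N by (simp add: sample_mean_def T_def field_simps)
  show "integrable M (\<lambda>\<omega>. (sample_mean N (\<lambda>k. \<xi> k \<omega>) - m0)\<^sup>2)"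
    unfolding mean power_mult_distrib by (intro integrable_mult_right mT)
  show "expectation (\<lambda>\<omega>. (sample_mean N (\<lambda>k. \<xi> k \<omega>) - m0)\<^sup>2) = S0 / real N"
    unfolding mean power_mult_distrib integral_mult_right_zero mT(5) using N by (simp add: power2_eq_square)
  define u where "u = (\<lambda>k \<omega>. (\<xi> k \<omega> - m0)\<^sup>2 - S0)"
  define q where "q = (\<lambda>\<omega>. (T \<omega> - real N * m0)\<^sup>2 / real N - S0)"
  define s where "s = (\<lambda>\<omega>. \<Sum>k<N. u k \<omega>)"
  have usq: "(u k \<omega>)\<^sup>2 = (\<xi> k \<omega> - m0) ^ 4 - 2 * S0 * (\<xi> k \<omega> - m0)\<^sup>2 + S0\<^sup>2" for k \<omega>
    by (simp add: u_def power2_eq_square power4_eq_xxxx algebra_simps)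
  have u2: "integrable M (\<lambda>\<omega>. (u k \<omega>)\<^sup>2)" "expectation (\<lambda>\<omega>. (u k \<omega>)\<^sup>2) = 2 * S0\<^sup>2" if "k < N" for k
  proof -
    note m = m\<xi>(1)[OF that] m\<xi>(5)[OF that] m\<xi>(6)[OF that]
    show "integrable M (\<lambda>\<omega>. (u k \<omega>)\<^sup>2)" unfolding usq by (simp add: m)
    have "expectation (\<lambda>\<omega>. (u k \<omega>)\<^sup>2) = 3 * S0\<^sup>2 - 2 * S0 * S0 + S0\<^sup>2"
      unfolding usq by (simp add: m prob_space)
    then show "expectation (\<lambda>\<omega>. (u k \<omega>)\<^sup>2) = 2 * S0\<^sup>2" by (simp add: power2_eq_square)
  qed
  have u1: "expectation (u k) = 0" if "k < N" for k
    unfolding u_def by (simp add: m\<xi>(1)[OF that] m\<xi>(5)[OF that] prob_space)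
  have uind: "indep_vars (\<lambda>_. borel) u {..<N}"
    unfolding u_def by (rule indep_vars_compose2[OF ind]) measurable
  have s2: "integrable M (\<lambda>\<omega>. (s \<omega>)\<^sup>2)" "expectation (\<lambda>\<omega>. (s \<omega>)\<^sup>2) = real N * (2 * S0\<^sup>2)"
    using second_moment_indep_sum[OF _ uind] u2 u1 by (auto simp: s_def)
  have qsq: "(q \<omega>)\<^sup>2 = (T \<omega> - real N * m0) ^ 4 / (real N)\<^sup>2 - 2 * S0 / real N * (T \<omega> - real N * m0)\<^sup>2 + S0\<^sup>2" for \<omega>
    using N by (simp add: q_def power2_eq_square power4_eq_xxxx field_simps)
  have q2: "integrable M (\<lambda>\<omega>. (q \<omega>)\<^sup>2)" "expectation (\<lambda>\<omega>. (q \<omega>)\<^sup>2) = 2 * S0\<^sup>2"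
  proof -
    show "integrable M (\<lambda>\<omega>. (q \<omega>)\<^sup>2)" unfolding qsq by (simp add: mT(1))
    have "expectation (\<lambda>\<omega>. (q \<omega>)\<^sup>2) = 3 * (real N * S0)\<^sup>2 / (real N)\<^sup>2 - 2 * S0 / real N * (real N * S0) + S0\<^sup>2"
      unfolding qsq by (simp add: mT(1,5,6) prob_space)
    then show "expectation (\<lambda>\<omega>. (q \<omega>)\<^sup>2) = 2 * S0\<^sup>2" using N by (simp add: power2_eq_square)
  qed
  have var: "sample_var N (\<lambda>k. \<xi> k \<omega>) - S0 = (s \<omega> - q \<omega>) / (real N - 1)" for \<omega>
  proof -
    let ?y = "\<lambda>k. \<xi> k \<omega> - m0" and ?e = "sample_mean N (\<lambda>k. \<xi> k \<omega>) - m0"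
    have sy: "(\<Sum>k<N. ?y k) = real N * ?e" using N by (simp add: sample_mean_def sum_subtractf field_simps)
    have "(\<Sum>k<N. (\<xi> k \<omega> - sample_mean N (\<lambda>k. \<xi> k \<omega>))\<^sup>2) = (\<Sum>k<N. (?y k)\<^sup>2 - 2 * ?e * ?y k + ?e\<^sup>2)"
      by (rule sum.cong) (auto simp: power2_eq_square algebra_simps)
    also have "\<dots> = (\<Sum>k<N. (?y k)\<^sup>2) - 2 * ?e * (\<Sum>k<N. ?y k) + real N * ?e\<^sup>2"
    proof -
      have "(\<Sum>k<N. 2 * ?e * ?y k) = 2 * ?e * (\<Sum>k<N. ?y k)" by (simp only: sum_distrib_left)
      then show ?thesis by (simp only: sum.distrib sum_subtractf) simp
    qed
    also have "\<dots> = (\<Sum>k<N. (?y k)\<^sup>2) - real N * ?e\<^sup>2" unfolding sy by (simp add: power2_eq_square)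
    also have "real N * ?e\<^sup>2 = (T \<omega> - real N * m0)\<^sup>2 / real N"
      unfolding mean using N by (simp add: power2_eq_square)
    finally have "(real N - 1) * sample_var N (\<lambda>k. \<xi> k \<omega>) = (\<Sum>k<N. (?y k)\<^sup>2) - (T \<omega> - real N * m0)\<^sup>2 / real N"
      using N by (simp add: sample_var_def)
    then have "(real N - 1) * (sample_var N (\<lambda>k. \<xi> k \<omega>) - S0) = s \<omega> - q \<omega>"
      by (simp add: s_def u_def q_def sum_subtractf algebra_simps)
    then show ?thesis using N by (simp add: eq_divide_eq mult.commute)
  qed
  define K where "K = 2 / (real N - 1)\<^sup>2"
  have bound: "(sample_var N (\<lambda>k. \<xi> k \<omega>) - S0)\<^sup>2 \<le> K * ((s \<omega>)\<^sup>2 + (q \<omega>)\<^sup>2)" for \<omega>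
  proof -
    have "(s \<omega> - q \<omega>)\<^sup>2 \<le> 2 * ((s \<omega>)\<^sup>2 + (q \<omega>)\<^sup>2)"
      using zero_le_power2[of "s \<omega> + q \<omega>"] by (simp add: power2_sum power2_diff)
    then have "(s \<omega> - q \<omega>)\<^sup>2 / (real N - 1)\<^sup>2 \<le> 2 * ((s \<omega>)\<^sup>2 + (q \<omega>)\<^sup>2) / (real N - 1)\<^sup>2"
      by (rule divide_right_mono) simp
    then show ?thesis unfolding var K_def by (simp add: power_divide)
  qed
  have Ki: "integrable M (\<lambda>\<omega>. K * ((s \<omega>)\<^sup>2 + (q \<omega>)\<^sup>2))" using s2 q2 by simp
  have vm: "(\<lambda>\<omega>. (sample_var N (\<lambda>k. \<xi> k \<omega>) - S0)\<^sup>2) \<in> borel_measurable M"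
    using sample_var_measurable[of N \<xi> M] \<xi>m by measurable
  show vi: "integrable M (\<lambda>\<omega>. (sample_var N (\<lambda>k. \<xi> k \<omega>) - S0)\<^sup>2)"
  proof (rule Bochner_Integration.integrable_bound[OF Ki vm], rule AE_I2)
    fix \<omega>
    show "norm ((sample_var N (\<lambda>k. \<xi> k \<omega>) - S0)\<^sup>2) \<le> norm (K * ((s \<omega>)\<^sup>2 + (q \<omega>)\<^sup>2))"
      unfolding real_norm_def abs_power2 by (rule order_trans[OF bound abs_ge_self])
  qed
  have "expectation (\<lambda>\<omega>. (sample_var N (\<lambda>k. \<xi> k \<omega>) - S0)\<^sup>2) \<le> expectation (\<lambda>\<omega>. K * ((s \<omega>)\<^sup>2 + (q \<omega>)\<^sup>2))"
    by (rule integral_mono[OF vi Ki bound])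
  also have "\<dots> = K * (real N * (2 * S0\<^sup>2) + 2 * S0\<^sup>2)" using s2 q2 by simp
  also have "\<dots> \<le> 24 * S0\<^sup>2 / real N"
  proof -
    define n where "n = real N"
    have n: "n \<ge> 2" using N by (simp add: n_def)
    have "(n + 1) * n \<le> 6 * (n - 1)\<^sup>2"
    proof -
      have "0 \<le> (n - 2) * (5 * n - 3)" using n by (intro mult_nonneg_nonneg) auto
      then show ?thesis by (simp add: power2_eq_square algebra_simps)
    qed
    then have "4 * S0\<^sup>2 * ((n + 1) * n) \<le> 4 * S0\<^sup>2 * (6 * (n - 1)\<^sup>2)"
      by (rule mult_left_mono) simp
    moreover have "(n - 1)\<^sup>2 > 0" using n by simp
    ultimately have "4 * S0\<^sup>2 * (n + 1) / (n - 1)\<^sup>2 \<le> 24 * S0\<^sup>2 / n"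
      using n by (simp add: divide_le_eq le_divide_eq algebra_simps)
    then show ?thesis by (simp add: K_def n_def[symmetric] algebra_simps add_divide_distrib)
  qed
  finally show "expectation (\<lambda>\<omega>. (sample_var N (\<lambda>k. \<xi> k \<omega>) - S0)\<^sup>2) \<le> 24 * S0\<^sup>2 / real N" .
qed

section \<open>Explicit solutions and the error bound\<close>

text \<open>
  The functional that multiplies \<open>R 0 - S 0\<close> in the difference of the means.
\<close>

lemma filter_error_functional_l2:
  fixes Z :: "real \<Rightarrow> 'a \<Rightarrow> real ^ 'm" and a b c :: real and S :: "real \<Rightarrow> real"
  defines "\<phi> \<equiv> \<lambda>t. exp (integral {0..t} (\<lambda>s. a - c * S s))"
  assumes F: "subalgebra M F" and S: "riccati a b c S"
    and \<zeta>: "l2_process M F \<zeta>" and \<zeta>0: "AE \<omega> in M. \<zeta> 0 \<omega> = 0"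
    and m: "AE \<omega> in M. kalman_mean a b c S (\<lambda>t. \<zeta> t \<omega>) (\<lambda>t. m t \<omega>)"
    and m0: "AE \<omega> in M. m 0 \<omega> = m0" and M: "prob_space M"
  shows "l2_process M F (\<lambda>t \<omega>. \<phi> t * \<zeta> t \<omega>
     - integral {0..t} (\<lambda>s. \<phi> s * ((a - c * S s) * \<zeta> s \<omega> + c * m s \<omega>)))"
proof -
  interpret prob_space M by fact
  note cS = riccati_continuous[OF S]
  have c\<phi>: "continuous_on {0..} \<phi>"
    unfolding \<phi>_def by (intro continuous_on_exp continuous_on_integral_Ici continuous_intros cS)
  have \<phi>0: "\<phi> t \<noteq> 0" for t by (simp add: \<phi>_def)
  define k where "k = (\<lambda>s. ((a - c * S s) * S s - riccati_rhs a b c (S s)) / \<phi> s)"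
  have ck: "continuous_on {0..} k"
    unfolding k_def by (intro continuous_intros cS c\<phi>) (simp add: \<phi>0)
  have lm0: "l2_process M F (\<lambda>_ _. m0)"
    by (rule l2_process_const) (simp_all add: ae_measurable_const emeasure_space_1)
  have lm: "l2_process M F m"
  proof (rule l2_process_cong)
    show "l2_process M F (\<lambda>t \<omega>. S t * \<zeta> t \<omega> + \<phi> t * (m0 + integral {0..t} (\<lambda>s. k s * \<zeta> s \<omega>)))"
      by (intro l2_process_add[OF F] l2_process_mult[OF _ _ F] l2_process_integral[OF F] \<zeta> lm0 cS c\<phi> ck)
    show "AE \<omega> in M. \<forall>t\<ge>0. m t \<omega> = S t * \<zeta> t \<omega> + \<phi> t * (m0 + integral {0..t} (\<lambda>s. k s * \<zeta> s \<omega>))"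
      using m m0 \<zeta>0 l2_process_continuous[OF \<zeta>]
    proof eventually_elim
      case (elim \<omega>)
      show ?case
        using kalman_mean_solution[OF elim(1) S elim(4,3)] elim(2) by (simp add: k_def \<phi>_def)
    qed
  qed
  have "l2_process M F (\<lambda>t \<omega>. \<phi> t * \<zeta> t \<omega>
     + (-1) * integral {0..t} (\<lambda>s. \<phi> s * ((a - c * S s) * \<zeta> s \<omega> + c * m s \<omega>)))"
    by (intro l2_process_add[OF F] l2_process_mult[OF _ _ F] l2_process_integral[OF F] \<zeta> lm c\<phi>
        continuous_on_const continuous_on_diff continuous_on_mult cS)
  then show ?thesis by simp
qed

lemma sqrt_diff_square_le:
  fixes x y :: real
  assumes "x \<ge> 0" "y > 0"
  shows "(sqrt x - sqrt y)\<^sup>2 \<le> \<bar>x - y\<bar>" and "(sqrt x - sqrt y)\<^sup>2 \<le> (x - y)\<^sup>2 / y"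
proof -
  have p: "x - y = (sqrt x - sqrt y) * (sqrt x + sqrt y)"
    using assms by (simp add: algebra_simps)
  have s: "sqrt x + sqrt y \<ge> \<bar>sqrt x - sqrt y\<bar>" "sqrt x + sqrt y \<ge> sqrt y" "sqrt y > 0"
    using assms by (auto simp: abs_if)
  have "(sqrt x - sqrt y)\<^sup>2 = \<bar>sqrt x - sqrt y\<bar> * \<bar>sqrt x - sqrt y\<bar>" by (simp add: power2_eq_square)
  also have "\<dots> \<le> \<bar>sqrt x - sqrt y\<bar> * (sqrt x + sqrt y)" by (intro mult_left_mono s) simp
  also have "\<dots> = \<bar>x - y\<bar>" unfolding p using s by (simp add: abs_mult)
  finally show "(sqrt x - sqrt y)\<^sup>2 \<le> \<bar>x - y\<bar>" .
  have "(sqrt x - sqrt y)\<^sup>2 * y = (sqrt x - sqrt y)\<^sup>2 * (sqrt y)\<^sup>2" using assms by simp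
  also have "\<dots> \<le> (sqrt x - sqrt y)\<^sup>2 * (sqrt x + sqrt y)\<^sup>2"
    using s by (intro mult_left_mono power_mono) auto
  also have "\<dots> = (x - y)\<^sup>2" unfolding p by (simp add: power_mult_distrib)
  finally show "(sqrt x - sqrt y)\<^sup>2 \<le> (x - y)\<^sup>2 / y" using assms by (simp add: le_divide_eq)
qed

text \<open>
  Multiplied by \<open>R0\<close>, the left-hand side is a squared difference of the square roots
  of \<open>R\<close> and \<open>S R0 / S0\<close>. If \<open>R0\<close> is at least half of
  \<open>S0\<close>, the latter is bounded below and the square root is Lipschitz. Otherwise
  \<open>|R0 - S0|\<close> is at least half of \<open>S0\<close>, and the linear bound is already
  quadratic in \<open>R0 - S0\<close>.
\<close>

lemma sqrt_scaling_error:
  fixes R S R0 S0 \<kappa> :: real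
  assumes "R > 0" "S > 0" "R0 > 0" "S0 > 0" "\<kappa> \<ge> 0" and RS: "\<bar>R - S\<bar> \<le> \<kappa> * \<bar>R0 - S0\<bar>"
  shows "(sqrt (R / R0) - sqrt (S / S0))\<^sup>2 * R0
      \<le> (2 * (\<kappa> + S / S0)\<^sup>2 / S + 2 * (\<kappa> + S / S0) / S0) * (R0 - S0)\<^sup>2"
proof -
  define y where "y = S * R0 / S0"
  define l where "l = \<kappa> + S / S0"
  have l: "l \<ge> 0" using assms by (simp add: l_def)
  have y: "y > 0" using assms by (simp add: y_def)
  have "(sqrt (R / R0) - sqrt (S / S0))\<^sup>2 * R0 = ((sqrt (R / R0) - sqrt (S / S0)) * sqrt R0)\<^sup>2"
    using assms by (simp add: power_mult_distrib)
  also have "(sqrt (R / R0) - sqrt (S / S0)) * sqrt R0 = sqrt R - sqrt y"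
    using assms by (simp add: y_def left_diff_distrib real_sqrt_mult[symmetric])
  finally have eq: "(sqrt (R / R0) - sqrt (S / S0))\<^sup>2 * R0 = (sqrt R - sqrt y)\<^sup>2" .
  have "R - y = (R - S) - S / S0 * (R0 - S0)" using assms by (simp add: y_def field_simps)
  then have "\<bar>R - y\<bar> \<le> \<bar>R - S\<bar> + \<bar>S / S0 * (R0 - S0)\<bar>" by linarith
  also have "\<bar>S / S0 * (R0 - S0)\<bar> = S / S0 * \<bar>R0 - S0\<bar>" using assms by (simp add: abs_mult)
  finally have d: "\<bar>R - y\<bar> \<le> l * \<bar>R0 - S0\<bar>" using RS by (simp add: l_def algebra_simps)
  have n1: "2 * l\<^sup>2 / S * (R0 - S0)\<^sup>2 \<ge> 0" and n2: "2 * l / S0 * (R0 - S0)\<^sup>2 \<ge> 0"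
    using assms l by simp_all
  have "(sqrt R - sqrt y)\<^sup>2 \<le> 2 * l\<^sup>2 / S * (R0 - S0)\<^sup>2 + 2 * l / S0 * (R0 - S0)\<^sup>2"
  proof (cases "R0 \<ge> S0 / 2")
    case True
    have yS: "y \<ge> S / 2"
    proof -
      have "S * (S0 / 2) / S0 \<le> S * R0 / S0"
        using True assms by (intro divide_right_mono mult_left_mono) auto
      then show ?thesis using assms by (simp add: y_def)
    qed
    have "(sqrt R - sqrt y)\<^sup>2 \<le> (R - y)\<^sup>2 / y" using assms y by (intro sqrt_diff_square_le) auto
    also have "\<dots> \<le> (R - y)\<^sup>2 / (S / 2)" using yS y assms by (intro divide_left_mono) auto
    also have "\<dots> \<le> (l * \<bar>R0 - S0\<bar>)\<^sup>2 / (S / 2)"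
      using assms power_mono[OF d, of 2] by (intro divide_right_mono) auto
    also have "\<dots> = 2 * l\<^sup>2 / S * (R0 - S0)\<^sup>2" by (simp add: power_mult_distrib)
    finally show ?thesis using n2 by linarith
  next
    case False
    then have big: "\<bar>R0 - S0\<bar> \<ge> S0 / 2" by linarith
    have "(sqrt R - sqrt y)\<^sup>2 \<le> \<bar>R - y\<bar>" using assms y by (intro sqrt_diff_square_le) auto
    also have "\<dots> \<le> l * \<bar>R0 - S0\<bar>" by (rule d)
    also have "\<dots> \<le> l * (\<bar>R0 - S0\<bar> * (\<bar>R0 - S0\<bar> / (S0 / 2)))"
    proof (intro mult_left_mono l)
      have "1 \<le> \<bar>R0 - S0\<bar> / (S0 / 2)" using big assms by (simp add: le_divide_eq)
      from mult_left_mono[OF this, of "\<bar>R0 - S0\<bar>"]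
      show "\<bar>R0 - S0\<bar> \<le> \<bar>R0 - S0\<bar> * (\<bar>R0 - S0\<bar> / (S0 / 2))" by simp
    qed
    also have "\<dots> = 2 * l / S0 * \<bar>R0 - S0\<bar>\<^sup>2" by (simp add: power2_eq_square)
    finally show ?thesis using n1 by simp
  qed
  then show ?thesis unfolding eq l_def[symmetric] by (simp add: distrib_right)
qed

text \<open>
  The deviation from the mean-field particle splits into the difference of the means, the
  difference of the two growth factors applied to \<open>e\<close>, and the initial error of the
  mean; the difference of the means is \<open>\<psi>\<close> times a term free of \<open>R
  t\<close>, with \<open>\<psi> \<le> exp (|a| t)\<close> since \<open>R\<close> is positive.
\<close>

lemma particle_error_path:
  fixes S R \<mu> m \<zeta> :: "real \<Rightarrow> real" and a b c t e :: real
  defines "\<phi> \<equiv> \<lambda>t. exp (integral {0..t} (\<lambda>s. a - c * S s))"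
  assumes "b \<ge> 0" "c \<ge> 0" and S: "riccati a b c S" "S 0 > 0" and R: "riccati a b c R" "R 0 > 0"
    and m: "kalman_mean a b c S \<zeta> m" and \<mu>: "kalman_mean a b c R \<zeta> \<mu>"
    and \<zeta>: "continuous_on {0..} \<zeta>" "\<zeta> 0 = 0" and t: "t \<ge> 0"
  shows "(\<mu> t + sqrt (R t / R 0) * e - (m t + sqrt (S t / S 0) * (\<mu> 0 + e - m 0)))\<^sup>2
    \<le> (6 * (exp (\<bar>a\<bar> * t))\<^sup>2 + 3 * (S t / S 0)) * (\<mu> 0 - m 0)\<^sup>2
      + 6 * (exp (\<bar>a\<bar> * t))\<^sup>2 * ((R 0 - S 0)\<^sup>2
          * (\<phi> t * \<zeta> t - integral {0..t} (\<lambda>s. \<phi> s * ((a - c * S s) * \<zeta> s + c * m s)))\<^sup>2)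
      + 3 * ((sqrt (R t / R 0) - sqrt (S t / S 0))\<^sup>2 * e\<^sup>2)"
proof -
  define L where "L = \<phi> t * \<zeta> t - integral {0..t} (\<lambda>s. \<phi> s * ((a - c * S s) * \<zeta> s + c * m s))"
  define \<psi> where "\<psi> = exp (integral {0..t} (\<lambda>s. a - c * R s))"
  define E D \<rho> \<sigma> k where "E = \<mu> 0 - m 0" and "D = R 0 - S 0" and "\<rho> = sqrt (R t / R 0)"
    and "\<sigma> = sqrt (S t / S 0)" and "k = exp (\<bar>a\<bar> * t)"
  have main: "\<mu> t - m t = \<psi> * (E + D * L)"
    using kalman_mean_difference[OF S(1) R(1) m \<mu> \<zeta> t]
    by (simp add: \<psi>_def E_def D_def L_def \<phi>_def)
  have \<psi>: "\<psi> \<le> k" "\<psi> \<ge> 0"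
  proof -
    have c: "continuous_on {0..} (\<lambda>s. a - c * R s)"
      by (intro continuous_intros riccati_continuous[OF R(1)])
    have "a - c * R s \<le> \<bar>a\<bar>" if "s \<ge> 0" for s
    proof -
      have "c * R s \<ge> 0" using riccati_pos[OF R \<open>b \<ge> 0\<close> that] \<open>c \<ge> 0\<close> by simp
      then show ?thesis by linarith
    qed
    then show "\<psi> \<le> k" unfolding \<psi>_def k_def by (rule exp_integral_le[OF c _ t])
  qed (simp add: \<psi>_def)
  have three: "(x + y + z)\<^sup>2 \<le> 3 * (x\<^sup>2 + y\<^sup>2 + z\<^sup>2)" for x y z :: real
    using zero_le_power2[of "x - y"] zero_le_power2[of "y - z"] zero_le_power2[of "x - z"]
    by (simp add: power2_eq_square algebra_simps)
  have two: "(x + y)\<^sup>2 \<le> 2 * (x\<^sup>2 + y\<^sup>2)" for x y :: real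
    using zero_le_power2[of "x - y"] by (simp add: power2_eq_square algebra_simps)
  have "\<mu> t + \<rho> * e - (m t + \<sigma> * (\<mu> 0 + e - m 0)) = \<psi> * (E + D * L) + (\<rho> - \<sigma>) * e + - (\<sigma> * E)"
    unfolding main[symmetric] by (simp add: E_def algebra_simps)
  then have "(\<mu> t + \<rho> * e - (m t + \<sigma> * (\<mu> 0 + e - m 0)))\<^sup>2
      \<le> 3 * ((\<psi> * (E + D * L))\<^sup>2 + ((\<rho> - \<sigma>) * e)\<^sup>2 + (- (\<sigma> * E))\<^sup>2)"
    by (simp only: three)
  also have "(\<psi> * (E + D * L))\<^sup>2 \<le> k\<^sup>2 * (2 * (E\<^sup>2 + (D * L)\<^sup>2))"
    unfolding power_mult_distrib[of \<psi>] using \<psi> by (intro mult_mono power_mono two) auto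
  also have "(- (\<sigma> * E))\<^sup>2 = S t / S 0 * E\<^sup>2"
    using riccati_pos[OF S \<open>b \<ge> 0\<close> t] S(2) by (simp add: power_mult_distrib \<sigma>_def)
  also have "((\<rho> - \<sigma>) * e)\<^sup>2 = (\<rho> - \<sigma>)\<^sup>2 * e\<^sup>2" by (rule power_mult_distrib)
  finally show ?thesis
    unfolding \<rho>_def[symmetric] \<sigma>_def[symmetric] E_def[symmetric] D_def[symmetric] L_def[symmetric] k_def[symmetric]
    by (simp add: algebra_simps power_mult_distrib)
qed

lemma initial_ensemble_facts:
  fixes B :: "real \<Rightarrow> 'a \<Rightarrow> real ^ 'q" and W :: "real \<Rightarrow> 'a \<Rightarrow> real ^ 'm"
  assumes M: "prob_space M" and init: "initial_ensemble M m0 S0 X B W N \<xi>"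
  shows "prob_space.indep_vars M (\<lambda>_. borel) \<xi> {..<N}"
    and "\<And>i. i < N \<Longrightarrow> distributed M lborel (\<xi> i) (normal_density m0 (sqrt S0))"
    and "prob_space.indep_set M (sets (generated_sigma M \<xi> {..<N})) (sets (model_sigma M X B W))"
    and "subalgebra M (generated_sigma M \<xi> {..<N})"
    and "\<And>i. i < N \<Longrightarrow> \<xi> i \<in> borel_measurable (generated_sigma M \<xi> {..<N})"
    and "\<And>i. i < N \<Longrightarrow> distr M borel (\<xi> i) = density lborel (normal_density m0 (sqrt S0))"
proof -
  interpret prob_space M by fact
  show "indep_vars (\<lambda>_. borel) \<xi> {..<N}"
    and D: "\<And>i. i < N \<Longrightarrow> distributed M lborel (\<xi> i) (normal_density m0 (sqrt S0))"
    and "indep_set (sets (generated_sigma M \<xi> {..<N})) (sets (model_sigma M X B W))"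
    using init unfolding initial_ensemble_def sets_model_sigma by blast+
  then show "subalgebra M (generated_sigma M \<xi> {..<N})"
    by (intro subalgebra_generated_sigma) (simp add: indep_vars_def)
  show "\<And>i. i < N \<Longrightarrow> \<xi> i \<in> borel_measurable (generated_sigma M \<xi> {..<N})"
    by (rule generated_sigma_measurable) simp
  fix i assume "i < N"
  have "distr M borel (\<xi> i) = distr M lborel (\<xi> i)" by (rule distr_cong) simp_all
  also have "\<dots> = density lborel (normal_density m0 (sqrt S0))"
    by (rule distributed_distr_eq_density[OF D[OF \<open>i < N\<close>]])
  finally show "distr M borel (\<xi> i) = density lborel (normal_density m0 (sqrt S0))" .
qed

lemma coupled_fpf_explicit:
  fixes Z :: "real \<Rightarrow> 'a \<Rightarrow> real ^ 'm" and B :: "real \<Rightarrow> 'a \<Rightarrow> real ^ 'q"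
  assumes M: "prob_space M" and S0: "S0 > 0"
    and model: "linear_gaussian_model M A C sB m0 S0 X B W Z"
    and kb: "kalman_bucy M A C sB m0 S0 Z m S"
    and N: "N \<ge> 2" and cpl: "coupled_fpf M A C sB m0 S0 X B W Z N Xp Xb"
  shows "AE \<omega> in M. riccati A (sB \<bullet> sB) (C \<bullet> C) (\<lambda>t. emp_cov N Xp t \<omega>) \<and>
       (\<forall>t\<ge>0. emp_cov N Xp t \<omega> > 0) \<and>
       kalman_mean A (sB \<bullet> sB) (C \<bullet> C) (\<lambda>t. emp_cov N Xp t \<omega>) (\<lambda>t. C \<bullet> Z t \<omega>) (\<lambda>t. emp_mean N Xp t \<omega>) \<and>
       (\<forall>t\<ge>0. \<forall>i<N. Xp i t \<omega> = emp_mean N Xp t \<omega> +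
                sqrt (emp_cov N Xp t \<omega> / emp_cov N Xp 0 \<omega>) * (Xp i 0 \<omega> - emp_mean N Xp 0 \<omega>) \<and>
              Xb i t \<omega> = m t \<omega> + sqrt (S t / S 0) * (Xp i 0 \<omega> - m 0 \<omega>))"
proof -
  interpret prob_space M by fact
  note obs = observation_l2_process[OF M S0 model]
  note kbp = kalman_bucy_path[OF M obs(2,1) kb]
  have S00: "S 0 = S0" and m0: "AE \<omega> in M. m 0 \<omega> = m0" using kb unfolding kalman_bucy_def by blast+
  have init: "initial_ensemble M m0 S0 X B W N (\<lambda>i. Xp i 0)" and fin: "finite_fpf M A C sB Z N Xp"
    and ne: "AE \<omega> in M. emp_cov N Xp 0 \<omega> \<noteq> 0"
    and mf: "\<And>i. i < N \<Longrightarrow> mean_field_fpf M A C sB Z (Xb i)"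
    and Xb0: "\<And>i. i < N \<Longrightarrow> AE \<omega> in M. Xb i 0 \<omega> = Xp i 0 \<omega>"
    using cpl unfolding coupled_fpf_def by blast+
  note ens = initial_ensemble_facts[OF M init]
  have Xb: "AE \<omega> in M. \<forall>i\<in>{..<N}. \<forall>t\<ge>0. Xb i t \<omega> = m t \<omega> + sqrt (S t / S0) * (Xp i 0 \<omega> - m0)"
    unfolding AE_finite_all[OF finite_lessThan]
  proof (intro ballI)
    fix i assume "i \<in> {..<N}"
    then have i: "i < N" by simp
    show "AE \<omega> in M. \<forall>t\<ge>0. Xb i t \<omega> = m t \<omega> + sqrt (S t / S0) * (Xp i 0 \<omega> - m0)"
      by (rule mean_field_fpf_exact[OF M S0 obs(2,1) kbp(1) S00 kbp(2) m0 mf[OF i] Xb0[OF i]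
            ens(2)[OF i] ens(5)[OF i] ens(3,4) subalgebra_model_sigma[OF model]])
         (rule observation_sets_mod_null[OF M S0 model])
  qed
  show ?thesis
    using finite_fpf_AE[OF M obs(2,1) N fin ne] Xb m0
  proof eventually_elim
    case (elim \<omega>)
    have "Xp i t \<omega> = emp_mean N Xp t \<omega> +
                sqrt (emp_cov N Xp t \<omega> / emp_cov N Xp 0 \<omega>) * (Xp i 0 \<omega> - emp_mean N Xp 0 \<omega>)"
      if "t \<ge> 0" "i < N" for t i
    proof -
      have "Xp i t \<omega> - emp_mean N Xp t \<omega> =
                sqrt (emp_cov N Xp t \<omega> / emp_cov N Xp 0 \<omega>) * (Xp i 0 \<omega> - emp_mean N Xp 0 \<omega>)"
        using elim(1) that by blast
      then show ?thesis by linarith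
    qed
    moreover have "Xb i t \<omega> = m t \<omega> + sqrt (S t / S 0) * (Xp i 0 \<omega> - m 0 \<omega>)" if "t \<ge> 0" "i < N" for t i
      using elim(2)[THEN bspec, of i, rule_format, of t] that unfolding S00 elim(3) by simp
    ultimately show ?case using elim(1) by blast
  qed
qed

text \<open>
  The expectation of each of the three terms of the pathwise bound is at most a constant times
  \<open>1 / N\<close>. In the first two this is the size of the moments of the sample mean and
  variance, where independence separates the ensemble from \<open>L\<close>; in the third,
  \<open>r\<close> expresses the growth factor as a function of the sample variance, so
  exchangeability applies.
\<close>

lemma coupled_fpf_error_bound:
  fixes Z :: "real \<Rightarrow> 'a \<Rightarrow> real ^ 'm" and B :: "real \<Rightarrow> 'a \<Rightarrow> real ^ 'q"
  assumes M: "prob_space M" and S0: "S0 > 0"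
    and model: "linear_gaussian_model M A C sB m0 S0 X B W Z"
    and kb: "kalman_bucy M A C sB m0 S0 Z m S" and t: "t \<ge> 0"
  shows "\<exists>c. \<forall>N\<ge>2. \<forall>Xp Xb. coupled_fpf M A C sB m0 S0 X B W Z N Xp Xb \<longrightarrow>
           (\<forall>i<N. integrable M (\<lambda>\<omega>. (Xp i t \<omega> - Xb i t \<omega>)\<^sup>2) \<and>
              (\<integral>\<omega>. (Xp i t \<omega> - Xb i t \<omega>)\<^sup>2 \<partial>M) \<le> c / real N)"
proof -
  interpret prob_space M by fact
  define b c where "b = sB \<bullet> sB" and "c = C \<bullet> C"
  have bc: "b \<ge> 0" "c \<ge> 0" by (simp_all add: b_def c_def)
  let ?H = "model_sigma M X B W"
  define \<zeta> where "\<zeta> = (\<lambda>t \<omega>. C \<bullet> Z t \<omega>)"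
  note obs = observation_l2_process[OF M S0 model]
  note H = subalgebra_model_sigma[OF model]
  have S: "riccati A b c S" and m: "AE \<omega> in M. kalman_mean A b c S (\<lambda>t. \<zeta> t \<omega>) (\<lambda>t. m t \<omega>)"
    unfolding b_def c_def \<zeta>_def by (rule kalman_bucy_path[OF M obs(2,1) kb])+
  have S00: "S 0 = S0" and m0: "AE \<omega> in M. m 0 \<omega> = m0" using kb unfolding kalman_bucy_def by blast+
  have Spos: "S t > 0" using riccati_pos[OF S _ bc(1) t] S0 S00 by simp
  have \<zeta>: "l2_process M ?H \<zeta>" unfolding \<zeta>_def by (rule obs(5))
  have \<zeta>0: "AE \<omega> in M. \<zeta> 0 \<omega> = 0" using obs(1) by eventually_elim (simp add: \<zeta>_def)
  define \<phi> where "\<phi> = (\<lambda>t. exp (integral {0..t} (\<lambda>s. A - c * S s)))"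
  define L where "L = (\<lambda>t \<omega>. \<phi> t * \<zeta> t \<omega> - integral {0..t} (\<lambda>s. \<phi> s * ((A - c * S s) * \<zeta> s \<omega> + c * m s \<omega>)))"
  have L: "l2_process M ?H L"
    unfolding L_def \<phi>_def by (rule filter_error_functional_l2[OF H S \<zeta> \<zeta>0 m m0 M])
  obtain g where gH: "g \<in> borel_measurable ?H" and gM[measurable]: "g \<in> borel_measurable M" and gL: "AE \<omega> in M. L t \<omega> = g \<omega>"
    using ae_measurable_obtain[OF H l2_process_ae_measurable[OF L t]] by blast
  have gi: "integrable M (\<lambda>\<omega>. (g \<omega>)\<^sup>2)"
  proof (rule integrableI_bounded)
    obtain K where "second_moment M (L t) \<le> ennreal K"
      using l2_process_bound[OF L, of t] t by blast
    moreover have "second_moment M (L t) = second_moment M g"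
      by (rule nn_integral_cong_AE) (use gL in eventually_elim, simp)
    ultimately show "(\<integral>\<^sup>+\<omega>. ennreal (norm ((g \<omega>)\<^sup>2)) \<partial>M) < \<infinity>"
      by (simp add: le_less_trans[OF _ ennreal_less_top])
  qed measurable
  define Eg where "Eg = expectation (\<lambda>\<omega>. (g \<omega>)\<^sup>2)"
  have Eg: "Eg \<ge> 0" unfolding Eg_def by (rule Bochner_Integration.integral_nonneg) simp
  define k where "k = exp (\<bar>A\<bar> * t)"
  define \<kappa> where "\<kappa> = exp (2 * \<bar>A\<bar> * t)"
  define l where "l = 2 * (\<kappa> + S t / S0)\<^sup>2 / S t + 2 * (\<kappa> + S t / S0) / S0"
  have l: "l \<ge> 0"
    unfolding l_def using Spos S0 by (intro add_nonneg_nonneg divide_nonneg_nonneg) (auto simp: \<kappa>_def intro!: mult_nonneg_nonneg add_nonneg_nonneg)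
  define c1 where "c1 = 6 * k\<^sup>2 + 3 * (S t / S0)"
  have c1: "c1 \<ge> 0" unfolding c1_def using Spos S0 by simp
  \<comment> \<open>The growth factor of the deviations as a function of the initial sample variance.\<close>
  define r where "r = (\<lambda>v. sqrt ((S t + (\<phi> t)\<^sup>2 * (v - S0) / (1 + c * (v - S0) * integral {0..t} (\<lambda>s. (\<phi> s)\<^sup>2))) / v))"
  define h where "h = (\<lambda>v. ennreal ((r v - sqrt (S t / S0))\<^sup>2))"
  have hm[measurable]: "h \<in> borel_measurable borel" unfolding h_def r_def by measurable
  define K where "K = c1 * S0 + (6 * k\<^sup>2 * Eg + 3 * l) * (24 * S0\<^sup>2)"
  show ?thesis
  proof (intro exI[of _ K] allI impI)
    fix N :: nat and Xp Xb i
    assume N: "N \<ge> 2" and cpl: "coupled_fpf M A C sB m0 S0 X B W Z N Xp Xb" and i: "i < N"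
    have init: "initial_ensemble M m0 S0 X B W N (\<lambda>i. Xp i 0)" and fin: "finite_fpf M A C sB Z N Xp"
      and mf: "mean_field_fpf M A C sB Z (Xb i)"
      using cpl i unfolding coupled_fpf_def by blast+
    note ens = initial_ensemble_facts[OF M init]
    note expl = coupled_fpf_explicit[OF M S0 model kb N cpl]
    define v where "v = (\<lambda>\<omega>. sample_var N (\<lambda>j. Xp j 0 \<omega>))"
    define e where "e = (\<lambda>\<omega>. Xp i 0 \<omega> - sample_mean N (\<lambda>j. Xp j 0 \<omega>))"
    define E where "E = (\<lambda>\<omega>. sample_mean N (\<lambda>j. Xp j 0 \<omega>) - m0)"
    define D where "D = (\<lambda>\<omega>. v \<omega> - S0)"
    have mom: "integrable M (\<lambda>\<omega>. (E \<omega>)\<^sup>2)" "expectation (\<lambda>\<omega>. (E \<omega>)\<^sup>2) = S0 / real N"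
      "integrable M (\<lambda>\<omega>. (D \<omega>)\<^sup>2)" "expectation (\<lambda>\<omega>. (D \<omega>)\<^sup>2) \<le> 24 * S0\<^sup>2 / real N"
      unfolding E_def D_def v_def by (rule gaussian_sample_moments[OF S0 N ens(1,2)]; assumption)+
    have vG: "v \<in> borel_measurable (generated_sigma M (\<lambda>i. Xp i 0) {..<N})"
      unfolding v_def by (rule sample_var_measurable) (rule ens(5))
    have vM[measurable]: "v \<in> borel_measurable M" by (rule measurable_from_subalg[OF ens(4) vG])
    have EM[measurable]: "E \<in> borel_measurable M" and eM[measurable]: "e \<in> borel_measurable M"
    proof -
      have *: "Xp j 0 \<in> borel_measurable M" if "j < N" for j
        by (rule measurable_from_subalg[OF ens(4) ens(5)[OF that]])
      have [measurable]: "(\<lambda>\<omega>. sample_mean N (\<lambda>j. Xp j 0 \<omega>)) \<in> borel_measurable M"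
        by (rule sample_mean_measurable) (rule *)
      show "E \<in> borel_measurable M" unfolding E_def by measurable
      show "e \<in> borel_measurable M" unfolding e_def using *[OF i] by measurable
    qed
    have DM[measurable]: "D \<in> borel_measurable M" unfolding D_def by measurable
    have ind: "indep_var borel (\<lambda>\<omega>. (D \<omega>)\<^sup>2) borel (\<lambda>\<omega>. (g \<omega>)\<^sup>2)"
    proof (rule indep_var_if_sigma_indep[OF ens(3,4) H])
      show "(\<lambda>\<omega>. (D \<omega>)\<^sup>2) \<in> borel_measurable (generated_sigma M (\<lambda>i. Xp i 0) {..<N})"
        unfolding D_def using vG by measurable
      show "(\<lambda>\<omega>. (g \<omega>)\<^sup>2) \<in> borel_measurable ?H" using gH by measurable
    qed
    have Dg: "integrable M (\<lambda>\<omega>. (D \<omega>)\<^sup>2 * (g \<omega>)\<^sup>2)"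
      "expectation (\<lambda>\<omega>. (D \<omega>)\<^sup>2 * (g \<omega>)\<^sup>2) = expectation (\<lambda>\<omega>. (D \<omega>)\<^sup>2) * Eg"
      unfolding Eg_def by (rule indep_var_integrable[OF ind mom(3) gi], rule indep_var_lebesgue_integral[OF ind mom(3) gi])
    have pw: "AE \<omega> in M. (Xp i t \<omega> - Xb i t \<omega>)\<^sup>2
        \<le> c1 * (E \<omega>)\<^sup>2 + 6 * k\<^sup>2 * ((D \<omega>)\<^sup>2 * (g \<omega>)\<^sup>2) + 3 * ((r (v \<omega>) - sqrt (S t / S0))\<^sup>2 * (e \<omega>)\<^sup>2)
      \<and> (r (v \<omega>) - sqrt (S t / S0))\<^sup>2 * v \<omega> \<le> l * (D \<omega>)\<^sup>2 \<and> v \<omega> > 0"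
      using expl m m0 gL \<zeta>0 l2_process_continuous[OF \<zeta>]
    proof eventually_elim
      case (elim \<omega>)
      define R where "R = (\<lambda>t. emp_cov N Xp t \<omega>)"
      define \<mu> where "\<mu> = (\<lambda>t. emp_mean N Xp t \<omega>)"
      have Rric: "riccati A b c R" and Rpos: "\<And>t. t \<ge> 0 \<Longrightarrow> R t > 0"
        and \<mu>: "kalman_mean A b c R (\<lambda>t. \<zeta> t \<omega>) \<mu>"
        using elim(1) unfolding R_def \<mu>_def b_def c_def \<zeta>_def by blast+
      have Xpe: "Xp i t \<omega> = \<mu> t + sqrt (R t / R 0) * (Xp i 0 \<omega> - \<mu> 0)"
        and Xbe: "Xb i t \<omega> = m t \<omega> + sqrt (S t / S 0) * (Xp i 0 \<omega> - m 0 \<omega>)"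
        using elim(1) i t unfolding R_def \<mu>_def by blast+
      have R0: "R 0 = v \<omega>" by (simp add: R_def v_def emp_cov_eq)
      have e: "Xp i 0 \<omega> - \<mu> 0 = e \<omega>" by (simp add: e_def \<mu>_def emp_mean_eq)
      have E: "\<mu> 0 - m 0 \<omega> = E \<omega>" by (simp add: E_def \<mu>_def emp_mean_eq elim(3))
      have Xi: "Xp i 0 \<omega> = \<mu> 0 + e \<omega>" using e by simp
      have rv: "r (v \<omega>) = sqrt (R t / R 0)"
        using riccati_closed_form[OF S Rric t] unfolding r_def \<phi>_def R0[symmetric] S00[symmetric]
        by (simp add: diff_eq_eq add.commute)
      have v: "v \<omega> > 0" using Rpos[of 0] R0 by simp
      have "S 0 > 0" using S0 S00 by simp
      note err = particle_error_path[OF bc S this Rric Rpos[OF order.refl] elim(2) \<mu> elim(6,5) t, of "e \<omega>"]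
      have "(Xp i t \<omega> - Xb i t \<omega>)\<^sup>2
        \<le> c1 * (E \<omega>)\<^sup>2 + 6 * k\<^sup>2 * ((D \<omega>)\<^sup>2 * (g \<omega>)\<^sup>2) + 3 * ((r (v \<omega>) - sqrt (S t / S0))\<^sup>2 * (e \<omega>)\<^sup>2)"
        using err elim(4)
        unfolding Xpe Xbe e rv E c1_def k_def[symmetric] Xi S00 L_def \<phi>_def D_def R0 by simp
      moreover have "(r (v \<omega>) - sqrt (S t / S0))\<^sup>2 * v \<omega> \<le> l * (D \<omega>)\<^sup>2"
      proof -
        have "\<bar>R t - S t\<bar> \<le> \<kappa> * \<bar>R 0 - S0\<bar>"
          using riccati_difference_bound[OF S Rric t bc] S0 S00 Rpos[of 0] by (simp add: \<kappa>_def)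
        from sqrt_scaling_error[OF Rpos[OF t] Spos Rpos[OF order.refl] S0 _ this]
        show ?thesis by (simp add: rv R0 l_def D_def \<kappa>_def)
      qed
      ultimately show ?case using v by blast
    qed
    have rM[measurable]: "(\<lambda>\<omega>. r (v \<omega>)) \<in> borel_measurable M" unfolding r_def by measurable
    \<comment> \<open>The third term of the pathwise bound, by exchangeability.\<close>
    have third: "(\<integral>\<^sup>+\<omega>. ennreal ((r (v \<omega>) - sqrt (S t / S0))\<^sup>2 * (e \<omega>)\<^sup>2) \<partial>M) \<le> ennreal (l * expectation (\<lambda>\<omega>. (D \<omega>)\<^sup>2))"
    proof -
      have "(\<integral>\<^sup>+\<omega>. ennreal ((r (v \<omega>) - sqrt (S t / S0))\<^sup>2 * (e \<omega>)\<^sup>2) \<partial>M) = (\<integral>\<^sup>+\<omega>. h (v \<omega>) * ennreal ((e \<omega>)\<^sup>2) \<partial>M)"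
        by (simp add: h_def ennreal_mult)
      also have "\<dots> \<le> (\<integral>\<^sup>+\<omega>. h (v \<omega>) * ennreal (v \<omega>) \<partial>M)"
        unfolding v_def e_def by (rule iid_deviation_le_sample_var[OF N ens(1,6) hm i])
      also have "\<dots> \<le> (\<integral>\<^sup>+\<omega>. ennreal (l * (D \<omega>)\<^sup>2) \<partial>M)"
      proof (rule nn_integral_mono_AE)
        show "AE \<omega> in M. h (v \<omega>) * ennreal (v \<omega>) \<le> ennreal (l * (D \<omega>)\<^sup>2)"
          using pw by eventually_elim (simp add: h_def ennreal_mult[symmetric] ennreal_leI)
      qed
      also have "\<dots> = ennreal (expectation (\<lambda>\<omega>. l * (D \<omega>)\<^sup>2))"
        using mom(3) l by (intro nn_integral_eq_integral) auto
      finally show ?thesis by simp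
    qed
    have [measurable]: "Xp i t \<in> borel_measurable M" "Xb i t \<in> borel_measurable M"
    proof -
      have "continuous_process M (Xp i)" "continuous_process M (Xb i)"
        using fin i mf unfolding finite_fpf_def mean_field_fpf_def filter_sde_def by blast+
      then show "Xp i t \<in> borel_measurable M" "Xb i t \<in> borel_measurable M"
        using t by (auto intro: continuous_process_measurable)
    qed
    have "(\<integral>\<^sup>+\<omega>. ennreal ((Xp i t \<omega> - Xb i t \<omega>)\<^sup>2) \<partial>M)
      \<le> (\<integral>\<^sup>+\<omega>. ennreal (c1 * (E \<omega>)\<^sup>2 + 6 * k\<^sup>2 * ((D \<omega>)\<^sup>2 * (g \<omega>)\<^sup>2))
            + 3 * ennreal ((r (v \<omega>) - sqrt (S t / S0))\<^sup>2 * (e \<omega>)\<^sup>2) \<partial>M)"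
    proof (rule nn_integral_mono_AE)
      show "AE \<omega> in M. ennreal ((Xp i t \<omega> - Xb i t \<omega>)\<^sup>2) \<le> ennreal (c1 * (E \<omega>)\<^sup>2 + 6 * k\<^sup>2 * ((D \<omega>)\<^sup>2 * (g \<omega>)\<^sup>2))
            + 3 * ennreal ((r (v \<omega>) - sqrt (S t / S0))\<^sup>2 * (e \<omega>)\<^sup>2)"
        using pw
      proof eventually_elim
        case (elim \<omega>)
        have "0 \<le> c1 * (E \<omega>)\<^sup>2 + 6 * k\<^sup>2 * ((D \<omega>)\<^sup>2 * (g \<omega>)\<^sup>2)" using c1 by simp
        then have "ennreal (c1 * (E \<omega>)\<^sup>2 + 6 * k\<^sup>2 * ((D \<omega>)\<^sup>2 * (g \<omega>)\<^sup>2)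
            + 3 * ((r (v \<omega>) - sqrt (S t / S0))\<^sup>2 * (e \<omega>)\<^sup>2))
          = ennreal (c1 * (E \<omega>)\<^sup>2 + 6 * k\<^sup>2 * ((D \<omega>)\<^sup>2 * (g \<omega>)\<^sup>2))
            + 3 * ennreal ((r (v \<omega>) - sqrt (S t / S0))\<^sup>2 * (e \<omega>)\<^sup>2)"
          by (subst ennreal_plus) (auto simp: ennreal_mult)
        then show ?case using elim by (metis ennreal_leI)
      qed
    qed
    also have "\<dots> = (\<integral>\<^sup>+\<omega>. ennreal (c1 * (E \<omega>)\<^sup>2 + 6 * k\<^sup>2 * ((D \<omega>)\<^sup>2 * (g \<omega>)\<^sup>2)) \<partial>M)
       + 3 * (\<integral>\<^sup>+\<omega>. ennreal ((r (v \<omega>) - sqrt (S t / S0))\<^sup>2 * (e \<omega>)\<^sup>2) \<partial>M)"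
      by (subst nn_integral_add) (simp_all add: nn_integral_cmult)
    also have "(\<integral>\<^sup>+\<omega>. ennreal (c1 * (E \<omega>)\<^sup>2 + 6 * k\<^sup>2 * ((D \<omega>)\<^sup>2 * (g \<omega>)\<^sup>2)) \<partial>M)
        = ennreal (expectation (\<lambda>\<omega>. c1 * (E \<omega>)\<^sup>2 + 6 * k\<^sup>2 * ((D \<omega>)\<^sup>2 * (g \<omega>)\<^sup>2)))"
      using mom(1) Dg(1) c1 by (intro nn_integral_eq_integral) auto
    also have "expectation (\<lambda>\<omega>. c1 * (E \<omega>)\<^sup>2 + 6 * k\<^sup>2 * ((D \<omega>)\<^sup>2 * (g \<omega>)\<^sup>2))
        = c1 * (S0 / real N) + 6 * k\<^sup>2 * (expectation (\<lambda>\<omega>. (D \<omega>)\<^sup>2) * Eg)"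
      using mom(1,2) Dg by simp
    also have "ennreal (c1 * (S0 / real N) + 6 * k\<^sup>2 * (expectation (\<lambda>\<omega>. (D \<omega>)\<^sup>2) * Eg))
        + 3 * (\<integral>\<^sup>+\<omega>. ennreal ((r (v \<omega>) - sqrt (S t / S0))\<^sup>2 * (e \<omega>)\<^sup>2) \<partial>M)
      \<le> ennreal (K / real N)"
    proof -
      let ?d = "expectation (\<lambda>\<omega>. (D \<omega>)\<^sup>2)"
      have d: "?d \<ge> 0" by (rule Bochner_Integration.integral_nonneg) simp
      have nn: "c1 * (S0 / real N) + 6 * k\<^sup>2 * (?d * Eg) \<ge> 0" "3 * (l * ?d) \<ge> 0"
        using c1 S0 d Eg l by simp_all
      have "ennreal (c1 * (S0 / real N) + 6 * k\<^sup>2 * (?d * Eg)) + 3 * (\<integral>\<^sup>+\<omega>. ennreal ((r (v \<omega>) - sqrt (S t / S0))\<^sup>2 * (e \<omega>)\<^sup>2) \<partial>M)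
        \<le> ennreal (c1 * (S0 / real N) + 6 * k\<^sup>2 * (?d * Eg)) + 3 * ennreal (l * ?d)"
        by (intro add_left_mono mult_left_mono third) simp
      also have "\<dots> = ennreal (c1 * (S0 / real N) + 6 * k\<^sup>2 * (?d * Eg) + 3 * (l * ?d))"
        using nn l d by (subst ennreal_plus) (auto simp: ennreal_mult)
      also have "\<dots> \<le> ennreal (K / real N)"
      proof (rule ennreal_leI)
        have "(6 * k\<^sup>2 * Eg + 3 * l) * ?d \<le> (6 * k\<^sup>2 * Eg + 3 * l) * (24 * S0\<^sup>2 / real N)"
          using Eg l by (intro mult_left_mono mom(4)) auto
        then show "c1 * (S0 / real N) + 6 * k\<^sup>2 * (?d * Eg) + 3 * (l * ?d) \<le> K / real N"
          by (simp add: K_def add_divide_distrib algebra_simps)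
      qed
      finally show ?thesis .
    qed
    finally have fin: "(\<integral>\<^sup>+\<omega>. ennreal ((Xp i t \<omega> - Xb i t \<omega>)\<^sup>2) \<partial>M) \<le> ennreal (K / real N)" .
    have int: "integrable M (\<lambda>\<omega>. (Xp i t \<omega> - Xb i t \<omega>)\<^sup>2)"
      by (rule integrableI_bounded) (use le_less_trans[OF fin ennreal_less_top] in simp_all)
    have "K \<ge> 0" unfolding K_def using c1 S0 Eg l by simp
    then have "expectation (\<lambda>\<omega>. (Xp i t \<omega> - Xb i t \<omega>)\<^sup>2) \<le> K / real N"
      using fin nn_integral_eq_integral[OF int] by (simp add: ennreal_le_iff)
    with int show "integrable M (\<lambda>\<omega>. (Xp i t \<omega> - Xb i t \<omega>)\<^sup>2) \<and>
              expectation (\<lambda>\<omega>. (Xp i t \<omega> - Xb i t \<omega>)\<^sup>2) \<le> K / real N" ..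
  qed
qed

theorem proposition3:
  fixes M :: "'a measure"
    and A m0 S0 :: real and C :: "real ^ 'm" and sB :: "real ^ 'q"
    and X :: "real \<Rightarrow> 'a \<Rightarrow> real" and B :: "real \<Rightarrow> 'a \<Rightarrow> real ^ 'q"
    and W Z :: "real \<Rightarrow> 'a \<Rightarrow> real ^ 'm"
    and m :: "real \<Rightarrow> 'a \<Rightarrow> real" and S :: "real \<Rightarrow> real"
  assumes "prob_space M"
    and "S0 > 0"
    and "linear_gaussian_model M A C sB m0 S0 X B W Z"
    and "kalman_bucy M A C sB m0 S0 Z m S"
    and "detectable A C"
    and "stabilizable A sB"
  shows "(\<forall>N\<ge>2. \<forall>Xp Xb. coupled_fpf M A C sB m0 S0 X B W Z N Xp Xb \<longrightarrow>
           (AE \<omega> in M. \<forall>t\<ge>0. \<forall>i<N.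
              Xp i t \<omega> = emp_mean N Xp t \<omega> +
                sqrt (emp_cov N Xp t \<omega> / emp_cov N Xp 0 \<omega>) * (Xp i 0 \<omega> - emp_mean N Xp 0 \<omega>) \<and>
              Xb i t \<omega> = m t \<omega> + sqrt (S t / S 0) * (Xp i 0 \<omega> - m 0 \<omega>))) \<and>
         (\<forall>t>0. \<exists>c N0. \<forall>N\<ge>N0. \<forall>Xp Xb. coupled_fpf M A C sB m0 S0 X B W Z N Xp Xb \<longrightarrow>
           (\<forall>i<N. integrable M (\<lambda>\<omega>. \<bar>Xp i t \<omega> - Xb i t \<omega>\<bar>\<^sup>2) \<and>
              (\<integral>\<omega>. \<bar>Xp i t \<omega> - Xb i t \<omega>\<bar>\<^sup>2 \<partial>M) \<le> c / real N))"
proof (intro conjI allI impI)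
  fix N :: nat and Xp Xb
  assume "N \<ge> 2" and "coupled_fpf M A C sB m0 S0 X B W Z N Xp Xb"
  from coupled_fpf_explicit[OF assms(1-4) this]
  show "AE \<omega> in M. \<forall>t\<ge>0. \<forall>i<N.
              Xp i t \<omega> = emp_mean N Xp t \<omega> +
                sqrt (emp_cov N Xp t \<omega> / emp_cov N Xp 0 \<omega>) * (Xp i 0 \<omega> - emp_mean N Xp 0 \<omega>) \<and>
              Xb i t \<omega> = m t \<omega> + sqrt (S t / S 0) * (Xp i 0 \<omega> - m 0 \<omega>)"
    by eventually_elim blast
next
  fix t :: real assume "t > 0"
  then have "t \<ge> 0" by simp
  from coupled_fpf_error_bound[OF assms(1-4) this]
  show "\<exists>c N0. \<forall>N\<ge>N0. \<forall>Xp Xb. coupled_fpf M A C sB m0 S0 X B W Z N Xp Xb \<longrightarrow>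
           (\<forall>i<N. integrable M (\<lambda>\<omega>. \<bar>Xp i t \<omega> - Xb i t \<omega>\<bar>\<^sup>2) \<and>
              (\<integral>\<omega>. \<bar>Xp i t \<omega> - Xb i t \<omega>\<bar>\<^sup>2 \<partial>M) \<le> c / real N)"
    unfolding power2_abs by blast
qed

end
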